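(* Let $\mathbb T$ be $\mathbb Z$ or $\mathbb R$ and $d\in\mathbb N$. Let $X=\{X(t),t\in\mathbb T^d\}$ be a stationary and stochastically continuous process which is max-i.d. with $\operatorname{essinf}X(t)=0$ for all $t$ (respectively, i.d. without Gaussian component), with a spectral representation $\{f_t,t\in\mathbb T^d\}\subset\mathcal L^{\vee}(\Omega,\mathcal B,\mu)$ (respectively, $\{f_t,t\in\mathbb T^d\}\subset\mathcal L^{+}(\Omega,\mathcal B,\mu)$ with $\{X(t),t\in\mathbb T^d\}\stackrel{d}{=}\{I^+(f_t)+c(t),t\in\mathbb T^d\}$). If the representation is minimal and the measure space $(\Omega,\mathcal B,\mu)$ is $\sigma$-finite Borel, then there exists a measurable and measure-preserving flow $\{T_t\}_{t\in\mathbb T^d}$ on $(\Omega,\mathcal B,\mu)$ such that for all $t\in\mathbb T^d$, $$f_t=f_0\circ T_t,\quad\mu\text{-a.e.}$$ In the i.d. case the function $c(t)$ is constant.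
   Context: $\stackrel{d}{=}$ denotes equality of finite-dimensional distributions. A real-valued process $X=\{X(t),t\in T\}$ is max-i.d. (resp. i.d.) if for every $n\in\mathbb N$ it equals in distribution the pointwise maximum (resp. sum) of $n$ i.i.d. processes. "Without Gaussian component" means the Gaussian part in the L\'evy triplet of every finite-dimensional distribution vanishes. Let $(\Omega,\mathcal B,\mu)$ be $\sigma$-finite and $\Pi_\mu=\{U_i,i\in J\}$ a Poisson point process on it with intensity $\mu$; functions equal $\mu$-a.e. are identified. $\mathcal L^\vee$: measurable $f:\Omega\to\mathbb R$ with $f\ge0$ $\mu$-a.e. and $\mu\{f>a\}<\infty$ for all $a>0$; $I^\vee(f):=\sup_{i\in J}f(U_i)$ ($0$ if $\Pi_\mu$ is empty). $\mathcal L^+$: measurable $f:\Omega\to\mathbb R$ with $\int\min\{1,|f|^2\}d\mu<\infty$; $I^+(f):=\lim_{\varepsilon\to0+}\{\sum_{i\in J}f(U_i)\mathbf 1_{\{|f(U_i)|>\varepsilon\}}-\int_{\{|f|>\varepsilon\}}a(f)\,d\mu\}$ (a.s. limit), where $a(u)=u$ for $|u|\le1$ and $a(u)=\operatorname{sign}(u)$ for $|u|>1$. In the max-i.d. case, $\{f_t\}\subset\mathcal L^\vee$ is a spectral representation of $X$ if $\{X(t)\}\stackrel{d}{=}\{I^\vee(f_t)\}$; in the i.d. case, $\{f_t\}\subset\mathcal L^+$ is one if $\{X(t)\}\stackrel{d}{=}\{I^+(f_t)+c(t)\}$ for some real function $c$. A representation is minimal if (i) for every $B\in\mathcal B$ there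 is $A\in\sigma\{f_t,t\in\mathbb T^d\}$ with $\mu(A\Delta B)=0$, and (ii) there is no $B\in\mathcal B$ with $\mu(B)>0$ such that for every $t$, $f_t=0$ $\mu$-a.e. on $B$. A $\sigma$-finite Borel space is a measurable space isomorphic to a complete separable metric space with its Borel $\sigma$-algebra, endowed with a $\sigma$-finite measure. A measure space isomorphism (modulo null sets) is a bijection between complements of null sets, measurable with measurable inverse, preserving measure. A measure-preserving $\mathbb T^d$-action (flow) on $(\Omega,\mathcal B,\mu)$ is a family $\{T_t\}_{t\in\mathbb T^d}$ of measure space isomorphisms $T_t:\Omega\to\Omega$ such that $T_0=\mathrm{id}$ $\mu$-a.e. and $T_t\circ T_s=T_{t+s}$ $\mu$-a.e. for all $t,s\in\mathbb T^d$. It is measurable if $(t,\omega)\mapsto T_t(\omega)$ is measurable from $\mathbb T^d\times\Omega$ (product $\sigma$-algebra; $\mathbb R^d$ with Borel sets, $\mathbb Z^d$ with all subsets) to $\Omega$. *)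

theory Defs
  imports "HOL-Probability.Probability"
begin

section \<open>Index sets\<close>

text \<open>
  Both index groups are carried as subsets of the type of real vectors, so that a process on
  either of them is a function on that type whose values off the index set are irrelevant.  The
  \<open>\<sigma>\<close>-algebra and the topology of the index set are the traces of those of the ambient
  space; on the integer lattice these are the discrete ones, see the two lemmas.
\<close>

definition integer_lattice :: "(real ^ 'd::finite) set" where
  "integer_lattice = {x. \<forall>i. x $ i \<in> \<int>}"

lemma integer_lattice_dist:
  fixes x y :: "real ^ 'd::finite"
  assumes "x \<in> integer_lattice" "y \<in> integer_lattice" "x \<noteq> y"
  shows "dist x y \<ge> 1"
proof -
  obtain i where i: "x $ i \<noteq> y $ i" using assms(3) by (auto simp: vec_eq_iff)
  have "x $ i - y $ i \<in> \<int>"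
    using assms by (auto simp: integer_lattice_def)
  then have "1 \<le> \<bar>x $ i - y $ i\<bar>" using i by (simp add: Ints_nonzero_abs_ge1)
  also have "\<dots> = dist (x $ i) (y $ i)" by (simp add: dist_real_def)
  also have "\<dots> \<le> dist x y" by (rule dist_vec_nth_le)
  finally show ?thesis .
qed

lemma at_within_integer_lattice:
  fixes x :: "real ^ 'd::finite"
  assumes "x \<in> integer_lattice"
  shows "at x within integer_lattice = bot"
proof -
  have "\<not> x islimpt integer_lattice"
    unfolding islimpt_approachable
    using integer_lattice_dist[OF _ assms] by (metis less_le_not_le zero_less_one)
  then show ?thesis by (simp add: trivial_limit_within)
qed

lemma sets_restrict_borel_integer_lattice:
  "sets (restrict_space borel (integer_lattice :: (real ^ 'd::finite) set)) = Pow integer_lattice"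
proof -
  have *: "closed S" if "S \<subseteq> (integer_lattice :: (real ^ 'd) set)" for S
  proof (rule discrete_imp_closed)
    show "\<forall>x\<in>S. \<forall>y\<in>S. dist y x < 1 \<longrightarrow> y = x"
      using that integer_lattice_dist by (metis in_mono not_less)
  qed simp
  show ?thesis
  proof (intro equalityI subsetI)
    fix S :: "(real ^ 'd) set" assume "S \<in> Pow integer_lattice"
    then have "S \<subseteq> integer_lattice" by simp
    then show "S \<in> sets (restrict_space borel integer_lattice)"
      using borel_closed[OF *[of S]] by (auto simp: sets_restrict_space image_iff)
  qed (auto simp: sets_restrict_space)
qed

section \<open>Stochastic processes\<close>

definition process_on :: "'t set \<Rightarrow> 'p measure \<Rightarrow> ('t \<Rightarrow> 'p \<Rightarrow> real) \<Rightarrow> bool" where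
  "process_on I P X \<longleftrightarrow> prob_space P \<and> (\<forall>t\<in>I. X t \<in> borel_measurable P)"

definition fdd_eq ::
  "'t set \<Rightarrow> 'p measure \<Rightarrow> ('t \<Rightarrow> 'p \<Rightarrow> real) \<Rightarrow> 'q measure \<Rightarrow> ('t \<Rightarrow> 'q \<Rightarrow> real) \<Rightarrow> bool" where
  "fdd_eq I P X Q Y \<longleftrightarrow>
     (\<forall>F. finite F \<and> F \<subseteq> I \<longrightarrow>
        distr P (PiM F (\<lambda>_. borel)) (\<lambda>\<omega>. \<lambda>t\<in>F. X t \<omega>) =
        distr Q (PiM F (\<lambda>_. borel)) (\<lambda>\<omega>. \<lambda>t\<in>F. Y t \<omega>))"

definition stationary :: "'t::plus set \<Rightarrow> 'p measure \<Rightarrow> ('t \<Rightarrow> 'p \<Rightarrow> real) \<Rightarrow> bool" where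
  "stationary I P X \<longleftrightarrow> (\<forall>s\<in>I. fdd_eq I P X P (\<lambda>t. X (t + s)))"

definition stochastically_continuous ::
  "'t::topological_space set \<Rightarrow> 'p measure \<Rightarrow> ('t \<Rightarrow> 'p \<Rightarrow> real) \<Rightarrow> bool" where
  "stochastically_continuous I P X \<longleftrightarrow>
     (\<forall>t\<in>I. \<forall>\<epsilon>>0.
        ((\<lambda>s. measure P {\<omega> \<in> space P. \<bar>X s \<omega> - X t \<omega>\<bar> > \<epsilon>}) \<longlongrightarrow> 0) (at t within I))"

definition essinf :: "'p measure \<Rightarrow> ('p \<Rightarrow> real) \<Rightarrow> ereal" where
  "essinf P Z = - esssup P (\<lambda>\<omega>. - ereal (Z \<omega>))"

definition iid_processes ::
  "'t set \<Rightarrow> nat \<Rightarrow> 'q measure \<Rightarrow> (nat \<Rightarrow> 't \<Rightarrow> 'q \<Rightarrow> real) \<Rightarrow> bool" where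
  "iid_processes I n Q Y \<longleftrightarrow>
     prob_space Q \<and>
     prob_space.indep_vars Q (\<lambda>_. PiM I (\<lambda>_. borel)) (\<lambda>i \<omega>. \<lambda>t\<in>I. Y i t \<omega>) {..<n} \<and>
     (\<forall>i<n. \<forall>j<n. fdd_eq I Q (Y i) Q (Y j))"

text \<open>
  Fixing the type of the sample space in the next two definitions costs no generality: \<open>n\<close>
  real processes can always be realised as the coordinates of a probability measure on
  \<open>nat \<Rightarrow> 't \<Rightarrow> real\<close>.
\<close>

definition max_id :: "'t set \<Rightarrow> 'p measure \<Rightarrow> ('t \<Rightarrow> 'p \<Rightarrow> real) \<Rightarrow> bool" where
  "max_id I P X \<longleftrightarrow>
     (\<forall>n\<ge>1. \<exists>(Q :: (nat \<Rightarrow> 't \<Rightarrow> real) measure) Y.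
        iid_processes I n Q Y \<and> fdd_eq I P X Q (\<lambda>t \<omega>. MAX i\<in>{..<n}. Y i t \<omega>))"

definition sum_id :: "'t set \<Rightarrow> 'p measure \<Rightarrow> ('t \<Rightarrow> 'p \<Rightarrow> real) \<Rightarrow> bool" where
  "sum_id I P X \<longleftrightarrow>
     (\<forall>n\<ge>1. \<exists>(Q :: (nat \<Rightarrow> 't \<Rightarrow> real) measure) Y.
        iid_processes I n Q Y \<and> fdd_eq I P X Q (\<lambda>t \<omega>. \<Sum>i<n. Y i t \<omega>))"

text \<open>
  \<open>has_levy_triplet F P X A \<Lambda> \<gamma>\<close>: the random vector \<open>(X t)\<close>, \<open>t \<in> F\<close>, has a
  characteristic function of Levy-Khintchine form with Gaussian covariance \<open>A\<close>, Levy measure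
  \<open>\<Lambda>\<close> on \<open>\<real>\<close>-valued functions on \<open>F\<close>, and drift \<open>\<gamma>\<close>.
\<close>

definition has_levy_triplet ::
  "'t set \<Rightarrow> 'p measure \<Rightarrow> ('t \<Rightarrow> 'p \<Rightarrow> real) \<Rightarrow>
     ('t \<Rightarrow> 't \<Rightarrow> real) \<Rightarrow> ('t \<Rightarrow> real) measure \<Rightarrow> ('t \<Rightarrow> real) \<Rightarrow> bool" where
  "has_levy_triplet F P X A \<Lambda> \<gamma> \<longleftrightarrow>
     (\<forall>s\<in>F. \<forall>t\<in>F. A s t = A t s) \<and>
     (\<forall>z. 0 \<le> (\<Sum>s\<in>F. \<Sum>t\<in>F. z s * A s t * z t)) \<and>
     sets \<Lambda> = sets (PiM F (\<lambda>_. borel)) \<and>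
     emeasure \<Lambda> {\<lambda>t\<in>F. 0} = 0 \<and>
     (\<integral>\<^sup>+x. ennreal (min 1 (\<Sum>t\<in>F. (x t)\<^sup>2)) \<partial>\<Lambda>) < \<infinity> \<and>
     (\<forall>z. (\<integral>\<omega>. iexp (\<Sum>t\<in>F. z t * X t \<omega>) \<partial>P) =
        exp (complex_of_real (- (\<Sum>s\<in>F. \<Sum>t\<in>F. z s * A s t * z t) / 2)
             + \<i> * complex_of_real (\<Sum>t\<in>F. z t * \<gamma> t)
             + (\<integral>x. iexp (\<Sum>t\<in>F. z t * x t) - 1
                     - \<i> * complex_of_real ((\<Sum>t\<in>F. z t * x t) *
                         of_bool ((\<Sum>t\<in>F. (x t)\<^sup>2) \<le> 1)) \<partial>\<Lambda>)))"

text \<open>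
  The triplet of an infinitely divisible vector exists and is unique, so the existential
  quantifier below speaks about \<^emph>\<open>the\<close> triplet.
\<close>

definition without_gaussian_component ::
  "'t set \<Rightarrow> 'p measure \<Rightarrow> ('t \<Rightarrow> 'p \<Rightarrow> real) \<Rightarrow> bool" where
  "without_gaussian_component I P X \<longleftrightarrow>
     (\<forall>F. finite F \<and> F \<subseteq> I \<longrightarrow>
        (\<exists>A \<Lambda> \<gamma>. has_levy_triplet F P X A \<Lambda> \<gamma> \<and> (\<forall>s\<in>F. \<forall>t\<in>F. A s t = 0)))"

section \<open>Poisson point processes and spectral representations\<close>

text \<open>
  A point process is given by its points \<open>U i \<omega>\<close>, \<open>i \<in> J \<omega>\<close>, where the random index set
  \<open>J \<omega>\<close> is a set of natural numbers (hence at most countable); points may be repeated.  Only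
  the counts are required to be random variables; the individual \<open>U i\<close> need not be.
\<close>

definition point_count ::
  "(nat \<Rightarrow> 'q \<Rightarrow> 'w) \<Rightarrow> ('q \<Rightarrow> nat set) \<Rightarrow> 'w set \<Rightarrow> 'q \<Rightarrow> ennreal" where
  "point_count U J B \<omega> = emeasure (count_space UNIV) {i \<in> J \<omega>. U i \<omega> \<in> B}"

definition poisson_point_process ::
  "'q measure \<Rightarrow> 'w measure \<Rightarrow> (nat \<Rightarrow> 'q \<Rightarrow> 'w) \<Rightarrow> ('q \<Rightarrow> nat set) \<Rightarrow> bool" where
  "poisson_point_process Q M U J \<longleftrightarrow>
     prob_space Q \<and>
     (\<forall>\<omega>\<in>space Q. \<forall>i\<in>J \<omega>. U i \<omega> \<in> space M) \<and>
     (\<forall>B\<in>sets M. point_count U J B \<in> borel_measurable Q) \<and>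
     (\<forall>B\<in>sets M. emeasure M B < \<infinity> \<longrightarrow>
        (\<forall>k. measure Q {\<omega> \<in> space Q. point_count U J B \<omega> = of_nat k} =
             exp (- measure M B) * measure M B ^ k / fact k)) \<and>
     (\<forall>B\<in>sets M. emeasure M B = \<infinity> \<longrightarrow> (AE \<omega> in Q. point_count U J B \<omega> = \<infinity>)) \<and>
     (\<forall>B :: nat \<Rightarrow> 'w set. range B \<subseteq> sets M \<and> disjoint_family B \<longrightarrow>
        prob_space.indep_vars Q (\<lambda>_. borel) (\<lambda>n. point_count U J (B n)) UNIV)"

definition L_max :: "'w measure \<Rightarrow> ('w \<Rightarrow> real) set" where
  "L_max M = {f \<in> borel_measurable M. (AE x in M. 0 \<le> f x) \<and>
                (\<forall>a>0. emeasure M {x \<in> space M. f x > a} < \<infinity>)}"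

definition L_sum :: "'w measure \<Rightarrow> ('w \<Rightarrow> real) set" where
  "L_sum M = {f \<in> borel_measurable M. (\<integral>\<^sup>+x. ennreal (min 1 (\<bar>f x\<bar>\<^sup>2)) \<partial>M) < \<infinity>}"

text \<open>
  The Poisson integrals are only determined up to null sets, so they are rendered as
  predicates saying that the random variable \<open>Z\<close> is a version of the integral of \<open>f\<close>.
\<close>

definition is_max_integral ::
  "'q measure \<Rightarrow> (nat \<Rightarrow> 'q \<Rightarrow> 'w) \<Rightarrow> ('q \<Rightarrow> nat set) \<Rightarrow> ('w \<Rightarrow> real) \<Rightarrow> ('q \<Rightarrow> real) \<Rightarrow> bool" where
  "is_max_integral Q U J f Z \<longleftrightarrow>
     Z \<in> borel_measurable Q \<and>
     (AE \<omega> in Q. ereal (Z \<omega>) =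
        (if J \<omega> = {} then 0 else (SUP i\<in>J \<omega>. ereal (f (U i \<omega>)))))"

definition trunc :: "real \<Rightarrow> real" where
  "trunc u = (if \<bar>u\<bar> \<le> 1 then u else sgn u)"

text \<open>
  For \<open>f \<in> L_sum M\<close> and \<open>\<epsilon> > 0\<close> the set where \<open>\<bar>f\<bar> > \<epsilon>\<close> has finite measure, so that
  the sum below is almost surely finite and the compensator is the integral of a bounded
  function over a set of finite measure.
\<close>

definition is_sum_integral ::
  "'q measure \<Rightarrow> 'w measure \<Rightarrow> (nat \<Rightarrow> 'q \<Rightarrow> 'w) \<Rightarrow> ('q \<Rightarrow> nat set) \<Rightarrow>
     ('w \<Rightarrow> real) \<Rightarrow> ('q \<Rightarrow> real) \<Rightarrow> bool" where
  "is_sum_integral Q M U J f Z \<longleftrightarrow>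
     Z \<in> borel_measurable Q \<and>
     (AE \<omega> in Q.
        ((\<lambda>\<epsilon>. (\<Sum>i\<in>{i \<in> J \<omega>. \<bar>f (U i \<omega>)\<bar> > \<epsilon>}. f (U i \<omega>))
              - (LINT x:{x \<in> space M. \<bar>f x\<bar> > \<epsilon>}|M. trunc (f x)))
         \<longlongrightarrow> Z \<omega>) (at_right 0))"

definition max_spectral_rep ::
  "'t set \<Rightarrow> 'p measure \<Rightarrow> ('t \<Rightarrow> 'p \<Rightarrow> real) \<Rightarrow> 'w measure \<Rightarrow> ('t \<Rightarrow> 'w \<Rightarrow> real) \<Rightarrow>
     'q measure \<Rightarrow> (nat \<Rightarrow> 'q \<Rightarrow> 'w) \<Rightarrow> ('q \<Rightarrow> nat set) \<Rightarrow> bool" where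
  "max_spectral_rep I P X M f Q U J \<longleftrightarrow>
     (\<forall>t\<in>I. f t \<in> L_max M) \<and>
     (\<exists>Z. (\<forall>t\<in>I. is_max_integral Q U J (f t) (Z t)) \<and> fdd_eq I P X Q Z)"

definition sum_spectral_rep ::
  "'t set \<Rightarrow> 'p measure \<Rightarrow> ('t \<Rightarrow> 'p \<Rightarrow> real) \<Rightarrow> 'w measure \<Rightarrow> ('t \<Rightarrow> 'w \<Rightarrow> real) \<Rightarrow>
     ('t \<Rightarrow> real) \<Rightarrow> 'q measure \<Rightarrow> (nat \<Rightarrow> 'q \<Rightarrow> 'w) \<Rightarrow> ('q \<Rightarrow> nat set) \<Rightarrow> bool" where
  "sum_spectral_rep I P X M f c Q U J \<longleftrightarrow>
     (\<forall>t\<in>I. f t \<in> L_sum M) \<and>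
     (\<exists>Z. (\<forall>t\<in>I. is_sum_integral Q M U J (f t) (Z t)) \<and>
          fdd_eq I P X Q (\<lambda>t \<omega>. Z t \<omega> + c t))"

definition minimal_rep :: "'t set \<Rightarrow> 'w measure \<Rightarrow> ('t \<Rightarrow> 'w \<Rightarrow> real) \<Rightarrow> bool" where
  "minimal_rep I M f \<longleftrightarrow>
     (\<forall>B\<in>sets M.
        \<exists>A\<in>sigma_sets (space M) {f t -` S \<inter> space M | t S. t \<in> I \<and> S \<in> sets borel}.
          emeasure M ((A - B) \<union> (B - A)) = 0) \<and>
     \<not> (\<exists>B\<in>sets M. emeasure M B > 0 \<and> (\<forall>t\<in>I. AE x in M. x \<in> B \<longrightarrow> f t x = 0))"

section \<open>Borel spaces and flows\<close>

definition borel_of :: "'a topology \<Rightarrow> 'a measure" where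
  "borel_of \<tau> = sigma (topspace \<tau>) {G. openin \<tau> G}"

text \<open>
  The metric space may be taken inside the same type, being in bijection with \<open>space M\<close>.
\<close>

definition sigma_finite_borel :: "'w measure \<Rightarrow> bool" where
  "sigma_finite_borel M \<longleftrightarrow>
     sigma_finite_measure M \<and>
     (\<exists>(S :: 'w set) d \<phi>.
        Metric_space S d \<and> Metric_space.mcomplete S d \<and>
        separable_space (Metric_space.mtopology S d) \<and>
        bij_betw \<phi> (space M) S \<and>
        \<phi> \<in> M \<rightarrow>\<^sub>M borel_of (Metric_space.mtopology S d) \<and>
        the_inv_into (space M) \<phi> \<in> borel_of (Metric_space.mtopology S d) \<rightarrow>\<^sub>M M)"

definition measure_space_iso_mod0 :: "'w measure \<Rightarrow> ('w \<Rightarrow> 'w) \<Rightarrow> bool" where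
  "measure_space_iso_mod0 M \<phi> \<longleftrightarrow>
     (\<exists>N1\<in>null_sets M. \<exists>N2\<in>null_sets M.
        bij_betw \<phi> (space M - N1) (space M - N2) \<and>
        \<phi> \<in> restrict_space M (space M - N1) \<rightarrow>\<^sub>M restrict_space M (space M - N2) \<and>
        the_inv_into (space M - N1) \<phi>
          \<in> restrict_space M (space M - N2) \<rightarrow>\<^sub>M restrict_space M (space M - N1) \<and>
        (\<forall>B\<in>sets M. B \<subseteq> space M - N2 \<longrightarrow>
           emeasure M (\<phi> -` B \<inter> (space M - N1)) = emeasure M B))"

definition measure_preserving_flow ::
  "'t::monoid_add set \<Rightarrow> 'w measure \<Rightarrow> ('t \<Rightarrow> 'w \<Rightarrow> 'w) \<Rightarrow> bool" where
  "measure_preserving_flow I M T \<longleftrightarrow>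
     (\<forall>t\<in>I. T t \<in> space M \<rightarrow> space M) \<and>
     (\<forall>t\<in>I. measure_space_iso_mod0 M (T t)) \<and>
     (AE x in M. T 0 x = x) \<and>
     (\<forall>t\<in>I. \<forall>s\<in>I. AE x in M. T t (T s x) = T (t + s) x)"

definition measurable_flow ::
  "'t::topological_space set \<Rightarrow> 'w measure \<Rightarrow> ('t \<Rightarrow> 'w \<Rightarrow> 'w) \<Rightarrow> bool" where
  "measurable_flow I M T \<longleftrightarrow>
     (\<lambda>(t, x). T t x) \<in> restrict_space borel I \<Otimes>\<^sub>M M \<rightarrow>\<^sub>M M"

end

theory Submission
  imports Defs
begin

text \<open>
  The spectral functions can be shifted because the law of the process determines their joint law
  away from the origin.  For finitely many indices, the image of the measure \<open>\<mu>\<close> under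
  \<open>(f\<^sub>t)\<close>, restricted to the complement of \<open>0\<close>, is the exponent measure (for maxima) or the
  Levy measure (for sums) of the random vector \<open>(X(t))\<close>.  Stationarity therefore gives the shifted
  family \<open>(f\<^bsub>t+u\<^esub>)\<close> the same image measure.  For maxima this is
  \<open>max_shift_invariant\<close>, which rests on the void probabilities of the Poisson process; for sums it is
  \<open>sum_shift_invariant\<close>, which rests on the Levy-Khintchine formula \<open>sum_integral_char\<close> and on the
  uniqueness of the Levy measure.  Stochastic continuity of \<open>X\<close> becomes continuity in measure of
  \<open>t \<mapsto> f\<^sub>t\<close> (\<open>max_continuous_at_0\<close>, \<open>sum_continuous_at_0\<close>).

  The flow is then produced by reading off a point from its path.  By minimality there are countably
  many indices \<open>s\<^sub>n\<close> such that the sequence \<open>(f\<^bsub>s\<^sub>n\<^esub>(x))\<close> determines almost every point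
  \<open>x\<close>: a measurable map \<open>G\<close> from sequences to points recovers \<open>x\<close> from it (\<open>recovery_map\<close>).
  Put \<open>T\<^sub>t x = G((f\<^bsub>s\<^sub>n+t\<^esub>(x))\<^sub>n)\<close>.  Almost everywhere statements about the sequence
  \<open>(f\<^bsub>s\<^sub>n\<^esub>)\<close> are statements about its law, hence they hold for the shifted sequence as well, and
  this yields that \<open>T\<^sub>t\<close> preserves the measure, that \<open>f\<^bsub>r+t\<^esub> = f\<^sub>r \<circ> T\<^sub>t\<close>, and from
  these two the flow property.  Since \<open>T\<^sub>t\<close> and \<open>T\<^bsub>-t\<^esub>\<close> are measurable and inverse to each other
  almost everywhere, \<open>T\<^sub>t\<close> is an isomorphism modulo null sets.  Joint measurability holds once
  the family \<open>f\<close> is replaced by a jointly measurable version (\<open>jointly_measurable_version\<close>):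
  shift invariance makes the continuity uniform in \<open>t\<close>, so one sequence of grids approximates all
  \<open>f\<^sub>t\<close> at once.

  For sums, \<open>f\<^sub>t = f\<^sub>0 \<circ> T\<^sub>t\<close> makes the integral terms in the characteristic exponents of
  \<open>X(t)\<close> and \<open>X(0)\<close> equal, and what remains of the equality of the exponents is
  \<open>c(t) = c(0)\<close>.
\<close>

section \<open>Recovering points of a standard Borel space\<close>

text \<open>
  The metric and the isomorphism to a metric space combine to a metric on \<open>space M\<close> itself.  Completeness
  is stated for sequences with a prescribed rate only; this is the form in which limits are later
  taken, and the rate survives in the bound for the limit.
\<close>

lemma sigma_finite_borel_metric:
  fixes M :: "'w measure"
  assumes "sigma_finite_borel M" "space M \<noteq> {}"
  obtains d :: "'w \<Rightarrow> 'w \<Rightarrow> real" and a :: "nat \<Rightarrow> 'w" where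
    "Metric_space (space M) d"
    "range a \<subseteq> space M"
    "\<forall>x\<in>space M. \<forall>r>0. \<exists>n. d (a n) x < r"
    "\<forall>b. range b \<subseteq> space M \<longrightarrow> (\<forall>k l. d (b k) (b l) \<le> 1 / Suc k + 1 / Suc l) \<longrightarrow>
       (\<exists>y\<in>space M. \<forall>k. d y (b k) \<le> 1 / Suc k)"
    "sets M = sigma_sets (space M) {{x \<in> space M. d (a n) x < 1 / Suc k} | n k. True}"
proof -
  obtain S :: "'w set" and d0 \<phi> where
    "Metric_space S d0" and comp: "Metric_space.mcomplete S d0" and
    sep: "separable_space (Metric_space.mtopology S d0)" and
    bij: "bij_betw \<phi> (space M) S" and
    meas: "\<phi> \<in> M \<rightarrow>\<^sub>M borel_of (Metric_space.mtopology S d0)" and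
    inv: "the_inv_into (space M) \<phi> \<in> borel_of (Metric_space.mtopology S d0) \<rightarrow>\<^sub>M M"
    using assms(1) unfolding sigma_finite_borel_def by (elim conjE exE) (rule that)
  interpret S: Metric_space S d0 by fact
  have inj: "inj_on \<phi> (space M)" and im: "\<phi> ` space M = S"
    using bij by (auto simp: bij_betw_def)
  define d where "d x y = d0 (\<phi> x) (\<phi> y)" for x y
  obtain D where D: "countable D" "D \<subseteq> S" "S.mtopology closure_of D = S"
    using sep unfolding separable_space_def by auto
  have Dne: "D \<noteq> {}"
    using D(3) im assms(2) by auto
  obtain a0 :: "nat \<Rightarrow> 'w" where a0: "range a0 = D"
    using uncountable_def[of D] D(1) Dne by metis
  define a where "a n = the_inv_into (space M) \<phi> (a0 n)" for n
  have a: "a n \<in> space M" "\<phi> (a n) = a0 n" for n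
    using a0 D(2) im inj unfolding a_def
    by (auto intro!: f_the_inv_into_f the_inv_into_into[OF inj _ subset_refl])
  have dense: "\<exists>n. d (a n) x < r" if x: "x \<in> space M" and r: "r > 0" for x r
  proof -
    have "\<phi> x \<in> S.mtopology closure_of D" using x im D(3) by blast
    then obtain y where "y \<in> D" "y \<in> S.mball (\<phi> x) r"
      using r unfolding S.metric_closure_of by blast
    then show ?thesis using a0 a(2) by (auto simp: d_def S.commute)
  qed
  have ms: "Metric_space (space M) d"
  proof
    fix x y assume "x \<in> space M" "y \<in> space M"
    then show "(d x y = 0) = (x = y)"
      using im inj by (auto simp: d_def inj_on_def)
  next
    fix x y z assume "x \<in> space M" "y \<in> space M" "z \<in> space M"
    then show "d x z \<le> d x y + d y z" using im by (auto simp: d_def intro!: S.triangle)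
  qed (auto simp: d_def S.commute)
  interpret M: Metric_space "space M" d by fact
  have complete: "\<exists>y\<in>space M. \<forall>k. d y (b k) \<le> 1 / Suc k"
    if b: "range b \<subseteq> space M" "\<And>k l. d (b k) (b l) \<le> 1 / Suc k + 1 / Suc l" for b
  proof -
    have "S.MCauchy (\<phi> \<circ> b)" unfolding S.MCauchy_def
    proof (intro conjI allI impI)
      show "range (\<phi> \<circ> b) \<subseteq> S" using b(1) im by auto
      fix e :: real assume "e > 0"
      then obtain N where N: "1 / Suc N < e / 2" by (metis half_gt_zero nat_approx_posE)
      show "\<exists>N. \<forall>n n'. N \<le> n \<longrightarrow> N \<le> n' \<longrightarrow> d0 ((\<phi> \<circ> b) n) ((\<phi> \<circ> b) n') < e"
      proof (intro exI allI impI)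
        fix n m assume nm: "N \<le> n" "N \<le> m"
        have "1 / Suc n \<le> 1 / Suc N" "1 / Suc m \<le> 1 / Suc N"
          using nm by (auto intro!: divide_left_mono)
        with b(2)[of n m] N show "d0 ((\<phi> \<circ> b) n) ((\<phi> \<circ> b) m) < e" by (simp add: d_def)
      qed
    qed
    then obtain l where l: "limitin S.mtopology (\<phi> \<circ> b) l sequentially"
      using comp unfolding S.mcomplete_def by blast
    then have lS: "l \<in> S" by (simp add: S.limit_metric_sequentially)
    then obtain y where y: "y \<in> space M" "\<phi> y = l" using im by auto
    have "d y (b k) \<le> 1 / Suc k" for k
    proof (rule field_le_epsilon)
      fix e :: real assume "e > 0"
      obtain N where N: "\<And>n. n \<ge> N \<Longrightarrow> d0 (\<phi> (b n)) l < e / 2"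
        using l \<open>e > 0\<close> unfolding S.limit_metric_sequentially by (metis half_gt_zero comp_apply)
      obtain N' where N': "1 / Suc N' < e / 2" using \<open>e > 0\<close> by (metis half_gt_zero nat_approx_posE)
      define n where "n = max N N'"
      have "1 / Suc n \<le> 1 / Suc N'" by (auto intro!: divide_left_mono simp: n_def)
      moreover have "d y (b n) < e / 2"
        using N[of n] y(2) by (simp add: d_def n_def S.commute)
      moreover have "d y (b k) \<le> d y (b n) + d (b n) (b k)"
        using b(1) y(1) by (intro M.triangle) auto
      moreover note b(2)[of n k] N'
      ultimately show "d y (b k) \<le> 1 / Suc k + e" by linarith
    qed
    then show ?thesis using y by auto
  qed
  define E where "E = {{x \<in> space M. d (a n) x < 1 / Suc k} | n k. True}"
  have open_gen: "\<phi> -` G \<inter> space M \<in> sigma_sets (space M) E" if G: "openin S.mtopology G" for G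
  proof -
    define K where "K = {(n, k). S.mball (a0 n) (1 / Suc k) \<subseteq> G}"
    have "\<phi> -` G \<inter> space M = (\<Union>(n,k)\<in>K. {x \<in> space M. d (a n) x < 1 / Suc k})"
    proof (intro equalityI subsetI)
      fix x assume "x \<in> \<phi> -` G \<inter> space M"
      then have x: "x \<in> space M" "\<phi> x \<in> G" by auto
      then obtain r where r: "r > 0" "S.mball (\<phi> x) r \<subseteq> G"
        using G unfolding S.openin_mtopology by blast
      obtain k where k: "1 / Suc k < r / 2" using r(1) by (metis half_gt_zero nat_approx_posE)
      obtain n where n: "d (a n) x < 1 / Suc k" using dense[OF x(1), of "1 / Suc k"] by auto
      have "S.mball (a0 n) (1 / Suc k) \<subseteq> S.mball (\<phi> x) r"
      proof (rule S.mball_subset)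
        show "d0 (a0 n) (\<phi> x) + 1 / Suc k \<le> r" using n k a(2) by (simp add: d_def)
        show "\<phi> x \<in> S" using x(1) im by blast
      qed
      then have "(n, k) \<in> K" using r(2) by (auto simp: K_def)
      then show "x \<in> (\<Union>(n,k)\<in>K. {x \<in> space M. d (a n) x < 1 / Suc k})" using n x by auto
    next
      fix x assume "x \<in> (\<Union>(n,k)\<in>K. {x \<in> space M. d (a n) x < 1 / Suc k})"
      then obtain n k where "(n, k) \<in> K" "x \<in> space M" "d (a n) x < 1 / real (Suc k)" by auto
      moreover have "a0 n \<in> S" "\<phi> x \<in> S"
        using a0 D(2) im \<open>x \<in> space M\<close> by auto
      ultimately show "x \<in> \<phi> -` G \<inter> space M" using a(2) by (auto simp: K_def d_def)
    qed
    moreover have "(\<Union>(n,k)\<in>K. {x \<in> space M. d (a n) x < 1 / Suc k}) \<in> sigma_sets (space M) E"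
    proof -
      interpret sigma_algebra "space M" "sigma_sets (space M) E"
        by (rule sigma_algebra_sigma_sets) (auto simp: E_def)
      have "countable K" by simp
      show ?thesis
        by (intro countable_UN'') (auto intro!: sigma_sets.Basic simp: E_def)
    qed
    ultimately show ?thesis by simp
  qed
  have sub: "{G. openin S.mtopology G} \<subseteq> Pow S"
    using openin_subset[of S.mtopology] unfolding S.topspace_mtopology by blast
  have spS: "space (borel_of S.mtopology) = S" "sets (borel_of S.mtopology) = sigma_sets S {G. openin S.mtopology G}"
    unfolding borel_of_def using sub by (auto simp: space_measure_of_conv)
  have "sets M = sigma_sets (space M) E"
  proof (rule equalityI; rule subsetI)
    fix B assume B: "B \<in> sets M"
    interpret sigma_algebra "space M" "sigma_sets (space M) E"
      by (rule sigma_algebra_sigma_sets) (auto simp: E_def)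
    have "the_inv_into (space M) \<phi> -` B \<inter> S \<in> sigma_sets S {G. openin S.mtopology G}"
      using measurable_sets[OF inv B] spS by simp
    moreover have "\<phi> -` A \<inter> space M \<in> sigma_sets (space M) E"
      if "A \<in> sigma_sets S {G. openin S.mtopology G}" for A
      using that
    proof induction
      case (Basic G) then show ?case using open_gen by auto
    next
      case Empty then show ?case by simp
    next
      case (Compl A)
      have "\<phi> -` (S - A) \<inter> space M = space M - (\<phi> -` A \<inter> space M)" using im by auto
      then show ?case using Compl by auto
    next
      case (Union A)
      have "\<phi> -` (\<Union>(range A)) \<inter> space M = (\<Union>i. \<phi> -` A i \<inter> space M)" by auto
      then show ?case using Union.IH by (simp only: sigma_sets.Union)
    qed
    ultimately have "\<phi> -` (the_inv_into (space M) \<phi> -` B \<inter> S) \<inter> space M \<in> sigma_sets (space M) E"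
      by blast
    also have "\<phi> -` (the_inv_into (space M) \<phi> -` B \<inter> S) \<inter> space M = B"
    proof -
      have "\<phi> x \<in> S \<and> the_inv_into (space M) \<phi> (\<phi> x) = x" if "x \<in> space M" for x
        using that im the_inv_into_f_f[OF inj] by blast
      then show ?thesis using sets.sets_into_space[OF B] by auto
    qed
    finally show "B \<in> sigma_sets (space M) E" .
  next
    fix B assume "B \<in> sigma_sets (space M) E"
    moreover have "E \<subseteq> sets M"
    proof
      fix e assume "e \<in> E"
      then obtain n k where e: "e = {x \<in> space M. d (a n) x < 1 / Suc k}" by (auto simp: E_def)
      have "S.mball (a0 n) (1 / Suc k) \<in> sets (borel_of S.mtopology)"
        unfolding spS by (auto intro: sigma_sets.Basic)
      from measurable_sets[OF meas this] have "\<phi> -` S.mball (a0 n) (1 / Suc k) \<inter> space M \<in> sets M" .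
      also have "\<phi> -` S.mball (a0 n) (1 / Suc k) \<inter> space M = e"
      proof -
        have "a0 n \<in> S" "\<And>x. x \<in> space M \<Longrightarrow> \<phi> x \<in> S" using a0 D(2) im by auto
        then show ?thesis using a(2) by (auto simp: e d_def)
      qed
      finally show "e \<in> sets M" .
    qed
    ultimately show "B \<in> sets M" by (metis sets.sigma_sets_subset subsetD)
  qed
  with ms a(1) dense complete show ?thesis unfolding E_def
    by (intro that[of d a]) blast+
qed

text \<open>
  The sets \<open>E n\<close> are the balls of radius \<open>1 / (k + 1)\<close> around the points of a dense sequence, and
  a point is coded by the balls that contain it.  Codes can be decoded measurably: for each \<open>k\<close>, the
  first ball of radius \<open>1 / (k + 1)\<close> named by the code yields a centre, and where these centres are
  compatible they converge to the coded point.  At inconsistent codes decoding returns the default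
  value \<open>a 0\<close>, which makes it a map on the whole space \<open>R\<close>.
\<close>

lemma sigma_finite_borel_separating:
  fixes M :: "'w measure"
  assumes "sigma_finite_borel M"
  obtains E :: "nat \<Rightarrow> 'w set" where
    "range E \<subseteq> sets M"
    "\<And>x y. x \<in> space M \<Longrightarrow> y \<in> space M \<Longrightarrow> (\<forall>n. x \<in> E n \<longleftrightarrow> y \<in> E n) \<Longrightarrow> x = y"
    "\<And>(R :: 'r measure) A. range A \<subseteq> sets R \<Longrightarrow> space M \<noteq> {} \<Longrightarrow> \<exists>G\<in>R \<rightarrow>\<^sub>M M. \<forall>y\<in>space R. \<forall>x\<in>space M.
       (\<forall>n. y \<in> A n \<longleftrightarrow> x \<in> E n) \<longrightarrow> G y = x"
proof (cases "space M = {}")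
  case True
  then show ?thesis
    by (intro that[of "\<lambda>_. {}"]) auto
next
  case False
  obtain d :: "'w \<Rightarrow> 'w \<Rightarrow> real" and a :: "nat \<Rightarrow> 'w" where
    ms: "Metric_space (space M) d" and
    a: "range a \<subseteq> space M" and
    "\<forall>x\<in>space M. \<forall>r>0. \<exists>n. d (a n) x < r" and
    "\<forall>b. range b \<subseteq> space M \<longrightarrow> (\<forall>k l. d (b k) (b l) \<le> 1 / Suc k + 1 / Suc l) \<longrightarrow>
       (\<exists>y\<in>space M. \<forall>k. d y (b k) \<le> 1 / Suc k)" and
    gen: "sets M = sigma_sets (space M) {{x \<in> space M. d (a n) x < 1 / Suc k} | n k. True}"
    by (rule sigma_finite_borel_metric[OF assms False])
  then have dense: "\<And>x r. x \<in> space M \<Longrightarrow> r > 0 \<Longrightarrow> \<exists>n. d (a n) x < r" and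
    complete: "\<And>b. range b \<subseteq> space M \<Longrightarrow> (\<And>k l. d (b k) (b l) \<le> 1 / Suc k + 1 / Suc l) \<Longrightarrow>
       \<exists>y\<in>space M. \<forall>k. d y (b k) \<le> 1 / Suc k" by blast+
  interpret Metric_space "space M" d by fact
  have aM: "a n \<in> space M" for n using a by auto
  define B where "B n k = {x \<in> space M. d (a n) x < 1 / Suc k}" for n k
  define E where "E i = (case prod_decode i of (n, k) \<Rightarrow> B n k)" for i
  have E_enc: "E (prod_encode (n, k)) = B n k" for n k by (simp add: E_def)
  have rangeE: "range E = {{x \<in> space M. d (a n) x < 1 / Suc k} | n k. True}"
  proof safe
    fix i show "\<exists>n k. E i = {x \<in> space M. d (a n) x < 1 / real (Suc k)} \<and> True"
      by (auto simp: E_def B_def split: prod.split)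
  next
    fix n k
    show "{x \<in> space M. d (a n) x < 1 / real (Suc k)} \<in> range E"
      using E_enc[of n k] unfolding B_def by (metis rangeI)
  qed
  show ?thesis
  proof (rule that[of E])
    show "range E \<subseteq> sets M" unfolding gen rangeE by (auto intro: sigma_sets.Basic)
  next
    fix x y assume xy: "x \<in> space M" "y \<in> space M" "\<forall>n. x \<in> E n \<longleftrightarrow> y \<in> E n"
    have iff: "d (a n) x < 1 / Suc k \<longleftrightarrow> d (a n) y < 1 / Suc k" for n k
      using xy(3)[rule_format, of "prod_encode (n, k)"] xy(1,2) unfolding E_enc B_def by simp
    have "d x y \<le> 0"
    proof (rule field_le_epsilon)
      fix e :: real assume "e > 0"
      then obtain k where k: "1 / Suc k < e / 2" by (metis half_gt_zero nat_approx_posE)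
      obtain n where n: "d (a n) x < 1 / Suc k" using dense[OF xy(1), of "1 / Suc k"] by auto
      then have "d (a n) y < 1 / Suc k" using iff by blast
      moreover have "d x y \<le> d x (a n) + d (a n) y" using xy aM by (intro triangle) auto
      moreover have "d x (a n) = d (a n) x" by (rule commute)
      ultimately show "d x y \<le> 0 + e" using n k by linarith
    qed
    then show "x = y" using xy by (metis nonneg zero order_antisym)
  next
    fix R :: "'r measure" and A :: "nat \<Rightarrow> 'r set" assume A: "range A \<subseteq> sets R"
    define A' where "A' n k = A (prod_encode (n, k))" for n k
    have [measurable]: "A' n k \<in> sets R" for n k using A by (auto simp: A'_def)
    define i where "i k y = (LEAST n. y \<in> A' n k)" for k y
    have i[measurable]: "i k \<in> R \<rightarrow>\<^sub>M count_space UNIV" for k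
      unfolding i_def by measurable
    define C where "C = {y \<in> space R. \<forall>k l. d (a (i k y)) (a (i l y)) \<le> 1 / Suc k + 1 / Suc l}"
    have [measurable]: "C \<in> sets R" unfolding C_def by measurable
    have "\<forall>y\<in>C. \<exists>x\<in>space M. \<forall>k. d x (a (i k y)) \<le> 1 / Suc k"
      using complete[of "\<lambda>k. a (i k _)"] aM by (auto simp: C_def)
    then obtain L where L: "\<And>y. y \<in> C \<Longrightarrow> L y \<in> space M" "\<And>y k. y \<in> C \<Longrightarrow> d (L y) (a (i k y)) \<le> 1 / Suc k"
      by metis
    define G where "G y = (if y \<in> C then L y else a 0)" for y
    \<comment> \<open>By the bound on the speed of convergence, \<open>L y\<close> lies in a ball exactly if some centre does
      with a margin larger than its distance to \<open>L y\<close>.\<close>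
    have pre: "G -` B m j \<inter> space R =
       {y \<in> space R. (y \<in> C \<and> (\<exists>k. d (a m) (a (i k y)) + 1 / Suc k < 1 / Suc j)) \<or> (y \<notin> C \<and> a 0 \<in> B m j)}" for m j
    proof -
      have "G y \<in> B m j \<longleftrightarrow> (\<exists>k. d (a m) (a (i k y)) + 1 / Suc k < 1 / Suc j)" if y: "y \<in> C" for y
      proof
        assume "G y \<in> B m j"
        then have l: "d (a m) (L y) < 1 / Suc j" using y by (auto simp: G_def B_def)
        then obtain k where "1 / Suc k < (1 / Suc j - d (a m) (L y)) / 2"
          by (metis diff_gt_0_iff_gt half_gt_zero nat_approx_posE)
        moreover have "d (a m) (a (i k y)) \<le> d (a m) (L y) + d (L y) (a (i k y))"
          using L(1)[OF y] aM by (intro triangle) auto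
        ultimately show "\<exists>k. d (a m) (a (i k y)) + 1 / Suc k < 1 / Suc j"
          using L(2)[OF y, of k] by (intro exI[of _ k]) argo
      next
        assume "\<exists>k. d (a m) (a (i k y)) + 1 / Suc k < 1 / Suc j"
        then obtain k where k: "d (a m) (a (i k y)) + 1 / Suc k < 1 / Suc j" by blast
        have "d (a m) (L y) \<le> d (a m) (a (i k y)) + d (a (i k y)) (L y)"
          using L(1)[OF y] aM by (intro triangle) auto
        moreover have "d (a (i k y)) (L y) = d (L y) (a (i k y))" by (rule commute)
        ultimately show "G y \<in> B m j" using k y L(1)[OF y] L(2)[OF y, of k] by (auto simp: G_def B_def)
      qed
      then show ?thesis by (auto simp: G_def split: if_splits)
    qed
    have G: "G \<in> R \<rightarrow>\<^sub>M M"
    proof (rule measurable_sigma_sets[OF gen])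
      show "G \<in> space R \<rightarrow> space M" using L(1) aM by (auto simp: G_def)
      fix e assume "e \<in> {{x \<in> space M. d (a n) x < 1 / real (Suc k)} |n k. True}"
      then obtain m j where "e = B m j" by (auto simp: B_def)
      then show "G -` e \<inter> space R \<in> sets R" unfolding \<open>e = B m j\<close> pre by measurable
    qed auto
    have "G y = x" if y: "y \<in> space R" and x: "x \<in> space M" and yx: "\<forall>n. y \<in> A n \<longleftrightarrow> x \<in> E n" for x y
    proof -
      have A'B: "y \<in> A' n k \<longleftrightarrow> x \<in> B n k" for n k
        using yx[rule_format, of "prod_encode (n, k)"] unfolding E_enc A'_def .
      have close: "d (a (i k y)) x < 1 / Suc k" for k
      proof -
        obtain n where "d (a n) x < 1 / Suc k" using dense[OF x, of "1 / Suc k"] by auto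
        then have "y \<in> A' n k" using A'B x by (auto simp: B_def)
        then have "y \<in> A' (i k y) k" unfolding i_def by (rule LeastI)
        then show ?thesis using A'B by (auto simp: B_def)
      qed
      have "y \<in> C" unfolding C_def
      proof (intro CollectI conjI allI)
        fix k l
        have "d (a (i k y)) (a (i l y)) \<le> d (a (i k y)) x + d x (a (i l y))"
          using aM x by (intro triangle) auto
        moreover have "d x (a (i l y)) = d (a (i l y)) x" by (rule commute)
        ultimately show "d (a (i k y)) (a (i l y)) \<le> 1 / Suc k + 1 / Suc l"
          using close[of k] close[of l] by linarith
      qed (rule y)
      have "d (L y) x \<le> 0"
      proof (rule field_le_epsilon)
        fix e :: real assume "e > 0"
        then obtain k where k: "1 / Suc k < e / 2" by (metis half_gt_zero nat_approx_posE)
        have "d (L y) x \<le> d (L y) (a (i k y)) + d (a (i k y)) x"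
          using L(1)[OF \<open>y \<in> C\<close>] aM x by (intro triangle) auto
        then show "d (L y) x \<le> 0 + e" using L(2)[OF \<open>y \<in> C\<close>, of k] close[of k] k by linarith
      qed
      then have "L y = x" using L(1)[OF \<open>y \<in> C\<close>] x by (metis nonneg zero order_antisym)
      then show ?thesis using \<open>y \<in> C\<close> by (simp add: G_def)
    qed
    then show "\<exists>G\<in>R \<rightarrow>\<^sub>M M. \<forall>y\<in>space R. \<forall>x\<in>space M. (\<forall>n. y \<in> A n \<longleftrightarrow> x \<in> E n) \<longrightarrow> G y = x"
      using G by blast
  qed
qed

section \<open>Flows of shift-invariant families of functions\<close>

abbreviation "pathspace \<equiv> PiM UNIV (\<lambda>_::nat. borel :: real measure)"

lemma pathspace_Collect:
  assumes "Measurable.pred pathspace P"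
  shows "{y. P y} \<in> sets pathspace"
  using assms by (simp add: pred_def space_PiM)

text \<open>
  This is all that the construction of the flow uses about the process, and it holds in the max-i.d.
  as well as in the i.d. case.  Laws are compared off the origin only, because the law of the process
  carries no information on the set where all the functions vanish.
\<close>

locale shift_invariant_family =
  fixes I :: "(real ^ 'd::finite) set" and M :: "'w measure" and f :: "real ^ 'd \<Rightarrow> 'w \<Rightarrow> real"
  assumes index: "I = UNIV \<or> I = integer_lattice"
    and borel_space: "sigma_finite_borel M"
    and minimal: "minimal_rep I M f"
    and measurable_f: "t \<in> I \<Longrightarrow> f t \<in> borel_measurable M"
    and shift_invariant: "\<lbrakk>range s \<subseteq> I; u \<in> I; A \<in> sets (PiM UNIV (\<lambda>_::nat. borel)); (\<lambda>_. 0) \<notin> A\<rbrakk> \<Longrightarrow>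
      emeasure M {x \<in> space M. (\<lambda>n. f (s n + u) x) \<in> A} = emeasure M {x \<in> space M. (\<lambda>n. f (s n) x) \<in> A}"
    and continuous_at_0: "\<lbrakk>e > 0; r > 0\<rbrakk> \<Longrightarrow> \<exists>\<delta>>0. \<forall>u\<in>I. norm u < \<delta> \<longrightarrow>
      emeasure M {x \<in> space M. e < \<bar>f u x - f 0 x\<bar>} \<le> ennreal r"
begin

lemma I_group:
  shows zero_I: "0 \<in> I" and add_I: "t \<in> I \<Longrightarrow> u \<in> I \<Longrightarrow> t + u \<in> I"
    and diff_I: "t \<in> I \<Longrightarrow> u \<in> I \<Longrightarrow> t - u \<in> I" and minus_I: "t \<in> I \<Longrightarrow> - t \<in> I"
  using index by (auto simp: integer_lattice_def)

lemma measurable_path: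
  assumes "range s \<subseteq> I"
  shows "(\<lambda>x n. f (s n) x) \<in> M \<rightarrow>\<^sub>M pathspace"
  using assms by (intro measurable_PiM_single') (auto intro: measurable_f)

text \<open>
  Every event of a generated \<open>\<sigma>\<close>-algebra involves countably many of the generating functions.  The
  index set is a set \<open>C\<close> rather than a sequence so that countably many of them can be merged
  before they are enumerated.
\<close>

lemma countably_determined:
  assumes "A \<in> sigma_sets (space M) {f t -` S \<inter> space M | t S. t \<in> I \<and> S \<in> sets borel}"
  shows "\<exists>C. countable C \<and> C \<subseteq> I \<and> (\<forall>s::nat \<Rightarrow> _. C \<subseteq> range s \<longrightarrow>
    (\<exists>A'\<in>sets pathspace. A = (\<lambda>x n. f (s n) x) -` A' \<inter> space M))"
  using assms
proof induction
  case (Basic A)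
  then obtain t S where A: "A = f t -` S \<inter> space M" "t \<in> I" "S \<in> sets borel" by auto
  show ?case
  proof (intro exI[of _ "{t}"] conjI allI impI)
    fix s :: "nat \<Rightarrow> real ^ 'd" assume "{t} \<subseteq> range s"
    then obtain n where n: "s n = t" by auto
    have [measurable]: "S \<in> sets borel" by fact
    have "{y \<in> space pathspace. y n \<in> S} \<in> sets pathspace" by measurable
    moreover have "A = (\<lambda>x n. f (s n) x) -` {y \<in> space pathspace. y n \<in> S} \<inter> space M"
      using n A(1) by (auto simp: space_PiM)
    ultimately show "\<exists>A'\<in>sets pathspace. A = (\<lambda>x n. f (s n) x) -` A' \<inter> space M" by blast
  qed (use A in auto)
next
  case Empty
  then show ?case by (intro exI[of _ "{}"]) auto
next
  case (Compl A)
  then obtain C where C: "countable C" "C \<subseteq> I"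
    "\<And>s::nat \<Rightarrow> _. C \<subseteq> range s \<Longrightarrow> (\<exists>A'\<in>sets pathspace. A = (\<lambda>x n. f (s n) x) -` A' \<inter> space M)" by blast
  show ?case
  proof (intro exI[of _ C] conjI allI impI)
    fix s :: "nat \<Rightarrow> real ^ 'd" assume "C \<subseteq> range s"
    then obtain A' where "A' \<in> sets pathspace" "A = (\<lambda>x n. f (s n) x) -` A' \<inter> space M" using C(3) by blast
    then show "\<exists>A'\<in>sets pathspace. space M - A = (\<lambda>x n. f (s n) x) -` A' \<inter> space M"
      by (intro bexI[of _ "space pathspace - A'"] sets.compl_sets) (auto simp: space_PiM)
  qed (use C in auto)
next
  case (Union A)
  let ?P = "\<lambda>A C. countable C \<and> C \<subseteq> I \<and> (\<forall>s::nat \<Rightarrow> _. C \<subseteq> range s \<longrightarrow>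
    (\<exists>A'\<in>sets pathspace. A = (\<lambda>x n. f (s n) x) -` A' \<inter> space M))"
  have "\<forall>i. \<exists>C. ?P (A i) C" using Union.IH by (rule allI)
  then obtain C where C': "\<forall>i. ?P (A i) (C i)" by (rule choice[THEN exE])
  then have C: "\<And>i. countable (C i)" "\<And>i. C i \<subseteq> I"
    "\<And>i s. C i \<subseteq> range s \<Longrightarrow> (\<exists>A'\<in>sets pathspace. A i = (\<lambda>x (n::nat). f (s n) x) -` A' \<inter> space M)" by simp_all
  show ?case
  proof (intro exI[of _ "\<Union>i. C i"] conjI allI impI)
    fix s :: "nat \<Rightarrow> real ^ 'd" assume "(\<Union>i. C i) \<subseteq> range s"
    then have sub: "C i \<subseteq> range s" for i by blast
    have "\<forall>i. \<exists>A'. A' \<in> sets pathspace \<and> A i = (\<lambda>x n. f (s n) x) -` A' \<inter> space M"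
      using C(3)[OF sub] unfolding Bex_def by (rule allI)
    then obtain A' where A'_ex: "\<forall>i. A' i \<in> sets pathspace \<and> A i = (\<lambda>x n. f (s n) x) -` A' i \<inter> space M"
      by (rule choice[THEN exE])
    note A' = A'_ex[rule_format, THEN conjunct1] A'_ex[rule_format, THEN conjunct2]
    have "(\<Union>i. A i) = (\<lambda>x n. f (s n) x) -` (\<Union>i. A' i) \<inter> space M" unfolding A'(2) by blast
    then show "\<exists>A'\<in>sets pathspace. (\<Union>i. A i) = (\<lambda>x n. f (s n) x) -` A' \<inter> space M"
      using A'(1) by (intro bexI[of _ "\<Union>i. A' i"]) auto
  qed (use C in auto)
qed

text \<open>
  By the first part of minimality each of the coding sets agrees up to a null set with an event of
  countably many functions; enumerating all functions so obtained, the path of almost every point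
  determines its code, which can be decoded.

  The last conclusion needs the second part.  On the set \<open>B\<close> where the path vanishes, decoding the
  zero path gives a single point, so \<open>B\<close> is a point up to a null set.  If \<open>B\<close> is not null,
  some \<open>f t\<close> is nonzero at this point, and prepending \<open>t\<close> to the sequence removes \<open>B\<close>.
\<close>

lemma recovery_map:
  assumes "space M \<noteq> {}"
  obtains s :: "nat \<Rightarrow> real ^ 'd" and G where "range s \<subseteq> I" "G \<in> pathspace \<rightarrow>\<^sub>M M"
    "AE x in M. G (\<lambda>n. f (s n) x) = x" "AE x in M. (\<lambda>n. f (s n) x) \<noteq> (\<lambda>_. 0)"
proof -
  obtain E :: "nat \<Rightarrow> 'w set" where E: "range E \<subseteq> sets M" and
    ret: "\<And>A. range A \<subseteq> sets pathspace \<Longrightarrow> space M \<noteq> {} \<Longrightarrow> \<exists>G\<in>pathspace \<rightarrow>\<^sub>M M. \<forall>y\<in>space pathspace. \<forall>x\<in>space M.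
       (\<forall>n. y \<in> A n \<longleftrightarrow> x \<in> E n) \<longrightarrow> G y = x"
    using sigma_finite_borel_separating[OF borel_space, where 'r = "nat \<Rightarrow> real"] by (metis (no_types, lifting))
  have "E n \<in> sets M" for n using E by blast
  then have "\<forall>n. \<exists>A. A \<in> sigma_sets (space M) {f t -` S \<inter> space M | t S. t \<in> I \<and> S \<in> sets borel} \<and>
      emeasure M ((A - E n) \<union> (E n - A)) = 0"
    using minimal[unfolded minimal_rep_def, THEN conjunct1] unfolding Bex_def by simp
  then obtain A where A_ex: "\<forall>n. A n \<in> sigma_sets (space M) {f t -` S \<inter> space M | t S. t \<in> I \<and> S \<in> sets borel}
    \<and> emeasure M ((A n - E n) \<union> (E n - A n)) = 0" by (rule choice[THEN exE])
  note A = A_ex[rule_format, THEN conjunct1] A_ex[rule_format, THEN conjunct2]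
  let ?P = "\<lambda>A C. countable C \<and> C \<subseteq> I \<and> (\<forall>s::nat \<Rightarrow> _. C \<subseteq> range s \<longrightarrow>
    (\<exists>A'\<in>sets pathspace. A = (\<lambda>x n. f (s n) x) -` A' \<inter> space M))"
  have "\<forall>i. \<exists>C. ?P (A i) C" using countably_determined[OF A(1)] by (rule allI)
  then obtain C where C': "\<forall>i. ?P (A i) (C i)" by (rule choice[THEN exE])
  then have C: "\<And>i. countable (C i)" "\<And>i. C i \<subseteq> I"
    "\<And>i s. C i \<subseteq> range s \<Longrightarrow> (\<exists>A'\<in>sets pathspace. A i = (\<lambda>x (n::nat). f (s n) x) -` A' \<inter> space M)" by simp_all
  define s0 where "s0 = from_nat_into (insert 0 (\<Union>n. C n))"
  have s0: "range s0 = insert 0 (\<Union>n. C n)"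
    unfolding s0_def using C(1) by (intro range_from_nat_into) auto
  then have s0I: "range s0 \<subseteq> I" using C(2) zero_I by auto
  have [measurable]: "(\<lambda>x n. f (s0 n) x) \<in> M \<rightarrow>\<^sub>M pathspace" by (rule measurable_path[OF s0I])
  have sub: "C i \<subseteq> range s0" for i using s0 by blast
  have "\<forall>i. \<exists>A'. A' \<in> sets pathspace \<and> A i = (\<lambda>x n. f (s0 n) x) -` A' \<inter> space M"
    using C(3)[OF sub] unfolding Bex_def by (rule allI)
  then obtain A' where A'_ex: "\<forall>i. A' i \<in> sets pathspace \<and> A i = (\<lambda>x n. f (s0 n) x) -` A' i \<inter> space M"
    by (rule choice[THEN exE])
  note A' = A'_ex[rule_format, THEN conjunct1] A'_ex[rule_format, THEN conjunct2]
  have AM: "A i \<in> sets M" for i unfolding A'(2) using A'(1) by measurable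
  have "range A' \<subseteq> sets pathspace" using A'(1) by blast
  from ret[OF this assms] obtain G0 where G0[measurable]: "G0 \<in> pathspace \<rightarrow>\<^sub>M M" and
    G0_ex: "\<forall>y\<in>space pathspace. \<forall>x\<in>space M. (\<forall>n. y \<in> A' n \<longleftrightarrow> x \<in> E n) \<longrightarrow> G0 y = x"
    by (rule bexE)
  have "AE x in M. \<forall>n. x \<in> A n \<longleftrightarrow> x \<in> E n"
    unfolding AE_all_countable
  proof
    fix n
    have "(A n - E n) \<union> (E n - A n) \<in> null_sets M"
      using A(2)[of n] AM[of n] E by (auto simp: null_sets_def)
    from AE_not_in[OF this] show "AE x in M. x \<in> A n \<longleftrightarrow> x \<in> E n" by eventually_elim auto
  qed
  then have rec: "AE x in M. G0 (\<lambda>n. f (s0 n) x) = x"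
  proof (rule AE_mp, intro AE_I2 impI)
    fix x assume x: "x \<in> space M" "\<forall>n. x \<in> A n \<longleftrightarrow> x \<in> E n"
    show "G0 (\<lambda>n. f (s0 n) x) = x"
      using x A'(2) by (intro G0_ex[rule_format]) (auto simp: space_PiM)
  qed
  show ?thesis
  proof (cases "AE x in M. (\<lambda>n. f (s0 n) x) \<noteq> (\<lambda>_. 0)")
    case True
    then show ?thesis using that s0I G0 rec by blast
  next
    case False
    define B where "B = {x \<in> space M. \<forall>n. f (s0 n) x = 0}"
    have [measurable]: "f (s0 n) \<in> borel_measurable M" for n using s0I by (auto intro: measurable_f)
    have BM[measurable]: "B \<in> sets M" unfolding B_def by measurable
    have "emeasure M B \<noteq> 0"
    proof
      assume "emeasure M B = 0"
      then have "B \<in> null_sets M" using BM by auto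
      from AE_not_in[OF this] AE_space have "AE x in M. (\<lambda>n. f (s0 n) x) \<noteq> (\<lambda>_. 0)"
        by eventually_elim (auto simp: B_def fun_eq_iff)
      with False show False ..
    qed
    then obtain t where t: "t \<in> I" "\<not> (AE x in M. x \<in> B \<longrightarrow> f t x = 0)"
      using minimal BM unfolding minimal_rep_def by (auto simp: zero_less_iff_neq_zero)
    have one: "AE x in M. x \<in> B \<longrightarrow> x = G0 (\<lambda>_. 0)"
      using rec by eventually_elim (auto simp: B_def)
    have nz: "f t (G0 (\<lambda>_. 0)) \<noteq> 0"
    proof
      assume z: "f t (G0 (\<lambda>_. 0)) = 0"
      from one have "AE x in M. x \<in> B \<longrightarrow> f t x = 0" by eventually_elim (use z in auto)
      with t(2) show False ..
    qed
    show ?thesis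
    proof (rule that[of "case_nat t s0" "\<lambda>y. G0 (\<lambda>n. y (Suc n))"])
      show "range (case_nat t s0) \<subseteq> I"
        using t(1) s0I unfolding image_subset_iff by (auto split: nat.splits)
      show "(\<lambda>y. G0 (\<lambda>n. y (Suc n))) \<in> pathspace \<rightarrow>\<^sub>M M"
        by (rule measurable_compose[OF _ G0], rule measurable_PiM_single') (auto simp: space_PiM)
      show "AE x in M. G0 (\<lambda>n. f (case Suc n of 0 \<Rightarrow> t | Suc a \<Rightarrow> s0 a) x) = x" using rec by simp
      from one AE_space show "AE x in M. (\<lambda>n. f (case n of 0 \<Rightarrow> t | Suc a \<Rightarrow> s0 a) x) \<noteq> (\<lambda>_. 0)"
      proof eventually_elim
        case (elim x)
        show ?case
        proof
          assume *: "(\<lambda>n. f (case n of 0 \<Rightarrow> t | Suc a \<Rightarrow> s0 a) x) = (\<lambda>_. 0)"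
          have "f t x = 0" using fun_cong[OF *, of 0] by simp
          moreover have "x \<in> B" using elim fun_cong[OF *, of "Suc n" for n] by (auto simp: B_def)
          ultimately show False using elim nz by auto
        qed
      qed
    qed
  qed
qed

text \<open>
  Rounding to the grid of width \<open>1 / (m + 1)\<close>, rather than to a dyadic one, leaves all lattice points
  fixed, so that the two index sets can be treated alike.
\<close>

definition grid :: "nat \<Rightarrow> real ^ 'd \<Rightarrow> real ^ 'd" where
  "grid m t = (\<chi> i. real_of_int \<lfloor>real (Suc m) * t $ i\<rfloor> / real (Suc m))"

lemma grid_I: "t \<in> I \<Longrightarrow> grid m t \<in> I"
proof -
  have "grid m t = t" if t: "t \<in> integer_lattice"
  proof (rule vec_eq_iff[THEN iffD2], rule allI)
    fix i
    obtain k where k: "t $ i = of_int k" using t unfolding integer_lattice_def by (blast elim: Ints_cases)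
    have "\<lfloor>real (Suc m) * t $ i\<rfloor> = int (Suc m) * k"
      unfolding k by (metis floor_of_int of_int_mult of_int_of_nat_eq)
    then show "grid m t $ i = t $ i" by (simp add: grid_def k)
  qed
  then show "t \<in> I \<Longrightarrow> grid m t \<in> I" using index by auto
qed

lemma norm_grid: "norm (grid m t - t) \<le> real CARD('d) / real (Suc m)"
proof -
  have "\<bar>(grid m t - t) $ i\<bar> \<le> 1 / real (Suc m)" for i
  proof -
    define y where "y = real (Suc m) * t $ i"
    have "(grid m t - t) $ i = (of_int \<lfloor>y\<rfloor> - y) / real (Suc m)"
      by (simp add: grid_def y_def field_simps del: of_nat_Suc)
    moreover have "\<bar>of_int \<lfloor>y\<rfloor> - y\<bar> \<le> 1" by linarith
    ultimately show ?thesis by (simp add: divide_right_mono)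
  qed
  then have "(\<Sum>i\<in>UNIV. \<bar>(grid m t - t) $ i\<bar>) \<le> (\<Sum>i\<in>(UNIV::'d set). 1 / real (Suc m))"
    by (intro sum_mono)
  with norm_le_l1_cart[of "grid m t - t"] show ?thesis by simp
qed

lemma countable_grid: "countable (range (grid m))"
proof -
  have "range (grid m) \<subseteq> (\<lambda>k::int ^ 'd. \<chi> i. real_of_int (k $ i) / real (Suc m)) ` UNIV"
  proof
    fix y assume "y \<in> range (grid m)"
    then obtain t where "y = grid m t" by auto
    then show "y \<in> (\<lambda>k::int ^ 'd. \<chi> i. real_of_int (k $ i) / real (Suc m)) ` UNIV"
      by (intro image_eqI[of _ _ "\<chi> i. \<lfloor>real (Suc m) * t $ i\<rfloor>"]) (auto simp: grid_def)
  qed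
  then show ?thesis by (rule countable_subset) simp
qed

lemma measurable_grid[measurable]: "grid m \<in> borel_measurable borel"
proof (rule borel_measurable_euclidean_space[THEN iffD2], rule ballI)
  fix b :: "real ^ 'd" assume "b \<in> Basis"
  then obtain i where b: "b = axis i 1" by (auto simp: Basis_vec_def)
  have "(\<lambda>t::real ^ 'd. t $ i) \<in> borel_measurable borel"
    using borel_measurable_inner[OF borel_measurable_const measurable_ident_sets[OF refl], of "axis i 1"]
    by (simp add: inner_axis')
  then have "(\<lambda>t::real ^ 'd. real_of_int \<lfloor>real (Suc m) * t $ i\<rfloor> / real (Suc m)) \<in> borel_measurable borel"
    by measurable
  then show "(\<lambda>t. grid m t \<bullet> b) \<in> borel_measurable borel"
    by (simp add: b inner_axis grid_def)
qed

text \<open>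
  By shift invariance the distance in measure between \<open>f (t + u)\<close> and \<open>f t\<close> depends on \<open>u\<close>
  only.  Hence grid widths can be chosen, independently of \<open>t\<close>, such that the error of the \<open>k\<close>-th
  approximation exceeds \<open>1 / 2 ^ k\<close> on a set of measure at most \<open>1 / 2 ^ k\<close>.  For every
  \<open>t\<close> the approximations then converge almost everywhere by the Borel-Cantelli lemma, and being
  countably valued in \<open>t\<close> they are jointly measurable.
\<close>

lemma jointly_measurable_version:
  obtains F :: "real ^ 'd \<Rightarrow> 'w \<Rightarrow> real" where
    "(\<lambda>(t, x). F t x) \<in> borel_measurable (restrict_space borel I \<Otimes>\<^sub>M M)"
    "\<forall>t\<in>I. AE x in M. F t x = f t x"
proof -
  have "\<forall>k::nat. \<exists>\<delta>>0. \<forall>u\<in>I. norm u < \<delta> \<longrightarrow>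
      emeasure M {x \<in> space M. 1 / 2 ^ k < \<bar>f u x - f 0 x\<bar>} \<le> ennreal (1 / 2 ^ k)"
    using continuous_at_0 by simp
  then obtain \<delta> where \<delta>: "\<forall>k::nat. \<delta> k > 0 \<and> (\<forall>u\<in>I. norm u < \<delta> k \<longrightarrow>
      emeasure M {x \<in> space M. 1 / 2 ^ k < \<bar>f u x - f 0 x\<bar>} \<le> ennreal (1 / 2 ^ k))"
    by (rule choice[THEN exE])
  have "\<forall>k. \<exists>m. real CARD('d) / real (Suc m) < \<delta> k"
  proof
    fix k
    have "\<delta> k / real CARD('d) > 0" using \<delta> by simp
    then obtain m where "1 / real (Suc m) < \<delta> k / real CARD('d)" using nat_approx_posE by metis
    then show "\<exists>m. real CARD('d) / real (Suc m) < \<delta> k" by (intro exI[of _ m]) (simp add: field_simps)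
  qed
  then obtain m where m: "\<forall>k. real CARD('d) / real (Suc (m k)) < \<delta> k" by (rule choice[THEN exE])
  define q where "q k t = grid (m k) t" for k t
  define F where "F t x = lim (\<lambda>k. f (q k t) x)" for t x
  let ?N = "restrict_space borel I \<Otimes>\<^sub>M M"
  have [measurable]: "(\<lambda>p. f (q k (fst p)) (snd p)) \<in> borel_measurable ?N" for k
  proof (rule measurable_compose_countable'[where I = "q k ` I"])
    show "countable (q k ` I)"
      unfolding q_def by (rule countable_subset[OF _ countable_grid[of "m k"]]) auto
    then show "(\<lambda>p. q k (fst p)) \<in> ?N \<rightarrow>\<^sub>M count_space (q k ` I)"
    proof (rule measurable_count_space_eq_countable[THEN iffD2], intro conjI ballI)
      show "(\<lambda>p. q k (fst p)) \<in> space ?N \<rightarrow> q k ` I" by (auto simp: space_pair_measure space_restrict_space)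
      have [measurable]: "(\<lambda>p. q k (fst p)) \<in> borel_measurable ?N"
        unfolding q_def
        by (rule measurable_compose[OF measurable_compose[OF measurable_fst
              measurable_restrict_space1[OF measurable_ident_sets[OF refl]]] measurable_grid])
      fix a show "(\<lambda>p. q k (fst p)) -` {a} \<inter> space ?N \<in> sets ?N" by measurable
    qed
  next
    fix t assume "t \<in> q k ` I"
    then have "t \<in> I" by (auto simp: q_def grid_I)
    then show "(\<lambda>p. f t (snd p)) \<in> borel_measurable ?N" using measurable_f by measurable
  qed
  have "(\<lambda>p. F (fst p) (snd p)) \<in> borel_measurable ?N" unfolding F_def by measurable
  moreover have "AE x in M. F t x = f t x" if t: "t \<in> I" for t
  proof -
    define A where "A k = {x \<in> space M. 1 / 2 ^ k < \<bar>f (q k t) x - f t x\<bar>}" for k :: nat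
    have qI: "q k t \<in> I" for k using grid_I[OF t] by (simp add: q_def)
    have [measurable]: "f (q k t) \<in> borel_measurable M" "f t \<in> borel_measurable M" for k
      using measurable_f qI t by auto
    have A[measurable]: "A k \<in> sets M" for k unfolding A_def by measurable
    have le: "emeasure M (A k) \<le> ennreal (1 / 2 ^ k)" for k
    proof -
      define u where "u = q k t - t"
      define s where "s n = (if n = 0 then u else 0)" for n :: nat
      have u: "u \<in> I" unfolding u_def using qI t by (rule diff_I)
      define B where "B = {y \<in> space pathspace. 1 / 2 ^ k < \<bar>y 0 - y 1\<bar>}"
      have "norm u < \<delta> k" using m norm_grid[of "m k" t] by (auto simp: u_def q_def intro: le_less_trans)
      then have "emeasure M {x \<in> space M. 1 / 2 ^ k < \<bar>f u x - f 0 x\<bar>} \<le> ennreal (1 / 2 ^ k)"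
        using \<delta> u by blast
      also have "{x \<in> space M. 1 / 2 ^ k < \<bar>f u x - f 0 x\<bar>} = {x \<in> space M. (\<lambda>n. f (s n) x) \<in> B}"
        by (auto simp: B_def s_def space_PiM)
      also have "emeasure M \<dots> = emeasure M {x \<in> space M. (\<lambda>n. f (s n + t) x) \<in> B}"
      proof (rule shift_invariant[symmetric])
        show "B \<in> sets pathspace" unfolding B_def by measurable
      qed (use u t zero_I in \<open>auto simp: B_def s_def\<close>)
      also have "{x \<in> space M. (\<lambda>n. f (s n + t) x) \<in> B} = A k"
        by (auto simp: B_def s_def space_PiM u_def A_def)
      finally show ?thesis .
    qed
    have "AE x in M. eventually (\<lambda>k. x \<in> space M - A k) sequentially"
    proof (rule borel_cantelli_AE1)
      show "emeasure M (A k) < \<infinity>" for k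
        using le[of k] by (rule order.strict_trans1) simp
      show "summable (\<lambda>k. measure M (A k))"
      proof (rule summable_comparison_test')
        show "summable (\<lambda>k. (1 / 2) ^ k :: real)" by (rule summable_geometric) simp
        show "norm (measure M (A k)) \<le> (1 / 2) ^ k" for k
          using le[of k] unfolding measure_def by (simp add: enn2real_leI power_one_over)
      qed
    qed (rule A)
    then show ?thesis
    proof eventually_elim
      case (elim x)
      then have ev: "eventually (\<lambda>k. norm (f (q k t) x - f t x) \<le> (1 / 2) ^ k) sequentially"
        by (rule eventually_mono) (auto simp: A_def power_one_over)
      have "(\<lambda>k. f (q k t) x - f t x) \<longlonglongrightarrow> 0"
        by (rule Lim_null_comparison[OF ev]) (simp add: LIMSEQ_power_zero)
      then have "(\<lambda>k. f (q k t) x) \<longlonglongrightarrow> f t x" by (simp add: LIM_zero_iff)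
      then show ?case unfolding F_def by (rule limI)
    qed
  qed
  ultimately show ?thesis by (intro that[of F]) (auto simp: case_prod_beta')
qed

text \<open>
  \<open>T t x\<close> is the point whose path is the path of \<open>x\<close> shifted by \<open>t\<close>.  Each property of
  \<open>T t\<close> is an almost everywhere property of the path at \<open>t = 0\<close>, carried over to the shifted path
  by equality of laws.
\<close>

lemma ex_flow_nonempty:
  assumes "space M \<noteq> {}"
  shows "\<exists>T. measure_preserving_flow I M T \<and> measurable_flow I M T \<and>
    (\<forall>t\<in>I. T t \<in> M \<rightarrow>\<^sub>M M \<and> distr M M (T t) = M) \<and> (\<forall>t\<in>I. AE x in M. f t x = f 0 (T t x))"
proof -
  obtain s :: "nat \<Rightarrow> real ^ 'd" and G where s: "range s \<subseteq> I" and G[measurable]: "G \<in> pathspace \<rightarrow>\<^sub>M M" and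
    rec: "AE x in M. G (\<lambda>n. f (s n) x) = x" and nz: "AE x in M. (\<lambda>n. f (s n) x) \<noteq> (\<lambda>_. 0)"
    using recovery_map[OF assms] .
  obtain F :: "real ^ 'd \<Rightarrow> 'w \<Rightarrow> real" where
    F: "(\<lambda>(t, x). F t x) \<in> borel_measurable (restrict_space borel I \<Otimes>\<^sub>M M)" and
    F_eq: "\<forall>t\<in>I. AE x in M. F t x = f t x"
    using jointly_measurable_version .
  have sI: "s n \<in> I" for n using s by auto
  have [measurable]: "f (s n) \<in> borel_measurable M" for n by (rule measurable_f[OF sI])
  have fI[measurable]: "f (s n + t) \<in> borel_measurable M" if "t \<in> I" for n t
    by (rule measurable_f[OF add_I[OF sI that]])
  \<comment> \<open>Where the shifted path vanishes, every \<open>f u\<close> vanishes: with \<open>u - t\<close> prepended to the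
    sequence, this is an event off the origin, and it is null before the shift.\<close>
  have nz_shift: "AE x in M. (\<lambda>n. f (s n + t) x) \<noteq> (\<lambda>_. 0)" if t: "t \<in> I" for t
  proof -
    define B where "B = {x \<in> space M. \<forall>n. f (s n + t) x = 0}"
    have [measurable]: "f (s n + t) \<in> borel_measurable M" for n using fI t .
    have B[measurable]: "B \<in> sets M" unfolding B_def by measurable
    have "AE x in M. x \<in> B \<longrightarrow> f u x = 0" if u: "u \<in> I" for u
    proof -
      define s' where "s' = case_nat (u - t) s"
      define A where "A = {y \<in> space pathspace. y 0 \<noteq> 0 \<and> (\<forall>n. y (Suc n) = 0)}"
      have ut: "u - t \<in> I" using u t by (rule diff_I)
      have [measurable]: "f u \<in> borel_measurable M" "f (u - t) \<in> borel_measurable M"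
        using u ut by (auto intro: measurable_f)
      have "emeasure M {x \<in> space M. (\<lambda>n. f (s' n + t) x) \<in> A} = emeasure M {x \<in> space M. (\<lambda>n. f (s' n) x) \<in> A}"
      proof (rule shift_invariant)
        show "range s' \<subseteq> I" using ut sI by (auto simp: s'_def split: nat.splits)
        show "A \<in> sets pathspace" unfolding A_def by measurable
      qed (auto simp: A_def t)
      also have "{x \<in> space M. (\<lambda>n. f (s' n) x) \<in> A} = {x \<in> space M. f (u - t) x \<noteq> 0 \<and> (\<forall>n. f (s n) x = 0)}"
        by (auto simp: A_def s'_def space_PiM)
      also have "emeasure M \<dots> = 0"
      proof (rule emeasure_eq_0_AE)
        show "AE x in M. \<not> (f (u - t) x \<noteq> 0 \<and> (\<forall>n. f (s n) x = 0))"
          using nz by eventually_elim auto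
      qed
      finally have "emeasure M {x \<in> space M. f u x \<noteq> 0 \<and> (\<forall>n. f (s n + t) x = 0)} = 0"
        by (simp add: A_def s'_def space_PiM)
      then have "{x \<in> space M. f u x \<noteq> 0 \<and> (\<forall>n. f (s n + t) x = 0)} \<in> null_sets M"
        by (simp add: null_sets_def)
      from AE_not_in[OF this] AE_space show ?thesis by eventually_elim (auto simp: B_def)
    qed
    then have "emeasure M B = 0" using minimal B unfolding minimal_rep_def by (auto simp: zero_less_iff_neq_zero)
    then have "B \<in> null_sets M" using B by auto
    from AE_not_in[OF this] AE_space show ?thesis by eventually_elim (auto simp: B_def fun_eq_iff)
  qed
  \<comment> \<open>Since neither the path nor the shifted path vanishes, the laws agree on sets containing the
    origin too.\<close>
  have law: "emeasure M {x \<in> space M. (\<lambda>n. f (s' n + t) x) \<in> A} = emeasure M {x \<in> space M. (\<lambda>n. f (s' n) x) \<in> A}"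
    if s': "range s \<subseteq> range s'" "range s' \<subseteq> I" and t: "t \<in> I" and A[measurable]: "A \<in> sets pathspace" for s' t A
  proof -
    have m[measurable]: "(\<lambda>x n. f (s' n + t) x) \<in> M \<rightarrow>\<^sub>M pathspace" "(\<lambda>x n. f (s' n) x) \<in> M \<rightarrow>\<^sub>M pathspace"
      using s'(2) add_I t measurable_path[of "\<lambda>n. s' n + t"] measurable_path[OF s'(2)] by (auto simp: image_subset_iff)
    have [measurable]: "{\<lambda>_. 0} \<in> sets pathspace"
    proof -
      have "{\<lambda>_. 0} = {y :: nat \<Rightarrow> real. \<forall>n. y n = 0}" by auto
      also have "\<dots> \<in> sets pathspace" by (intro pathspace_Collect) measurable
      finally show ?thesis .
    qed
    have off: "AE x in M. (\<lambda>n. f (s' n + t) x) \<noteq> (\<lambda>_. 0)" "AE x in M. (\<lambda>n. f (s' n) x) \<noteq> (\<lambda>_. 0)"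
    proof -
      have s_s': "\<forall>n. \<exists>k. s n = s' k" using s'(1) by auto
      from nz_shift[OF t] show "AE x in M. (\<lambda>n. f (s' n + t) x) \<noteq> (\<lambda>_. 0)"
        by eventually_elim (use s_s' in \<open>metis\<close>)
      from nz show "AE x in M. (\<lambda>n. f (s' n) x) \<noteq> (\<lambda>_. 0)"
        by eventually_elim (use s_s' in \<open>metis\<close>)
    qed
    have "emeasure M {x \<in> space M. (\<lambda>n. f (s' n + t) x) \<in> A} = emeasure M {x \<in> space M. (\<lambda>n. f (s' n + t) x) \<in> A - {\<lambda>_. 0}}"
    proof (rule emeasure_Collect_eq_AE)
      from off(1) show "AE x in M. ((\<lambda>n. f (s' n + t) x) \<in> A) = ((\<lambda>n. f (s' n + t) x) \<in> A - {\<lambda>_. 0})"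
        by eventually_elim simp
    qed measurable
    also have "\<dots> = emeasure M {x \<in> space M. (\<lambda>n. f (s' n) x) \<in> A - {\<lambda>_. 0}}"
      by (rule shift_invariant) (use s' t in auto)
    also have "\<dots> = emeasure M {x \<in> space M. (\<lambda>n. f (s' n) x) \<in> A}"
    proof (rule emeasure_Collect_eq_AE)
      from off(2) show "AE x in M. ((\<lambda>n. f (s' n) x) \<in> A - {\<lambda>_. 0}) = ((\<lambda>n. f (s' n) x) \<in> A)"
        by eventually_elim simp
    qed measurable
    finally show ?thesis .
  qed
  define T where "T t x = G (\<lambda>n. F (s n + t) x)" for t x
  have T_joint: "(\<lambda>(t, x). T t x) \<in> restrict_space borel I \<Otimes>\<^sub>M M \<rightarrow>\<^sub>M M"
  proof -
    have "(\<lambda>p. (s n + fst p, snd p)) \<in> restrict_space borel I \<Otimes>\<^sub>M M \<rightarrow>\<^sub>M restrict_space borel I \<Otimes>\<^sub>M M" for n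
    proof (rule measurable_Pair)
      show "(\<lambda>p. s n + fst p) \<in> restrict_space borel I \<Otimes>\<^sub>M M \<rightarrow>\<^sub>M restrict_space borel I"
      proof (rule measurable_restrict_space2)
        show "(\<lambda>p. s n + fst p) \<in> space (restrict_space borel I \<Otimes>\<^sub>M M) \<rightarrow> I"
          using add_I[OF sI] by (auto simp: space_pair_measure space_restrict_space)
        show "(\<lambda>p. s n + fst p) \<in> borel_measurable (restrict_space borel I \<Otimes>\<^sub>M M)"
          by (intro borel_measurable_add borel_measurable_const measurable_compose[OF measurable_fst
              measurable_restrict_space1[OF measurable_ident_sets[OF refl]]])
      qed
    qed simp
    from measurable_compose[OF this F]
    have "(\<lambda>p. F (s n + fst p) (snd p)) \<in> borel_measurable (restrict_space borel I \<Otimes>\<^sub>M M)" for n by simp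
    then have "(\<lambda>p n. F (s n + fst p) (snd p)) \<in> restrict_space borel I \<Otimes>\<^sub>M M \<rightarrow>\<^sub>M pathspace"
      by (intro measurable_PiM_single') auto
    from measurable_compose[OF this G] show ?thesis by (simp add: T_def case_prod_beta')
  qed
  have T[measurable]: "T t \<in> M \<rightarrow>\<^sub>M M" if "t \<in> I" for t
    using measurable_compose[OF measurable_Pair1'[of t] T_joint] that by (simp add: space_restrict_space)
  have T_f: "AE x in M. T t x = G (\<lambda>n. f (s n + t) x)" if t: "t \<in> I" for t
  proof -
    have "AE x in M. \<forall>n. F (s n + t) x = f (s n + t) x"
      using F_eq[rule_format, OF add_I[OF sI t]] by (simp add: AE_all_countable)
    then show ?thesis by eventually_elim (simp add: T_def)
  qed
  have path[measurable]: "(\<lambda>x n. f (s n + t) x) \<in> M \<rightarrow>\<^sub>M pathspace" if "t \<in> I" for t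
    using measurable_path[of "\<lambda>n. s n + t"] add_I[OF sI that] by auto
  have path0[measurable]: "(\<lambda>x n. f (s n) x) \<in> M \<rightarrow>\<^sub>M pathspace" by (rule measurable_path[OF s])
  have T_preserves: "emeasure M (T t -` B \<inter> space M) = emeasure M B" if t: "t \<in> I" and B[measurable]: "B \<in> sets M" for t B
  proof -
    note [measurable] = T[OF t] path[OF t]
    have BS: "B = {x \<in> space M. x \<in> B}" using sets.sets_into_space[OF B] by auto
    have "emeasure M (T t -` B \<inter> space M) = emeasure M {x \<in> space M. T t x \<in> B}"
      by (rule arg_cong[of _ _ "emeasure M"]) auto
    also have "\<dots> = emeasure M {x \<in> space M. (\<lambda>n. f (s n + t) x) \<in> G -` B \<inter> space pathspace}"
    proof (rule emeasure_Collect_eq_AE)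
      from T_f[OF t] show "AE x in M. (T t x \<in> B) = ((\<lambda>n. f (s n + t) x) \<in> G -` B \<inter> space pathspace)"
        by eventually_elim (simp add: space_PiM)
    qed measurable
    also have "\<dots> = emeasure M {x \<in> space M. (\<lambda>n. f (s n) x) \<in> G -` B \<inter> space pathspace}"
      by (rule law) (use s t in auto)
    also have "\<dots> = emeasure M {x \<in> space M. x \<in> B}"
    proof (rule emeasure_Collect_eq_AE)
      from rec show "AE x in M. ((\<lambda>n. f (s n) x) \<in> G -` B \<inter> space pathspace) = (x \<in> B)"
        by eventually_elim (simp add: space_PiM)
    qed measurable
    also have "\<dots> = emeasure M B" using BS by simp
    finally show ?thesis .
  qed
  have T_distr: "distr M M (T t) = M" if t: "t \<in> I" for t
    by (rule measure_eqI) (use T_preserves[OF t] T[OF t] in \<open>auto simp: emeasure_distr\<close>)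
  have T_AE: "AE x in M. P (T t x)" if "t \<in> I" "AE x in M. P x" for t P
    by (rule AE_distrD[OF T[OF that(1)]]) (simp only: T_distr[OF that(1)] that(2))
  have f_T: "AE x in M. f (r + t) x = f r (T t x)" if r: "r \<in> I" and t: "t \<in> I" for r t
  proof -
    define s' where "s' = case_nat r s"
    \<comment> \<open>For the unshifted path, \<open>y 0\<close> is \<open>f r x\<close> and \<open>G\<close> returns \<open>x\<close>, so \<open>A\<close> is null.\<close>
    define h where "h y = f r (G (\<lambda>n. y (Suc n)))" for y
    define A where "A = {y \<in> space pathspace. y 0 - h y \<noteq> 0}"
    note [measurable] = path[OF t] measurable_f[OF r] measurable_f[OF add_I[OF r t]]
    have "(\<lambda>y n. y (Suc n)) \<in> pathspace \<rightarrow>\<^sub>M pathspace" by (rule measurable_PiM_single') (auto simp: space_PiM)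
    from measurable_compose[OF measurable_compose[OF this G] measurable_f[OF r]]
    have h: "h \<in> borel_measurable pathspace" unfolding h_def .
    have "(\<lambda>y. y 0) \<in> borel_measurable pathspace" by measurable
    from borel_measurable_diff[OF this h] have [measurable]: "(\<lambda>y. y 0 - h y) \<in> borel_measurable pathspace" .
    have "emeasure M {x \<in> space M. (\<lambda>n. f (s' n + t) x) \<in> A} = emeasure M {x \<in> space M. (\<lambda>n. f (s' n) x) \<in> A}"
    proof (rule law)
      show "range s \<subseteq> range s'" unfolding s'_def by (metis image_subsetI nat.case(2) rangeI)
      show "range s' \<subseteq> I" using r sI by (auto simp: s'_def split: nat.splits)
      show "A \<in> sets pathspace" unfolding A_def by measurable
    qed (rule t)
    also have "{x \<in> space M. (\<lambda>n. f (s' n) x) \<in> A} = {x \<in> space M. f r x \<noteq> f r (G (\<lambda>n. f (s n) x))}"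
      by (auto simp: A_def h_def s'_def space_PiM)
    also have "emeasure M \<dots> = 0"
    proof (rule emeasure_eq_0_AE)
      show "AE x in M. \<not> f r x \<noteq> f r (G (\<lambda>n. f (s n) x))" using rec by eventually_elim simp
    qed
    finally have "{x \<in> space M. f (r + t) x \<noteq> f r (G (\<lambda>n. f (s n + t) x))} \<in> null_sets M"
      by (simp add: A_def h_def s'_def space_PiM null_sets_def)
    from AE_not_in[OF this] AE_space T_f[OF t] show ?thesis by eventually_elim auto
  qed
  have T_add: "AE x in M. T t (T u x) = T (t + u) x" if t: "t \<in> I" and u: "u \<in> I" for t u
  proof -
    have "AE x in M. \<forall>n. f (s n + t + u) x = f (s n + t) (T u x)"
      unfolding AE_all_countable using f_T[OF add_I[OF sI t] u] by blast
    moreover note T_AE[OF u T_f[OF t]] T_f[OF add_I[OF t u]]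
    ultimately show ?thesis
      by eventually_elim (simp add: add.assoc)
  qed
  have T_0: "AE x in M. T 0 x = x"
    using T_f[OF zero_I] rec by eventually_elim simp
  \<comment> \<open>The set where \<open>T (- t)\<close> fails to invert \<open>T t\<close> must be measurable; separating sets show
    that it is.\<close>
  obtain E :: "nat \<Rightarrow> 'w set" where E: "range E \<subseteq> sets M" and
    sep: "\<And>x y. x \<in> space M \<Longrightarrow> y \<in> space M \<Longrightarrow> (\<forall>n. x \<in> E n \<longleftrightarrow> y \<in> E n) \<Longrightarrow> x = y"
    using sigma_finite_borel_separating[OF borel_space] by metis
  have inverse_null: "{x \<in> space M. T (- t) (T t x) \<noteq> x} \<in> null_sets M" if t: "t \<in> I" for t
  proof -
    note [measurable] = T[OF t] T[OF minus_I[OF t]]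
    have [measurable]: "E n \<in> sets M" for n using E by auto
    have "{x \<in> space M. T (- t) (T t x) \<noteq> x} = {x \<in> space M. \<exists>n. \<not> (x \<in> E n \<longleftrightarrow> T (- t) (T t x) \<in> E n)}"
    proof -
      have "T (- t) (T t x) = x \<longleftrightarrow> (\<forall>n. x \<in> E n \<longleftrightarrow> T (- t) (T t x) \<in> E n)" if x: "x \<in> space M" for x
        using sep[OF x, of "T (- t) (T t x)"] measurable_space[OF T[OF minus_I[OF t]] measurable_space[OF T[OF t] x]]
        by metis
      then show ?thesis by auto
    qed
    also have "\<dots> \<in> sets M" by measurable
    finally have "{x \<in> space M. T (- t) (T t x) \<noteq> x} \<in> sets M" .
    moreover have "AE x in M. T (- t) (T t x) = x"
      using T_add[OF minus_I[OF t] t] T_0 by eventually_elim simp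
    ultimately show ?thesis by (intro null_setsI emeasure_eq_0_AE) auto
  qed
  have iso: "measure_space_iso_mod0 M (T t)" if t: "t \<in> I" for t
  proof -
    define N1 where "N1 = {x \<in> space M. T (- t) (T t x) \<noteq> x}"
    define N2 where "N2 = {x \<in> space M. T t (T (- t) x) \<noteq> x}"
    have N: "N1 \<in> null_sets M" "N2 \<in> null_sets M"
      using inverse_null[OF t] inverse_null[OF minus_I[OF t]] by (auto simp: N1_def N2_def)
    note meas = T[OF t] T[OF minus_I[OF t]]
    note sp = measurable_space[OF T[OF t]] measurable_space[OF T[OF minus_I[OF t]]]
    have fwd: "T t x \<in> space M - N2" "T (- t) (T t x) = x" if "x \<in> space M - N1" for x
      using that sp by (auto simp: N1_def N2_def)
    have bwd: "T (- t) x \<in> space M - N1" "T t (T (- t) x) = x" if "x \<in> space M - N2" for x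
      using that sp by (auto simp: N1_def N2_def)
    have bij: "bij_betw (T t) (space M - N1) (space M - N2)"
      by (rule bij_betw_byWitness[where f' = "T (- t)"]) (use fwd bwd in auto)
    have inv: "the_inv_into (space M - N1) (T t) y = T (- t) y" if "y \<in> space M - N2" for y
      using bij bwd[OF that] the_inv_into_f_f[of "T t" "space M - N1" "T (- t) y"]
      by (simp add: bij_betw_def)
    have mr: "g \<in> restrict_space M S \<rightarrow>\<^sub>M restrict_space M S'" if "g \<in> M \<rightarrow>\<^sub>M M" "\<And>x. x \<in> S \<Longrightarrow> g x \<in> S'" for g S S'
      using that by (intro measurable_restrict_space3) auto
    show ?thesis unfolding measure_space_iso_mod0_def
    proof (intro bexI conjI ballI impI)
      show "bij_betw (T t) (space M - N1) (space M - N2)" by fact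
      show "T t \<in> restrict_space M (space M - N1) \<rightarrow>\<^sub>M restrict_space M (space M - N2)"
        by (rule mr[OF meas(1)]) (use fwd(1) in blast)
      have "T (- t) \<in> restrict_space M (space M - N2) \<rightarrow>\<^sub>M restrict_space M (space M - N1)"
        by (rule mr[OF meas(2)]) (use bwd(1) in blast)
      then show "the_inv_into (space M - N1) (T t) \<in> restrict_space M (space M - N2) \<rightarrow>\<^sub>M restrict_space M (space M - N1)"
        by (subst measurable_cong[of _ _ "T (- t)"]) (auto simp: space_restrict_space inv)
    next
      fix B assume B: "B \<in> sets M" "B \<subseteq> space M - N2"
      have "emeasure M (T t -` B \<inter> (space M - N1)) = emeasure M (T t -` B \<inter> space M)"
      proof (rule emeasure_eq_AE)
        show "AE x in M. (x \<in> T t -` B \<inter> (space M - N1)) = (x \<in> T t -` B \<inter> space M)"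
          using AE_not_in[OF N(1)] by eventually_elim auto
        show TB: "T t -` B \<inter> space M \<in> sets M" by (rule measurable_sets[OF meas(1) B(1)])
        have "T t -` B \<inter> (space M - N1) = T t -` B \<inter> space M - N1" by auto
        then show "T t -` B \<inter> (space M - N1) \<in> sets M" using TB N(1) by auto
      qed
      also have "\<dots> = emeasure M B" by (rule T_preserves[OF t B(1)])
      finally show "emeasure M (T t -` B \<inter> (space M - N1)) = emeasure M B" .
    qed (use N in auto)
  qed
  have "measure_preserving_flow I M T"
    unfolding measure_preserving_flow_def using measurable_space[OF T] iso T_0 T_add by auto
  moreover have "\<forall>t\<in>I. AE x in M. f t x = f 0 (T t x)"
    using f_T[OF zero_I] by simp
  moreover have "measurable_flow I M T" using T_joint by (simp add: measurable_flow_def)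
  ultimately show ?thesis using T T_distr by blast
qed

lemma ex_flow:
  "\<exists>T. measure_preserving_flow I M T \<and> measurable_flow I M T \<and>
    (\<forall>t\<in>I. T t \<in> M \<rightarrow>\<^sub>M M \<and> distr M M (T t) = M) \<and> (\<forall>t\<in>I. AE x in M. f t x = f 0 (T t x))"
proof (cases "space M = {}")
  case True
  have "measure_space_iso_mod0 M (\<lambda>x. x)"
    unfolding measure_space_iso_mod0_def using True
    by (intro bexI[of _ "{}"]) (auto simp: bij_betw_def measurable_def space_restrict_space)
  with True show ?thesis
    by (intro exI[of _ "\<lambda>t x. x"])
       (auto simp: measure_preserving_flow_def measurable_flow_def distr_id AE_I2)
qed (rule ex_flow_nonempty)

end

section \<open>Measures on the space of sequences\<close>

text \<open>
  On \<open>{w k > 0}\<close> a measure is recovered from its density by dividing by \<open>w k\<close>.  This reduces the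
  comparison of two exponent or Levy measures, which are infinite near the origin, to finite measures.
\<close>

lemma emeasure_eq_of_density_eq:
  fixes w :: "nat \<Rightarrow> 'y \<Rightarrow> real"
  assumes sets: "sets \<nu>1 = sets N" "sets \<nu>2 = sets N"
    and w: "\<And>k. w k \<in> borel_measurable N"
    and eq: "\<And>k. density \<nu>1 (\<lambda>y. ennreal (w k y)) = density \<nu>2 (\<lambda>y. ennreal (w k y))"
    and A: "A \<in> sets N" and pos: "\<And>y. y \<in> A \<Longrightarrow> \<exists>k. w k y > 0"
  shows "emeasure \<nu>1 A = emeasure \<nu>2 A"
proof -
  note [measurable] = w A
  have [measurable_cong]: "sets \<nu>1 = sets N" "sets \<nu>2 = sets N" by fact+
  have sp: "space \<nu>1 = space N" "space \<nu>2 = space N" using sets by (auto dest: sets_eq_imp_space_eq)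
  define D where "D k = {y \<in> A. w k y > 0}" for k
  have D[measurable]: "D k \<in> sets N" for k
  proof -
    have "{y \<in> space N. y \<in> A \<and> w k y > 0} \<in> sets N" by measurable
    also have "{y \<in> space N. y \<in> A \<and> w k y > 0} = D k" using sets.sets_into_space[OF A] by (auto simp: D_def)
    finally show ?thesis .
  qed
  have part: "emeasure \<nu>1 B = emeasure \<nu>2 B" if B[measurable]: "B \<in> sets N" and sub: "B \<subseteq> D k" for B k
  proof -
    have *: "emeasure \<nu> B = (\<integral>\<^sup>+y. ennreal (1 / w k y) * indicator B y \<partial>density \<nu> (\<lambda>y. ennreal (w k y)))"
      if "sets \<nu> = sets N" for \<nu>
    proof -
      have [measurable_cong]: "sets \<nu> = sets N" by fact
      have "(\<integral>\<^sup>+y. ennreal (1 / w k y) * indicator B y \<partial>density \<nu> (\<lambda>y. ennreal (w k y))) =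
          (\<integral>\<^sup>+y. ennreal (w k y) * (ennreal (1 / w k y) * indicator B y) \<partial>\<nu>)"
        by (rule nn_integral_density) measurable
      also have "\<dots> = (\<integral>\<^sup>+y. indicator B y \<partial>\<nu>)"
      proof (rule nn_integral_cong)
        fix y
        show "ennreal (w k y) * (ennreal (1 / w k y) * indicator B y) = indicator B y"
          using sub by (cases "y \<in> B") (auto simp: D_def ennreal_mult[symmetric])
      qed
      finally show ?thesis by simp
    qed
    show ?thesis using *[OF sets(1)] *[OF sets(2)] eq[of k] by simp
  qed
  have "A = (\<Union>k. D k)" using pos by (auto simp: D_def)
  then have UN: "A = (\<Union>k. disjointed D k)" by (simp add: UN_disjointed_eq)
  have dD: "range (disjointed D) \<subseteq> sets N" using D by (intro sets.range_disjointed_sets) auto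
  have "emeasure \<nu> A = (\<Sum>k. emeasure \<nu> (disjointed D k))" if "sets \<nu> = sets N" for \<nu>
    unfolding UN using dD that by (intro suminf_emeasure[symmetric] disjoint_family_disjointed) auto
  moreover have "emeasure \<nu>1 (disjointed D k) = emeasure \<nu>2 (disjointed D k)" for k
    using dD by (intro part[of _ k] disjointed_subset) auto
  ultimately show ?thesis using sets by simp
qed

lemma sets_pathspace_halfspaces:
  "sets pathspace = sigma_sets UNIV {{y. \<forall>n\<in>K. y n \<le> x n} | (K::nat set) (x::nat \<Rightarrow> real). finite K}"
    (is "_ = sigma_sets UNIV ?E")
proof (rule equalityI)
  define N where "N = sigma UNIV ?E"
  have N: "space N = UNIV" "sets N = sigma_sets UNIV ?E" by (auto simp: N_def)
  have "(\<lambda>y. y n) \<in> borel_measurable N" for n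
  proof (rule borel_measurableI_le)
    fix a :: real
    have "{y. \<forall>k\<in>{n}. y k \<le> a} \<in> ?E" by (intro CollectI exI[of _ "{n}"] exI[of _ "\<lambda>_. a"]) simp
    then show "{y \<in> space N. y n \<le> a} \<in> sets N" unfolding N by (intro sigma_sets.Basic) simp
  qed
  then have id: "(\<lambda>y. y) \<in> N \<rightarrow>\<^sub>M pathspace" by (intro measurable_PiM_single') (auto simp: N(1))
  show "sets pathspace \<subseteq> sigma_sets UNIV ?E"
    using measurable_sets[OF id] by (auto simp: N)
  have "?E \<subseteq> sets pathspace"
  proof safe
    fix K :: "nat set" and x :: "nat \<Rightarrow> real" assume "finite K"
    then show "{y. \<forall>n\<in>K. y n \<le> x n} \<in> sets pathspace" by (intro pathspace_Collect) measurable
  qed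
  then show "sigma_sets UNIV ?E \<subseteq> sets pathspace"
    using sets.sigma_sets_subset[of ?E pathspace] by (simp add: space_PiM)
qed

text \<open>
  Half spaces with finitely many constraints are stable under intersection and generate the product
  \<open>\<sigma>\<close>-algebra; the whole space is the case of no constraint.
\<close>

lemma finite_pathspace_measure_eqI:
  assumes sets: "sets \<nu>1 = sets pathspace" "sets \<nu>2 = sets pathspace" and fin: "finite_measure \<nu>1"
    and eq: "\<And>K x. finite K \<Longrightarrow> emeasure \<nu>1 {y. \<forall>n\<in>K. y n \<le> x n} = emeasure \<nu>2 {y. \<forall>n\<in>K. y n \<le> x n}"
  shows "\<nu>1 = \<nu>2"
proof -
  interpret finite_measure \<nu>1 by fact
  let ?E = "{{y. \<forall>n\<in>K. y n \<le> x n} | (K::nat set) (x::nat \<Rightarrow> real). finite K}"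
  show ?thesis
  proof (rule measure_eqI_generator_eq[where E = ?E and \<Omega> = UNIV and A = "\<lambda>_. UNIV"])
    show "Int_stable ?E"
    proof (rule Int_stableI)
      fix A B assume "A \<in> ?E" "B \<in> ?E"
      then obtain K x L y where K: "A = {z. \<forall>n\<in>K. z n \<le> x n}" "finite K"
        and L: "B = {z. \<forall>n\<in>L. z n \<le> (y n :: real)}" "finite L" by auto
      define m where "m n = (if n \<in> K then if n \<in> L then min (x n) (y n) else x n else y n)" for n
      have "A \<inter> B = {z. \<forall>n\<in>K \<union> L. z n \<le> m n}" unfolding K L by (auto simp: m_def split: if_splits)
      then show "A \<inter> B \<in> ?E" using K L by blast
    qed
    show "sets \<nu>1 = sigma_sets UNIV ?E" "sets \<nu>2 = sigma_sets UNIV ?E"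
      using sets sets_pathspace_halfspaces by auto
    show "range (\<lambda>_. UNIV) \<subseteq> ?E" by (auto intro!: exI[of _ "{}"])
    show "emeasure \<nu>1 UNIV \<noteq> \<infinity>" by simp
    fix X assume "X \<in> ?E"
    then show "emeasure \<nu>1 X = emeasure \<nu>2 X" using eq by auto
  qed auto
qed

lemma finite_measure_char_unique:
  fixes M1 M2 :: "real measure"
  assumes sets: "sets M1 = sets borel" "sets M2 = sets borel"
    and fin: "finite_measure M1" "finite_measure M2"
    and char: "\<And>t. (\<integral>x. iexp (t * x) \<partial>M1) = (\<integral>x. iexp (t * x) \<partial>M2)"
  shows "M1 = M2"
proof -
  interpret M1: finite_measure M1 by fact
  interpret M2: finite_measure M2 by fact
  have sp: "space M1 = UNIV" "space M2 = UNIV" using sets by (auto dest: sets_eq_imp_space_eq)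
  define m where "m = measure M1 UNIV"
  have m2: "m = measure M2 UNIV"
    using char[of 0] by (simp add: sp m_def)
  have em: "emeasure M1 UNIV = ennreal m" "emeasure M2 UNIV = ennreal m"
    using M1.emeasure_eq_measure M2.emeasure_eq_measure by (auto simp: m2) (simp add: m_def flip: m2)
  show ?thesis
  proof (cases "m = 0")
    case True
    show ?thesis
    proof (rule measure_eqI)
      fix A assume "A \<in> sets M1"
      have "emeasure M1 A \<le> emeasure M1 UNIV" "emeasure M2 A \<le> emeasure M2 UNIV"
        using sp by (metis emeasure_space)+
      then show "emeasure M1 A = emeasure M2 A" using True em by simp
    qed (simp add: sets)
  next
    case False
    then have m: "m > 0" by (simp add: m_def order_less_le)
    let ?D = "\<lambda>N. density N (\<lambda>_. ennreal (1 / m)) :: real measure"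
    have dist: "real_distribution (?D N)" if "sets N = sets borel" "emeasure N UNIV = ennreal m" for N
    proof -
      have sN: "space N = UNIV" using that(1) by (auto dest: sets_eq_imp_space_eq)
      have UN: "UNIV \<in> sets N" using sets.top[of N] sN by simp
      have "emeasure (?D N) UNIV = 1" using that m UN
        by (simp add: emeasure_density_const ennreal_mult[symmetric])
      then show ?thesis
        by (intro real_distribution.intro prob_spaceI real_distribution_axioms.intro) (auto simp: that sN)
    qed
    have meas: "(\<lambda>x. iexp (t * x)) \<in> borel_measurable N" if "sets N = sets borel" for N t
      using that by (subst measurable_cong_sets[OF that refl]) measurable
    have "char (?D M1) = char (?D M2)"
    proof
      fix t
      show "char (?D M1) t = char (?D M2) t"
        unfolding char_def using char[of t] m meas[OF sets(1)] meas[OF sets(2)]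
        by (subst (1 2) integral_density) (auto intro!: AE_I2)
    qed
    then have D: "?D M1 = ?D M2" using dist sets em by (intro Levy_uniqueness) auto
    show ?thesis
    proof (rule measure_eqI)
      fix A assume A: "A \<in> sets M1"
      have "ennreal (1 / m) * emeasure M1 A = ennreal (1 / m) * emeasure M2 A"
        using arg_cong[OF D, of "\<lambda>N. emeasure N A"] A sets by (simp add: emeasure_density_const)
      then have "ennreal m * (ennreal (1 / m) * emeasure M1 A) = ennreal m * (ennreal (1 / m) * emeasure M2 A)" by simp
      moreover have "ennreal m * ennreal (1 / m) = 1" using m by (simp add: ennreal_mult[symmetric])
      ultimately show "emeasure M1 A = emeasure M2 A" by (simp add: mult.assoc[symmetric])
    qed (simp add: sets)
  qed
qed

text \<open>
  The one-dimensional uniqueness theorem is applied one coordinate at a time: exponentials in the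
  coordinates of \<open>K\<close> are exchanged for indicators of half lines, while exponentials in the other
  coordinates remain.  To have positive measures at each step, the complex factor \<open>exp (i l)\<close> is
  replaced by the weights \<open>1 + cos (l + \<phi>)\<close>; the values \<open>0\<close>, \<open>pi\<close>, \<open>- pi / 2\<close> of
  \<open>\<phi>\<close> recover it.
\<close>

lemma finite_pathspace_measure_char_unique:
  assumes sets: "sets \<nu>1 = sets pathspace" "sets \<nu>2 = sets pathspace"
    and fin: "finite_measure \<nu>1" "finite_measure \<nu>2"
    and char: "\<And>K z. finite K \<Longrightarrow> (\<integral>y. iexp (\<Sum>n\<in>K. z n * y n) \<partial>\<nu>1) = (\<integral>y. iexp (\<Sum>n\<in>K. z n * y n) \<partial>\<nu>2)"
  shows "\<nu>1 = \<nu>2"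
proof -
  define C where "C K x = {y :: nat \<Rightarrow> real. \<forall>n\<in>K. y n \<le> x n}" for K x
  have C: "C K x \<in> sets pathspace" if "finite K" for K x
    unfolding C_def using that by (intro pathspace_Collect) measurable
  have key: "finite K \<Longrightarrow> \<forall>L z. finite L \<longrightarrow>
      (\<integral>y. of_real (indicator (C K x) y) * iexp (\<Sum>n\<in>L. z n * y n) \<partial>\<nu>1) =
      (\<integral>y. of_real (indicator (C K x) y) * iexp (\<Sum>n\<in>L. z n * y n) \<partial>\<nu>2)" for K x
  proof (induction K rule: finite_induct)
    case empty
    then show ?case using char by (simp add: C_def)
  next
    case (insert k K)
    note [measurable] = C[OF insert.hyps(1)]
    have Ck: "C (insert k K) x = C K x \<inter> {y. y k \<le> x k}" by (auto simp: C_def)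
    have ins[measurable]: "C (insert k K) x \<in> sets pathspace" using insert.hyps by (intro C) simp
    show ?case
    proof (intro allI impI)
      fix L :: "nat set" and z :: "nat \<Rightarrow> real" assume L: "finite L"
      let ?\<Psi> = "\<lambda>L z \<nu>. \<integral>y. of_real (indicator (C K x) y) * iexp (\<Sum>n\<in>L. z n * y n) \<partial>\<nu>"
      let ?p = "\<lambda>t n. (if n \<in> L then z n else 0) + (if n = k then t else 0 :: real)"
      let ?m = "\<lambda>t n. - (if n \<in> L then z n else 0) + (if n = k then t else 0 :: real)"
      define l where "l y = (\<Sum>n\<in>L. z n * y n)" for y
      have [measurable]: "l \<in> borel_measurable pathspace" unfolding l_def by measurable
      define w where "w \<phi> y = indicator (C K x) y * (1 + cos (l y + \<phi>))" for \<phi> y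
      have [measurable]: "w \<phi> \<in> borel_measurable pathspace" for \<phi> unfolding w_def by measurable
      have w_nn: "0 \<le> w \<phi> y" for \<phi> y
      proof -
        have "0 \<le> 1 + cos (l y + \<phi>)" using cos_ge_minus_one[of "l y + \<phi>"] by linarith
        then show ?thesis by (simp add: w_def)
      qed
      have w_le: "w \<phi> y \<le> 2" for \<phi> y
      proof -
        have "1 + cos (l y + \<phi>) \<le> 2" using cos_le_one[of "l y + \<phi>"] by linarith
        then show ?thesis by (simp add: w_def indicator_def)
      qed
      have half: "(\<integral>y. w \<phi> y * indicator {y. y k \<le> x k} y \<partial>\<nu>1) = (\<integral>y. w \<phi> y * indicator {y. y k \<le> x k} y \<partial>\<nu>2)" for \<phi>
      proof -
        define \<rho> where "\<rho> \<nu> = distr (density \<nu> (\<lambda>y. ennreal (w \<phi> y))) borel (\<lambda>y. y k)" for \<nu> :: "(nat \<Rightarrow> real) measure"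
        have one: "finite_measure (\<rho> \<nu>) \<and> (\<forall>t. (\<integral>x. iexp (t * x) \<partial>\<rho> \<nu>) =
            ?\<Psi> {k} (\<lambda>_. t) \<nu>
          + iexp \<phi> / 2 * ?\<Psi> (insert k L) (?p t) \<nu>
          + iexp (- \<phi>) / 2 * ?\<Psi> (insert k L) (?m t) \<nu>)
          \<and> measure (\<rho> \<nu>) {..x k} = (\<integral>y. w \<phi> y * indicator {y. y k \<le> x k} y \<partial>\<nu>)"
          if s\<nu>: "sets \<nu> = sets pathspace" and f\<nu>: "finite_measure \<nu>" for \<nu>
        proof -
          interpret \<nu>: finite_measure \<nu> by fact
          have [measurable_cong]: "sets \<nu> = sets pathspace" by fact
          have sp\<nu>: "space \<nu> = UNIV" using sets_eq_imp_space_eq[OF s\<nu>] by (simp add: space_PiM)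
          have [measurable]: "(\<lambda>y. y k) \<in> borel_measurable (density \<nu> (\<lambda>y. ennreal (w \<phi> y)))" by measurable
          have "emeasure (\<rho> \<nu>) UNIV = (\<integral>\<^sup>+y. ennreal (w \<phi> y) \<partial>\<nu>)"
            unfolding \<rho>_def using sets.top[of \<nu>] by (simp add: emeasure_distr emeasure_density sp\<nu>)
          also have "\<dots> \<le> (\<integral>\<^sup>+y. ennreal 2 \<partial>\<nu>)"
            using w_le by (intro nn_integral_mono ennreal_leI) auto
          also have "\<dots> < \<infinity>" using \<nu>.emeasure_finite[of "space \<nu>"]
            by (simp add: ennreal_mult_eq_top_iff less_top[symmetric])
          finally have fin: "finite_measure (\<rho> \<nu>)" by (intro finite_measureI) (simp add: \<rho>_def)
          have int: "integrable \<nu> g" if "g \<in> borel_measurable \<nu>" "\<And>y. norm (g y) \<le> 2" for g :: "_ \<Rightarrow> complex"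
            using that by (intro \<nu>.integrable_const_bound[of _ 2]) auto
          have int': "integrable \<nu> (\<lambda>y. complex_of_real (indicator (C K x) y) * iexp (\<Sum>n\<in>L. a n * y n))" if "finite L" for L a
          proof (rule int)
            show "(\<lambda>y. complex_of_real (indicator (C K x) y) * iexp (\<Sum>n\<in>L. a n * y n)) \<in> borel_measurable \<nu>"
              unfolding measurable_cong_sets[OF s\<nu> refl] by measurable
            show "norm (complex_of_real (indicator (C K x) y) * iexp (\<Sum>n\<in>L. a n * y n)) \<le> 2" for y
              unfolding norm_mult norm_exp_i_times by (simp add: indicator_def)
          qed
          have "(\<integral>x. iexp (t * x) \<partial>\<rho> \<nu>) = (\<integral>y. complex_of_real (w \<phi> y) * iexp (t * y k) \<partial>\<nu>)" for t
            unfolding \<rho>_def using w_nn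
            by (subst integral_distr, measurable, subst integral_density) (auto simp: scaleR_conv_of_real)
          also have "\<dots> t = (\<integral>y. of_real (indicator (C K x) y) * iexp (\<Sum>n\<in>{k}. t * y n)
            + (iexp \<phi> / 2 * (of_real (indicator (C K x) y) * iexp (\<Sum>n\<in>insert k L. ?p t n * y n))
            + iexp (- \<phi>) / 2 * (of_real (indicator (C K x) y) * iexp (\<Sum>n\<in>insert k L. ?m t n * y n))) \<partial>\<nu>)" for t
          proof (rule Bochner_Integration.integral_cong[OF refl])
            fix y
            have s1: "(\<Sum>n\<in>insert k L. (s * (if n \<in> L then z n else 0) + (if n = k then t else 0)) * y n) = s * l y + t * y k" for s
            proof -
              have "(\<Sum>n\<in>insert k L. (s * (if n \<in> L then z n else 0) + (if n = k then t else 0)) * y n) =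
                s * (\<Sum>n\<in>insert k L. (if n \<in> L then z n * y n else 0)) + (\<Sum>n\<in>insert k L. (if n = k then t * y n else 0))"
                by (simp add: sum.distrib[symmetric] sum_distrib_left algebra_simps if_distrib cong: if_cong del: sum.insert)
                  (auto intro!: sum.cong simp: algebra_simps)
              also have "(\<Sum>n\<in>insert k L. (if n \<in> L then z n * y n else 0)) = l y"
                unfolding l_def using L by (intro sum.mono_neutral_cong_right) auto
              also have "(\<Sum>n\<in>insert k L. (if n = k then t * y n else 0)) = t * y k" using L by (subst sum.delta) auto
              finally show ?thesis .
            qed
            have e1: "iexp (\<Sum>n\<in>insert k L. ?p t n * y n) = iexp (l y) * iexp (t * y k)"
              using s1[of 1] unfolding mult_1 by (simp only: exp_add[symmetric] of_real_add distrib_left)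
            have e2: "iexp (\<Sum>n\<in>insert k L. ?m t n * y n) = iexp (- l y) * iexp (t * y k)"
              using s1[of "-1"] unfolding mult_minus1 by (simp only: exp_add[symmetric] of_real_add distrib_left)
            have c: "complex_of_real (cos (l y + \<phi>)) = (iexp \<phi> * iexp (l y) + iexp (- \<phi>) * iexp (- l y)) / 2"
              by (simp add: cos_of_real[symmetric] cos_exp_eq exp_add[symmetric] algebra_simps)
            show "complex_of_real (w \<phi> y) * iexp (t * y k) = of_real (indicator (C K x) y) * iexp (\<Sum>n\<in>{k}. t * y n)
              + (iexp \<phi> / 2 * (of_real (indicator (C K x) y) * iexp (\<Sum>n\<in>insert k L. ?p t n * y n))
              + iexp (- \<phi>) / 2 * (of_real (indicator (C K x) y) * iexp (\<Sum>n\<in>insert k L. ?m t n * y n)))"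
              unfolding e1 e2 w_def of_real_mult of_real_add of_real_1 c by (simp add: field_simps)
          qed
          also have "\<dots> t = ?\<Psi> {k} (\<lambda>_. t) \<nu>
          + (iexp \<phi> / 2 * ?\<Psi> (insert k L) (?p t) \<nu>
          + iexp (- \<phi>) / 2 * ?\<Psi> (insert k L) (?m t) \<nu>)" for t
          proof -
            have fi: "finite {k}" "finite (insert k L)" using L by auto
            note i1 = int'[OF fi(1), of "\<lambda>_. t"] and i2 = int'[OF fi(2)]
            show ?thesis
              by (subst Bochner_Integration.integral_add[OF i1 Bochner_Integration.integrable_add[OF integrable_mult_right[OF i2] integrable_mult_right[OF i2]]],
                  subst Bochner_Integration.integral_add[OF integrable_mult_right[OF i2] integrable_mult_right[OF i2]],
                  simp only: integral_mult_right_zero)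
          qed
          finally have ch: "(\<integral>x. iexp (t * x) \<partial>\<rho> \<nu>) = ?\<Psi> {k} (\<lambda>_. t) \<nu>
          + iexp \<phi> / 2 * ?\<Psi> (insert k L) (?p t) \<nu>
          + iexp (- \<phi>) / 2 * ?\<Psi> (insert k L) (?m t) \<nu>" for t
            by (simp only: add.assoc)
          have "emeasure (\<rho> \<nu>) {..x k} = (\<integral>\<^sup>+y. ennreal (w \<phi> y * indicator {y. y k \<le> x k} y) \<partial>\<nu>)"
          proof -
            have [measurable]: "{y. y k \<le> x k} \<in> sets pathspace"
              using C[of "{k}" x] by (simp add: C_def)
            have v: "(\<lambda>y. y k) -` {..x k} \<inter> space (density \<nu> (\<lambda>y. ennreal (w \<phi> y))) = {y. y k \<le> x k}" by (auto simp: sp\<nu>)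
            show ?thesis unfolding \<rho>_def
              by (subst emeasure_distr, measurable, subst v, subst emeasure_density)
                 (auto simp: ennreal_mult' ennreal_indicator w_nn intro!: nn_integral_cong)
          qed
          also have "\<dots> = ennreal (\<integral>y. w \<phi> y * indicator {y. y k \<le> x k} y \<partial>\<nu>)"
          proof (rule nn_integral_eq_integral)
            have [measurable]: "{y. y k \<le> x k} \<in> sets pathspace"
              using C[of "{k}" x] by (simp add: C_def)
            show "integrable \<nu> (\<lambda>y. w \<phi> y * indicator {y. y k \<le> x k} y)"
              using w_nn w_le by (intro \<nu>.integrable_const_bound[of _ 2]) (auto simp: indicator_def)
          qed (use w_nn in auto)
          finally have "measure (\<rho> \<nu>) {..x k} = (\<integral>y. w \<phi> y * indicator {y. y k \<le> x k} y \<partial>\<nu>)"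
            unfolding measure_def using w_nn by (simp add: integral_nonneg_AE)
          then show ?thesis using fin ch by blast
        qed
        have "\<rho> \<nu>1 = \<rho> \<nu>2"
        proof (rule finite_measure_char_unique)
          fix t
          have fi: "finite {k}" "finite (insert k L)" using L by auto
          show "(\<integral>x. iexp (t * x) \<partial>\<rho> \<nu>1) = (\<integral>x. iexp (t * x) \<partial>\<rho> \<nu>2)"
            using one[OF sets(1) fin(1)] one[OF sets(2) fin(2)] insert.IH[rule_format, OF fi(1), of "\<lambda>_. t"]
              insert.IH[rule_format, OF fi(2)] by (simp only:)
        qed (use one[OF sets(1) fin(1)] one[OF sets(2) fin(2)] in \<open>auto simp: \<rho>_def\<close>)
        then show ?thesis using one[OF sets(1) fin(1)] one[OF sets(2) fin(2)] by simp
      qed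
      let ?one = "indicator (C (insert k K) x) :: (nat \<Rightarrow> real) \<Rightarrow> real"
      have split: "(\<integral>y. of_real (?one y) * iexp (l y) \<partial>\<nu>) =
          of_real ((\<integral>y. w 0 y * indicator {y. y k \<le> x k} y \<partial>\<nu>) - (\<integral>y. ?one y \<partial>\<nu>))
          + \<i> * of_real ((\<integral>y. w (- (pi / 2)) y * indicator {y. y k \<le> x k} y \<partial>\<nu>) - (\<integral>y. ?one y \<partial>\<nu>))
        \<and> 2 * (\<integral>y. ?one y \<partial>\<nu>) = (\<integral>y. w 0 y * indicator {y. y k \<le> x k} y \<partial>\<nu>) + (\<integral>y. w pi y * indicator {y. y k \<le> x k} y \<partial>\<nu>)"
        if s\<nu>: "sets \<nu> = sets pathspace" and f\<nu>: "finite_measure \<nu>" for \<nu>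
      proof -
        interpret \<nu>: finite_measure \<nu> by fact
        have [measurable_cong]: "sets \<nu> = sets pathspace" by fact
        have w_eq: "w \<phi> y * indicator {y. y k \<le> x k} y = ?one y * (1 + cos (l y + \<phi>))" for \<phi> y
          by (auto simp: w_def Ck indicator_def)
        have int: "integrable \<nu> g" if "g \<in> borel_measurable \<nu>" "\<And>y. \<bar>g y\<bar> \<le> 1" for g :: "_ \<Rightarrow> real"
          using that by (intro \<nu>.integrable_const_bound[of _ 1]) auto
        have i0: "integrable \<nu> ?one"
          by (rule int) (auto simp: indicator_def)
        have i1: "integrable \<nu> (\<lambda>y. ?one y * cos (l y + \<phi>))" for \<phi>
          by (rule int) (auto simp: indicator_def abs_mult)
        have W: "(\<integral>y. w \<phi> y * indicator {y. y k \<le> x k} y \<partial>\<nu>) =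
           (\<integral>y. ?one y \<partial>\<nu>) + (\<integral>y. ?one y * cos (l y + \<phi>) \<partial>\<nu>)" for \<phi>
          unfolding w_eq using i0 i1[of \<phi>] by (simp add: distrib_left)
        have "(\<integral>y. of_real (?one y) * iexp (l y) \<partial>\<nu>) =
           (\<integral>y. complex_of_real (?one y * cos (l y + 0)) + \<i> * complex_of_real (?one y * cos (l y + (- (pi / 2)))) \<partial>\<nu>)"
        proof (rule Bochner_Integration.integral_cong[OF refl])
          fix y
          have "cos (l y + - (pi / 2)) = sin (l y)" by (simp add: cos_diff)
          then show "of_real (?one y) * iexp (l y) =
            complex_of_real (?one y * cos (l y + 0)) + \<i> * complex_of_real (?one y * cos (l y + (- (pi / 2))))"
            by (simp add: exp_Euler cos_of_real sin_of_real algebra_simps)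
        qed
        also have "\<dots> = complex_of_real (\<integral>y. ?one y * cos (l y + 0) \<partial>\<nu>) + \<i> * complex_of_real (\<integral>y. ?one y * cos (l y + (- (pi / 2))) \<partial>\<nu>)"
          using integrable_of_real[OF i1[of 0], where 'a = complex] integrable_of_real[OF i1[of "- (pi / 2)"], where 'a = complex]
          by (subst Bochner_Integration.integral_add) (auto simp only: integrable_mult_right integral_mult_right_zero integral_complex_of_real)
        moreover have "(\<integral>y. ?one y * cos (l y + pi) \<partial>\<nu>) = - (\<integral>y. ?one y * cos (l y + 0) \<partial>\<nu>)"
          by (simp add: cos_add)
        ultimately show ?thesis unfolding W by simp
      qed
      show "(\<integral>y. of_real (?one y) * iexp (\<Sum>n\<in>L. z n * y n) \<partial>\<nu>1) =
        (\<integral>y. of_real (?one y) * iexp (\<Sum>n\<in>L. z n * y n) \<partial>\<nu>2)"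
      proof -
        have mass: "(\<integral>y. ?one y \<partial>\<nu>1) = (\<integral>y. ?one y \<partial>\<nu>2 :: real)"
          using split[OF sets(1) fin(1), THEN conjunct2] split[OF sets(2) fin(2), THEN conjunct2] half[of 0] half[of pi]
          by linarith
        show ?thesis
          unfolding l_def[symmetric] split[OF sets(1) fin(1), THEN conjunct1] split[OF sets(2) fin(2), THEN conjunct1] mass half ..
      qed
    qed
  qed
  show ?thesis
  proof (rule finite_pathspace_measure_eqI[OF sets fin(1)])
    fix K :: "nat set" and x :: "nat \<Rightarrow> real" assume K: "finite K"
    have int: "(\<integral>y. of_real (indicator (C K x) y) * iexp (\<Sum>n\<in>{}. 0 * y n) \<partial>\<nu>) = complex_of_real (measure \<nu> (C K x))"
      if "sets \<nu> = sets pathspace" "finite_measure \<nu>" for \<nu>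
    proof -
      interpret finite_measure \<nu> by fact
      have "C K x \<in> sets \<nu>" using C[OF K] that(1) by simp
      then show ?thesis using sets_eq_imp_space_eq[OF that(1)] by (simp add: space_PiM)
    qed
    have "complex_of_real (measure \<nu>1 (C K x)) = complex_of_real (measure \<nu>2 (C K x))"
      using key[OF K, rule_format, of "{}" x "\<lambda>_. 0"] unfolding int[OF sets(1) fin(1)] int[OF sets(2) fin(2)] by simp
    then show "emeasure \<nu>1 {y. \<forall>n\<in>K. y n \<le> x n} = emeasure \<nu>2 {y. \<forall>n\<in>K. y n \<le> x n}"
      unfolding C_def[symmetric] using fin by (simp add: finite_measure.emeasure_eq_measure)
  qed
qed

section \<open>Finite-dimensional distributions and tails\<close>

lemma fdd_eq_prob:
  assumes "fdd_eq I P X Q Y" "finite F" "F \<subseteq> I" "A \<in> sets (PiM F (\<lambda>_. borel))"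
    "\<And>t. t \<in> F \<Longrightarrow> X t \<in> borel_measurable P" "\<And>t. t \<in> F \<Longrightarrow> Y t \<in> borel_measurable Q"
  shows "measure P {\<omega> \<in> space P. (\<lambda>t\<in>F. X t \<omega>) \<in> A} = measure Q {\<omega> \<in> space Q. (\<lambda>t\<in>F. Y t \<omega>) \<in> A}"
proof -
  have X: "(\<lambda>\<omega>. \<lambda>t\<in>F. X t \<omega>) \<in> P \<rightarrow>\<^sub>M PiM F (\<lambda>_. borel)" and Y: "(\<lambda>\<omega>. \<lambda>t\<in>F. Y t \<omega>) \<in> Q \<rightarrow>\<^sub>M PiM F (\<lambda>_. borel)"
    using assms(5,6) by (auto intro!: measurable_restrict)
  have "distr P (PiM F (\<lambda>_. borel)) (\<lambda>\<omega>. \<lambda>t\<in>F. X t \<omega>) = distr Q (PiM F (\<lambda>_. borel)) (\<lambda>\<omega>. \<lambda>t\<in>F. Y t \<omega>)"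
    using assms(1-3) unfolding fdd_eq_def by blast
  from arg_cong[OF this, of "\<lambda>N. measure N A"] show ?thesis
    using assms(4) X Y by (simp add: measure_distr vimage_def Int_def conj_commute)
qed

text \<open>
  The map \<open>\<tau>\<close> may repeat indices, so sequences in the index set can be used directly.
\<close>

lemma fdd_eq_cdf:
  fixes X :: "'t \<Rightarrow> 'p \<Rightarrow> real" and Y :: "'t \<Rightarrow> 'q \<Rightarrow> real" and \<tau> :: "'k \<Rightarrow> 't"
  assumes "fdd_eq I P X Q Y" "finite K" "\<tau> ` K \<subseteq> I"
    "\<And>t. t \<in> I \<Longrightarrow> X t \<in> borel_measurable P" "\<And>t. t \<in> I \<Longrightarrow> Y t \<in> borel_measurable Q"
  shows "measure P {\<omega> \<in> space P. \<forall>k\<in>K. X (\<tau> k) \<omega> \<le> (x k :: real)} = measure Q {\<omega> \<in> space Q. \<forall>k\<in>K. Y (\<tau> k) \<omega> \<le> x k}"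
proof -
  define A where "A = {y \<in> space (PiM (\<tau> ` K) (\<lambda>_. borel)). \<forall>k\<in>K. y (\<tau> k) \<le> x k}"
  have A: "A \<in> sets (PiM (\<tau> ` K) (\<lambda>_. borel))" unfolding A_def using assms(2)
  proof (intro sets.sets_Collect_finite_All)
    fix k assume "k \<in> K"
    then have [measurable]: "(\<lambda>y. y (\<tau> k)) \<in> borel_measurable (PiM (\<tau> ` K) (\<lambda>_. borel))"
      by (intro measurable_component_singleton) auto
    show "{y \<in> space (PiM (\<tau> ` K) (\<lambda>_. borel)). y (\<tau> k) \<le> x k} \<in> sets (PiM (\<tau> ` K) (\<lambda>_. borel))" by measurable
  qed
  have "((\<lambda>t\<in>\<tau> ` K. Z t \<omega>) \<in> A) = (\<forall>k\<in>K. Z (\<tau> k) \<omega> \<le> x k)" for Z :: "'t \<Rightarrow> 'p \<Rightarrow> real" and \<omega>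
    by (auto simp: A_def space_PiM)
  moreover have "((\<lambda>t\<in>\<tau> ` K. Z t \<omega>) \<in> A) = (\<forall>k\<in>K. Z (\<tau> k) \<omega> \<le> x k)" for Z :: "'t \<Rightarrow> 'q \<Rightarrow> real" and \<omega>
    by (auto simp: A_def space_PiM)
  moreover have "measure P {\<omega> \<in> space P. (\<lambda>t\<in>\<tau> ` K. X t \<omega>) \<in> A} = measure Q {\<omega> \<in> space Q. (\<lambda>t\<in>\<tau> ` K. Y t \<omega>) \<in> A}"
    using assms by (intro fdd_eq_prob[OF assms(1) _ assms(3) A]) auto
  ultimately show ?thesis by simp
qed

lemma fdd_eq_integral:
  fixes X :: "'t \<Rightarrow> 'p \<Rightarrow> real" and Y :: "'t \<Rightarrow> 'q \<Rightarrow> real" and \<tau> :: "'k \<Rightarrow> 't" and z :: "'k \<Rightarrow> real"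
  assumes fdd: "fdd_eq I P X Q Y" and K: "finite K" "\<tau> ` K \<subseteq> I"
    and X: "\<And>t. t \<in> I \<Longrightarrow> X t \<in> borel_measurable P" and Y: "\<And>t. t \<in> I \<Longrightarrow> Y t \<in> borel_measurable Q"
  shows "(\<integral>\<omega>. iexp (\<Sum>k\<in>K. z k * X (\<tau> k) \<omega>) \<partial>P) = (\<integral>\<omega>. iexp (\<Sum>k\<in>K. z k * Y (\<tau> k) \<omega>) \<partial>Q)"
proof -
  define F where "F = \<tau> ` K"
  have F: "finite F" "F \<subseteq> I" using K by (auto simp: F_def)
  let ?N = "PiM F (\<lambda>_. borel :: real measure)"
  have mX: "(\<lambda>\<omega>. \<lambda>t\<in>F. X t \<omega>) \<in> P \<rightarrow>\<^sub>M ?N" and mY: "(\<lambda>\<omega>. \<lambda>t\<in>F. Y t \<omega>) \<in> Q \<rightarrow>\<^sub>M ?N"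
    using X Y F by (auto intro!: measurable_restrict)
  have "(\<lambda>y. \<Sum>k\<in>K. z k * y (\<tau> k)) \<in> borel_measurable ?N"
    by (intro borel_measurable_sum borel_measurable_times borel_measurable_const measurable_component_singleton) (auto simp: F_def)
  then have m: "(\<lambda>y. iexp (\<Sum>k\<in>K. z k * y (\<tau> k))) \<in> borel_measurable ?N" by measurable
  have eq: "distr P ?N (\<lambda>\<omega>. \<lambda>t\<in>F. X t \<omega>) = distr Q ?N (\<lambda>\<omega>. \<lambda>t\<in>F. Y t \<omega>)"
    using fdd F unfolding fdd_eq_def by blast
  have "(\<integral>\<omega>. iexp (\<Sum>k\<in>K. z k * X (\<tau> k) \<omega>) \<partial>P) = (\<integral>y. iexp (\<Sum>k\<in>K. z k * y (\<tau> k)) \<partial>distr P ?N (\<lambda>\<omega>. \<lambda>t\<in>F. X t \<omega>))"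
    by (subst integral_distr[OF mX m]) (auto intro!: Bochner_Integration.integral_cong simp: F_def)
  also have "\<dots> = (\<integral>\<omega>. iexp (\<Sum>k\<in>K. z k * Y (\<tau> k) \<omega>) \<partial>Q)"
    unfolding eq by (subst integral_distr[OF mY m]) (auto intro!: Bochner_Integration.integral_cong simp: F_def)
  finally show ?thesis .
qed

lemma difference_tail_finite:
  fixes g h :: "'w \<Rightarrow> real"
  assumes [measurable]: "g \<in> borel_measurable M" "h \<in> borel_measurable M"
    and g: "emeasure M {x \<in> space M. e / 2 < \<bar>g x\<bar>} < \<infinity>" and h: "emeasure M {x \<in> space M. e / 2 < \<bar>h x\<bar>} < \<infinity>"
  shows "emeasure M {x \<in> space M. e < \<bar>g x - h x\<bar>} < \<infinity>"
proof -
  have "emeasure M {x \<in> space M. e < \<bar>g x - h x\<bar>} \<le>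
    emeasure M ({x \<in> space M. e / 2 < \<bar>g x\<bar>} \<union> {x \<in> space M. e / 2 < \<bar>h x\<bar>})"
    by (intro emeasure_mono) auto
  also have "\<dots> \<le> emeasure M {x \<in> space M. e / 2 < \<bar>g x\<bar>} + emeasure M {x \<in> space M. e / 2 < \<bar>h x\<bar>}"
    by (intro emeasure_subadditive) auto
  also have "\<dots> < \<infinity>" using g h by simp
  finally show ?thesis .
qed

lemma tail_tendsto_0:
  fixes g :: "'w \<Rightarrow> real"
  assumes [measurable]: "g \<in> borel_measurable M" and h: "h > 0"
    and fin: "\<And>a. a > 0 \<Longrightarrow> emeasure M {x \<in> space M. a < \<bar>g x\<bar>} < \<infinity>"
  shows "(\<lambda>N. measure M {x \<in> space M. real (Suc N) * h < \<bar>g x\<bar>}) \<longlonglongrightarrow> 0"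
proof -
  let ?T = "\<lambda>N. {x \<in> space M. real (Suc N) * h < \<bar>g x\<bar>}"
  have "(\<lambda>N. measure M (?T N)) \<longlonglongrightarrow> measure M (\<Inter>N. ?T N)"
  proof (rule Lim_measure_decseq)
    show "range ?T \<subseteq> sets M" by auto
    show "decseq ?T"
    proof (rule decseq_SucI)
      fix N
      have "real (Suc N) * h \<le> real (Suc (Suc N)) * h" using h by (simp add: mult_right_mono)
      then show "?T (Suc N) \<subseteq> ?T N" by (auto simp del: of_nat_Suc)
    qed
    show "emeasure M (?T N) \<noteq> \<infinity>" for N using fin[of "real (Suc N) * h"] h by auto
  qed
  moreover have "(\<Inter>N. ?T N) = {}"
  proof -
    have "\<exists>N. \<bar>g x\<bar> \<le> real (Suc N) * h" for x
    proof -
      obtain N where "\<bar>g x\<bar> / h < real N" using reals_Archimedean2 by blast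
      then have "\<bar>g x\<bar> \<le> real N * h" using h by (simp add: field_simps)
      also have "\<dots> \<le> real (Suc N) * h" using h by (simp add: mult_right_mono)
      finally show ?thesis ..
    qed
    then show ?thesis by (force simp: not_less[symmetric])
  qed
  ultimately show ?thesis by simp
qed

text \<open>
  The tail bounds are needed because \<open>measure\<close> is \<open>0\<close> on sets of infinite measure: a small value of
  it says something about \<open>emeasure\<close> only for sets known to have finite measure.
\<close>

lemma continuity_modulus:
  fixes f :: "'t::real_normed_vector \<Rightarrow> 'w \<Rightarrow> real"
  assumes lim: "((\<lambda>u. measure M {x \<in> space M. e < \<bar>f u x - f 0 x\<bar>}) \<longlongrightarrow> 0) (at 0 within I)"
    and I0: "0 \<in> I" and f: "\<And>t. t \<in> I \<Longrightarrow> f t \<in> borel_measurable M"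
    and tail: "\<And>t a. t \<in> I \<Longrightarrow> a > 0 \<Longrightarrow> emeasure M {x \<in> space M. a < \<bar>f t x\<bar>} < \<infinity>"
    and e: "e > 0" and r: "r > 0"
  shows "\<exists>\<delta>>0. \<forall>u\<in>I. norm u < \<delta> \<longrightarrow> emeasure M {x \<in> space M. e < \<bar>f u x - f 0 x\<bar>} \<le> ennreal r"
proof -
  have "eventually (\<lambda>u. measure M {x \<in> space M. e < \<bar>f u x - f 0 x\<bar>} < r) (at 0 within I)"
    using order_tendstoD(2)[OF lim] r by simp
  then obtain \<delta> where \<delta>: "\<delta> > 0" and
    small: "\<forall>u\<in>I. u \<noteq> 0 \<and> dist u 0 < \<delta> \<longrightarrow> measure M {x \<in> space M. e < \<bar>f u x - f 0 x\<bar>} < r"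
    unfolding eventually_at by blast
  have "emeasure M {x \<in> space M. e < \<bar>f u x - f 0 x\<bar>} \<le> ennreal r" if u: "u \<in> I" "norm u < \<delta>" for u
  proof -
    have "emeasure M {x \<in> space M. e < \<bar>f u x - f 0 x\<bar>} < \<infinity>"
      by (intro difference_tail_finite f tail u I0) (use e in simp_all)
    moreover have "measure M {x \<in> space M. e < \<bar>f u x - f 0 x\<bar>} \<le> r"
    proof (cases "u = 0")
      case True
      then show ?thesis using e r by (simp add: not_less[symmetric])
    next
      case False
      then show ?thesis using small u by (auto simp: dist_norm intro: less_imp_le)
    qed
    ultimately show ?thesis by (simp add: emeasure_eq_ennreal_measure ennreal_leI less_top)
  qed
  then show ?thesis using \<delta> by blast
qed

locale stationary_process =
  fixes I :: "'t::real_normed_vector set" and P :: "'p measure" and X :: "'t \<Rightarrow> 'p \<Rightarrow> real"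
  assumes XP: "process_on I P X" and st: "stationary I P X" and sc: "stochastically_continuous I P X"
    and I_add: "t \<in> I \<Longrightarrow> u \<in> I \<Longrightarrow> t + u \<in> I" and I0: "0 \<in> I"
begin

lemma X_measurable: "t \<in> I \<Longrightarrow> X t \<in> borel_measurable P" using XP by (simp add: process_on_def)

lemma eventually_in_index: "eventually (\<lambda>u. u \<in> I) (at 0 within I)"
  by (simp add: eventually_at_filter)

lemma stochastic_continuity_at_0:
  "e > 0 \<Longrightarrow> ((\<lambda>u. measure P {\<omega> \<in> space P. e < \<bar>X u \<omega> - X 0 \<omega>\<bar>}) \<longlongrightarrow> 0) (at 0 within I)"
  using sc I0 unfolding stochastically_continuous_def by blast

end

section \<open>Poisson suprema\<close>

text \<open>
  The supremum of \<open>f k\<close> over the Poisson points stays below \<open>x k > 0\<close> exactly if no point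
  falls into \<open>{f k > x k}\<close>, so the distribution function is the void probability of the union of
  these sets.
\<close>

lemma max_integral_cdf:
  assumes pp: "poisson_point_process Q M U J" and K: "finite K"
    and f: "\<And>k. k \<in> K \<Longrightarrow> f k \<in> L_max M"
    and Z: "\<And>k. k \<in> K \<Longrightarrow> is_max_integral Q U J (f k) (Z k)"
    and x: "\<And>k. k \<in> K \<Longrightarrow> x k > 0"
  shows "emeasure M {w \<in> space M. \<exists>k\<in>K. x k < f k w} < \<infinity>"
    "measure Q {\<omega> \<in> space Q. \<forall>k\<in>K. Z k \<omega> \<le> x k} = exp (- measure M {w \<in> space M. \<exists>k\<in>K. x k < f k w})"
proof -
  define B where "B = {w \<in> space M. \<exists>k\<in>K. x k < f k w}"
  have mf[measurable]: "f k \<in> borel_measurable M" if "k \<in> K" for k using f[OF that] by (simp add: L_max_def)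
  have Bk: "{w \<in> space M. x k < f k w} \<in> sets M" if "k \<in> K" for k using mf[OF that] by measurable
  have B_UN: "B = (\<Union>k\<in>K. {w \<in> space M. x k < f k w})" by (auto simp: B_def)
  have B: "B \<in> sets M" unfolding B_UN using K Bk by auto
  have "emeasure M B \<le> (\<Sum>k\<in>K. emeasure M {w \<in> space M. x k < f k w})"
    unfolding B_UN using K Bk by (intro emeasure_subadditive_finite) auto
  also have "\<dots> < \<infinity>" using K f x by (auto simp: L_max_def less_top[symmetric])
  finally show fin: "emeasure M {w \<in> space M. \<exists>k\<in>K. x k < f k w} < \<infinity>" by (simp add: B_def)
  interpret Q: prob_space Q using pp by (simp add: poisson_point_process_def)
  have pc: "point_count U J B \<in> borel_measurable Q" using pp B by (simp add: poisson_point_process_def)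
  have U: "U i \<omega> \<in> space M" if "\<omega> \<in> space Q" "i \<in> J \<omega>" for i \<omega>
    using pp that by (auto simp: poisson_point_process_def)
  have mZ: "Z k \<in> borel_measurable Q" if "k \<in> K" for k using Z[OF that] by (simp add: is_max_integral_def)
  have "AE \<omega> in Q. \<forall>k\<in>K. ereal (Z k \<omega>) = (if J \<omega> = {} then 0 else SUP i\<in>J \<omega>. ereal (f k (U i \<omega>)))"
    using Z K by (intro AE_finite_allI) (auto simp: is_max_integral_def)
  then have "AE \<omega> in Q. (\<forall>k\<in>K. Z k \<omega> \<le> x k) \<longleftrightarrow> point_count U J B \<omega> = of_nat 0"
  proof (rule AE_mp, intro AE_I2 impI)
    fix \<omega> assume \<omega>: "\<omega> \<in> space Q"
      and eq: "\<forall>k\<in>K. ereal (Z k \<omega>) = (if J \<omega> = {} then 0 else SUP i\<in>J \<omega>. ereal (f k (U i \<omega>)))"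
    have "Z k \<omega> \<le> x k \<longleftrightarrow> (\<forall>i\<in>J \<omega>. f k (U i \<omega>) \<le> x k)" if k: "k \<in> K" for k
    proof -
      have "Z k \<omega> \<le> x k \<longleftrightarrow> ereal (Z k \<omega>) \<le> ereal (x k)" by simp
      also have "\<dots> \<longleftrightarrow> (\<forall>i\<in>J \<omega>. f k (U i \<omega>) \<le> x k)"
        using eq k x[OF k] by (auto simp: SUP_le_iff)
      finally show ?thesis .
    qed
    then have "(\<forall>k\<in>K. Z k \<omega> \<le> x k) \<longleftrightarrow> {i \<in> J \<omega>. U i \<omega> \<in> B} = {}"
      using U[OF \<omega>] by (auto simp: B_def not_less)
    also have "\<dots> \<longleftrightarrow> point_count U J B \<omega> = of_nat 0"
      by (simp add: point_count_def emeasure_count_space_eq_0)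
    finally show "(\<forall>k\<in>K. Z k \<omega> \<le> x k) \<longleftrightarrow> point_count U J B \<omega> = of_nat 0" .
  qed
  then have "measure Q {\<omega> \<in> space Q. \<forall>k\<in>K. Z k \<omega> \<le> x k} = measure Q {\<omega> \<in> space Q. point_count U J B \<omega> = of_nat 0}"
  proof (intro Q.finite_measure_eq_AE)
    show "{\<omega> \<in> space Q. \<forall>k\<in>K. Z k \<omega> \<le> x k} \<in> sets Q"
      using K by (intro sets.sets_Collect_finite_All) (use mZ in measurable)
    show "{\<omega> \<in> space Q. point_count U J B \<omega> = of_nat 0} \<in> sets Q" using pc by measurable
  qed auto
  also have "\<dots> = exp (- measure M B) * measure M B ^ 0 / fact 0"
    using pp B fin unfolding poisson_point_process_def B_def by blast
  finally show "measure Q {\<omega> \<in> space Q. \<forall>k\<in>K. Z k \<omega> \<le> x k} = exp (- measure M {w \<in> space M. \<exists>k\<in>K. x k < f k w})"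
    by (simp add: B_def)
qed

locale max_representation = stationary_process I P X
  for I :: "'t::real_normed_vector set" and P :: "'p measure" and X +
  fixes M :: "'w measure" and f :: "'t \<Rightarrow> 'w \<Rightarrow> real" and Q :: "'q measure" and U J
  assumes pp: "poisson_point_process Q M U J" and rep: "max_spectral_rep I P X M f Q U J"
begin

lemma f_L_max: "t \<in> I \<Longrightarrow> f t \<in> L_max M"
  using rep unfolding max_spectral_rep_def by blast

lemma f_measurable: "t \<in> I \<Longrightarrow> f t \<in> borel_measurable M"
  and f_nonneg: "t \<in> I \<Longrightarrow> AE x in M. 0 \<le> f t x"
  and f_tail: "t \<in> I \<Longrightarrow> a > 0 \<Longrightarrow> emeasure M {x \<in> space M. a < f t x} < \<infinity>"
  using f_L_max by (auto simp: L_max_def)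

lemma f_abs_tail:
  assumes t: "t \<in> I" and a: "a > 0"
  shows "emeasure M {x \<in> space M. a < \<bar>f t x\<bar>} < \<infinity>"
proof -
  note [measurable] = f_measurable[OF t]
  have "AE x in M. (a < \<bar>f t x\<bar>) = (a < f t x)" using f_nonneg[OF t] by eventually_elim simp
  then have "emeasure M {x \<in> space M. a < \<bar>f t x\<bar>} = emeasure M {x \<in> space M. a < f t x}"
    by (intro emeasure_Collect_eq_AE) measurable
  then show ?thesis using f_tail[OF t a] by simp
qed

text \<open>
  The exponential is injective, hence the measure of \<open>{\<exists>k. f (\<tau> k) > x k}\<close> can be read off from
  the distribution function of the process, which does not change under shifts.
\<close>

lemma max_exponent_shift:
  fixes \<tau> :: "'k \<Rightarrow> 't"
  assumes K: "finite K" and \<tau>: "\<tau> ` K \<subseteq> I" and u: "u \<in> I" and x: "\<And>k. k \<in> K \<Longrightarrow> x k > 0"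
  shows "emeasure M {w \<in> space M. \<exists>k\<in>K. x k < f (\<tau> k) w} < \<infinity>"
    "measure P {\<omega> \<in> space P. \<forall>k\<in>K. X (\<tau> k) \<omega> \<le> x k} = exp (- measure M {w \<in> space M. \<exists>k\<in>K. x k < f (\<tau> k) w})"
    "measure M {w \<in> space M. \<exists>k\<in>K. x k < f (\<tau> k + u) w} = measure M {w \<in> space M. \<exists>k\<in>K. x k < f (\<tau> k) w}"
proof -
  obtain Z where Z: "\<forall>t\<in>I. is_max_integral Q U J (f t) (Z t)" and fdd: "fdd_eq I P X Q Z"
    using rep unfolding max_spectral_rep_def by blast
  have mZ: "Z t \<in> borel_measurable Q" if "t \<in> I" for t using Z that by (simp add: is_max_integral_def)
  have *: "emeasure M {w \<in> space M. \<exists>k\<in>K. x k < f (\<sigma> k) w} < \<infinity> \<and>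
    measure P {\<omega> \<in> space P. \<forall>k\<in>K. X (\<sigma> k) \<omega> \<le> x k} = exp (- measure M {w \<in> space M. \<exists>k\<in>K. x k < f (\<sigma> k) w})"
    if \<sigma>: "\<sigma> ` K \<subseteq> I" for \<sigma> :: "'k \<Rightarrow> 't"
  proof -
    have \<sigma>I: "\<sigma> k \<in> I" if "k \<in> K" for k using \<sigma> that by auto
    have "measure P {\<omega> \<in> space P. \<forall>k\<in>K. X (\<sigma> k) \<omega> \<le> x k} = measure Q {\<omega> \<in> space Q. \<forall>k\<in>K. Z (\<sigma> k) \<omega> \<le> x k}"
      by (rule fdd_eq_cdf[OF fdd K \<sigma> X_measurable mZ])
    moreover note max_integral_cdf[OF pp K, of "\<lambda>k. f (\<sigma> k)" "\<lambda>k. Z (\<sigma> k)" x]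
    ultimately show ?thesis using f_L_max Z \<sigma>I x by auto
  qed
  from *[OF \<tau>] show "emeasure M {w \<in> space M. \<exists>k\<in>K. x k < f (\<tau> k) w} < \<infinity>"
    "measure P {\<omega> \<in> space P. \<forall>k\<in>K. X (\<tau> k) \<omega> \<le> x k} = exp (- measure M {w \<in> space M. \<exists>k\<in>K. x k < f (\<tau> k) w})"
    by auto
  have \<tau>u: "(\<lambda>k. \<tau> k + u) ` K \<subseteq> I" using \<tau> I_add u by auto
  have "measure P {\<omega> \<in> space P. \<forall>k\<in>K. X (\<tau> k) \<omega> \<le> x k} = measure P {\<omega> \<in> space P. \<forall>k\<in>K. X (\<tau> k + u) \<omega> \<le> x k}"
    using st u I_add X_measurable unfolding stationary_def
    by (intro fdd_eq_cdf[where Y = "\<lambda>t. X (t + u)", OF _ K \<tau>]) auto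
  then show "measure M {w \<in> space M. \<exists>k\<in>K. x k < f (\<tau> k + u) w} = measure M {w \<in> space M. \<exists>k\<in>K. x k < f (\<tau> k) w}"
    using *[OF \<tau>] *[OF \<tau>u] by simp
qed

text \<open>
  Inside \<open>{f (s n) > a}\<close> the measures of lower orthants are differences of measures of the unions
  treated in the previous lemma.  They determine the restriction of the law to \<open>{y n > a}\<close>,
  which is a finite measure, and these sets cover the nonzero sequences with nonnegative entries.
\<close>

lemma max_shift_invariant:
  assumes s: "range s \<subseteq> I" and u: "u \<in> I" and A: "A \<in> sets pathspace" "(\<lambda>_. 0) \<notin> A"
  shows "emeasure M {x \<in> space M. (\<lambda>n. f (s n + u) x) \<in> A} = emeasure M {x \<in> space M. (\<lambda>n. f (s n) x) \<in> A}"
proof -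
  have sI: "s n \<in> I" "s n + u \<in> I" for n using s u I_add by auto
  define g where "g \<sigma> x n = f (\<sigma> n) x" for \<sigma> :: "nat \<Rightarrow> 't" and x n
  define \<nu> where "\<nu> \<sigma> = distr M pathspace (g \<sigma>)" for \<sigma>
  have mg: "g \<sigma> \<in> M \<rightarrow>\<^sub>M pathspace" if "\<And>n. \<sigma> n \<in> I" for \<sigma>
    unfolding g_def using f_measurable that by (intro measurable_PiM_single') auto
  \<comment> \<open>The functions are nonnegative only almost everywhere, so sequences with negative entries have to
    be cut off by \<open>Pos\<close>.\<close>
  define H where "H i = (case prod_decode i of (n, j) \<Rightarrow> {y :: nat \<Rightarrow> real. 1 / real (Suc j) < y n})" for i
  have H[measurable]: "H i \<in> sets pathspace" for i
    unfolding H_def by (cases "prod_decode i") (simp, intro pathspace_Collect, measurable)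
  define Pos where "Pos = {y :: nat \<Rightarrow> real. \<forall>n. 0 \<le> y n}"
  have Pos: "Pos \<in> sets pathspace"
    unfolding Pos_def by (intro pathspace_Collect) measurable
  have em: "emeasure (\<nu> \<sigma>) B = emeasure M {x \<in> space M. g \<sigma> x \<in> B}" if "\<And>n. \<sigma> n \<in> I" "B \<in> sets pathspace" for \<sigma> B
    unfolding \<nu>_def using mg[OF that(1)] that(2) by (simp add: emeasure_distr vimage_def Int_def conj_commute)
  define s' where "s' n = s n + u" for n
  have H_eq: "emeasure (\<nu> s') ({y. 1 / real (Suc j) < y n} \<inter> {y. \<forall>k\<in>K. y k \<le> x k}) =
      emeasure (\<nu> s) ({y. 1 / real (Suc j) < y n} \<inter> {y. \<forall>k\<in>K. y k \<le> x k})" if K: "finite K" for n j K x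
  proof -
    define a where "a = 1 / real (Suc j)"
    have a: "a > 0" by (simp add: a_def)
    have C: "{y. a < y n} \<inter> {y. \<forall>k\<in>K. y k \<le> x k} \<in> sets pathspace" for x
      using K by (intro sets.Int pathspace_Collect) measurable
    have pos: "measure M {w \<in> space M. a < f (s n + u) w \<and> (\<forall>k\<in>K. f (s k + u) w \<le> x k)} =
        measure M {w \<in> space M. a < f (s n) w \<and> (\<forall>k\<in>K. f (s k) w \<le> x k)}"
      if x: "\<And>k. k \<in> K \<Longrightarrow> x k > 0" for x
    proof -
      define V where "V \<sigma> = {w \<in> space M. \<exists>k\<in>K. x k < f (\<sigma> k) w}" for \<sigma> :: "nat \<Rightarrow> 't"
      \<comment> \<open>\<open>W\<close> is \<open>V\<close> with the additional event \<open>a < f (\<sigma> n)\<close>; both are unions of the form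
        handled by \<open>max_exponent_shift\<close>.\<close>
      define W where "W \<sigma> = {w \<in> space M. \<exists>k\<in>insert n K. (if k = n then if n \<in> K then min a (x n) else a else x k) < f (\<sigma> k) w}"
        for \<sigma> :: "nat \<Rightarrow> 't"
      have W: "W \<sigma> = {w \<in> space M. a < f (\<sigma> n) w} \<union> V \<sigma>" for \<sigma> by (cases "n \<in> K") (auto simp: W_def V_def min_less_iff_disj)
      have *: "measure M {w \<in> space M. a < f (\<sigma> n) w \<and> (\<forall>k\<in>K. f (\<sigma> k) w \<le> x k)} = measure M (W \<sigma>) - measure M (V \<sigma>)"
        if \<sigma>: "\<And>n. \<sigma> n \<in> I" for \<sigma>
      proof -
        note [measurable] = f_measurable[OF \<sigma>]
        have "V \<sigma> \<in> sets M" unfolding V_def using K by measurable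
        moreover have "W \<sigma> \<in> sets M" unfolding W using \<open>V \<sigma> \<in> sets M\<close> by measurable
        moreover have "emeasure M (W \<sigma>) < \<infinity>" unfolding W_def
          using a x \<sigma> by (intro max_exponent_shift(1)[OF _ _ u]) (auto simp: K)
        moreover have "{w \<in> space M. a < f (\<sigma> n) w \<and> (\<forall>k\<in>K. f (\<sigma> k) w \<le> x k)} = W \<sigma> - V \<sigma>"
          unfolding W by (auto simp: V_def not_less)
        ultimately show ?thesis by (simp add: measure_Diff W)
      qed
      have "measure M (W (\<lambda>k. s k + u)) = measure M (W s)"
        unfolding W_def using a x sI by (intro max_exponent_shift(3)[OF _ _ u]) (auto simp: K)
      moreover have "measure M (V (\<lambda>k. s k + u)) = measure M (V s)"
        unfolding V_def using x sI by (intro max_exponent_shift(3)[OF _ _ u]) (auto simp: K)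
      ultimately show ?thesis using *[of "\<lambda>k. s k + u"] *[of s] sI by simp
    qed
    have fin: "emeasure M {w \<in> space M. a < f t w} \<noteq> \<infinity>" if "t \<in> I" for t
      using f_tail[OF that a] by simp
    show ?thesis
    proof (cases "\<exists>k\<in>K. x k < 0")
      case True
      then obtain k where k: "k \<in> K" "x k < 0" by blast
      have z: "emeasure (\<nu> \<sigma>) ({y. a < y n} \<inter> {y. \<forall>k\<in>K. y k \<le> x k}) = 0" if \<sigma>: "\<And>n. \<sigma> n \<in> I" for \<sigma>
      proof -
        have "AE w in M. \<not> g \<sigma> w \<in> {y. a < y n} \<inter> {y. \<forall>k\<in>K. y k \<le> x k}"
          using f_nonneg[OF \<sigma>, of k] by eventually_elim (use k in \<open>force simp: g_def\<close>)
        then show ?thesis unfolding em[OF \<sigma> C] by (rule emeasure_eq_0_AE)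
      qed
      show ?thesis using z[of s'] z[of s] sI by (simp add: s'_def a_def)
    next
      case False
      \<comment> \<open>The void probabilities need positive thresholds; thresholds equal to \<open>0\<close> are reached from
        above.\<close>
      define B where "B m = {y. a < y n} \<inter> {y. \<forall>k\<in>K. y k \<le> x k + 1 / real (Suc m)}" for m
      have B_inter: "(\<Inter>m. B m) = {y. a < y n} \<inter> {y. \<forall>k\<in>K. y k \<le> x k}"
      proof (intro equalityI subsetI)
        fix y assume y: "y \<in> (\<Inter>m. B m)"
        have "y k \<le> x k" if k: "k \<in> K" for k
        proof (rule field_le_epsilon)
          fix e :: real assume "e > 0"
          then obtain m where "1 / real (Suc m) < e" using nat_approx_posE by metis
          moreover have "y \<in> B m" using y by blast
          then have "y k \<le> x k + 1 / real (Suc m)" using k unfolding B_def by blast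
          ultimately show "y k \<le> x k + e" by linarith
        qed
        moreover have "y \<in> B 0" using y by blast
        ultimately show "y \<in> {y. a < y n} \<inter> {y. \<forall>k\<in>K. y k \<le> x k}" by (auto simp: B_def)
      qed (auto simp: B_def intro: order_trans)
      have lim: "(\<lambda>m. emeasure (\<nu> \<sigma>) (B m)) \<longlonglongrightarrow> emeasure (\<nu> \<sigma>) (\<Inter>m. B m)" if \<sigma>: "\<And>n. \<sigma> n \<in> I" for \<sigma>
      proof (rule Lim_emeasure_decseq)
        show "range B \<subseteq> sets (\<nu> \<sigma>)" unfolding B_def \<nu>_def using C by auto
        show "decseq B"
        proof (rule decseq_SucI)
          fix m
          have "1 / real (Suc (Suc m)) \<le> 1 / real (Suc m)" by (intro divide_left_mono) auto
          then show "B (Suc m) \<subseteq> B m" unfolding B_def by (force simp del: of_nat_Suc)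
        qed
        fix m
        have "emeasure (\<nu> \<sigma>) (B m) = emeasure M {w \<in> space M. g \<sigma> w \<in> B m}" unfolding B_def by (rule em[OF \<sigma> C])
        also have "\<dots> \<le> emeasure M {w \<in> space M. a < f (\<sigma> n) w}"
          using f_measurable[OF \<sigma>] by (intro emeasure_mono) (auto simp: B_def g_def)
        finally show "emeasure (\<nu> \<sigma>) (B m) \<noteq> \<infinity>" using fin[OF \<sigma>] by (auto simp: top_unique)
      qed
      have "emeasure (\<nu> s') (B m) = emeasure (\<nu> s) (B m)" for m
      proof -
        have "x k + 1 / real (Suc m) > 0" if "k \<in> K" for k
          using False that by (intro add_nonneg_pos) (auto simp: not_less)
        from pos[OF this]
        have "measure M {w \<in> space M. a < f (s' n) w \<and> (\<forall>k\<in>K. f (s' k) w \<le> x k + 1 / real (Suc m))} =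
          measure M {w \<in> space M. a < f (s n) w \<and> (\<forall>k\<in>K. f (s k) w \<le> x k + 1 / real (Suc m))}" by (simp add: s'_def)
        moreover have nf: "emeasure M {w \<in> space M. a < f (\<sigma> n) w \<and> (\<forall>k\<in>K. f (\<sigma> k) w \<le> x k + 1 / real (Suc m))} \<noteq> \<infinity>"
          if \<sigma>: "\<And>n. \<sigma> n \<in> I" for \<sigma>
        proof -
          have "emeasure M {w \<in> space M. a < f (\<sigma> n) w \<and> (\<forall>k\<in>K. f (\<sigma> k) w \<le> x k + 1 / real (Suc m))} \<le> emeasure M {w \<in> space M. a < f (\<sigma> n) w}"
            using f_measurable[OF \<sigma>] by (intro emeasure_mono) auto
          then show ?thesis using fin[OF \<sigma>] by (auto simp: top_unique)
        qed
        ultimately have "emeasure M {w \<in> space M. a < f (s' n) w \<and> (\<forall>k\<in>K. f (s' k) w \<le> x k + 1 / real (Suc m))} =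
          emeasure M {w \<in> space M. a < f (s n) w \<and> (\<forall>k\<in>K. f (s k) w \<le> x k + 1 / real (Suc m))}"
          using nf[of s'] nf[of s] sI by (simp add: emeasure_eq_ennreal_measure s'_def)
        then show ?thesis unfolding B_def using sI C
          by (subst (1 2) em) (auto simp: s'_def g_def)
      qed
      then have "emeasure (\<nu> s') (\<Inter>m. B m) = emeasure (\<nu> s) (\<Inter>m. B m)"
        using LIMSEQ_unique[OF lim[of s']] lim[of s] sI by (simp add: s'_def)
      then show ?thesis unfolding B_inter a_def .
    qed
  qed
  have "density (\<nu> s') (\<lambda>y. ennreal (indicator (H i) y)) = density (\<nu> s) (\<lambda>y. ennreal (indicator (H i) y))" for i
  proof -
    obtain n j where i: "prod_decode i = (n, j)" by force
    then have Hi: "H i = {y. 1 / real (Suc j) < y n}" by (simp add: H_def)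
    have sets\<nu>: "sets (\<nu> \<sigma>) = sets pathspace" for \<sigma> by (simp add: \<nu>_def)
    have space\<nu>: "space (\<nu> \<sigma>) = UNIV" for \<sigma> by (simp add: \<nu>_def space_PiM)
    have HK: "{y. \<forall>n\<in>K. y n \<le> x n} \<in> sets pathspace" if "finite K" for K and x :: "nat \<Rightarrow> real"
      using that by (intro pathspace_Collect) measurable
    show ?thesis
    proof (rule finite_pathspace_measure_eqI)
      have "emeasure (\<nu> s') (H i) = emeasure M {x \<in> space M. g s' x \<in> H i}"
        by (rule em) (simp_all add: s'_def sI H)
      also have "\<dots> < \<infinity>" using f_tail[OF sI(2)] by (simp add: Hi g_def s'_def)
      finally have "emeasure (\<nu> s') (H i) \<noteq> \<infinity>" by simp
      then show "finite_measure (density (\<nu> s') (\<lambda>y. ennreal (indicator (H i) y)))"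
        using emeasure_restricted[of "H i" "\<nu> s'" "space (\<nu> s')"] sets.top[of "\<nu> s'"]
        by (intro finite_measureI) (simp add: sets\<nu> ennreal_indicator H space\<nu>)
      fix K :: "nat set" and x :: "nat \<Rightarrow> real" assume K: "finite K"
      show "emeasure (density (\<nu> s') (\<lambda>y. ennreal (indicator (H i) y))) {y. \<forall>n\<in>K. y n \<le> x n} =
         emeasure (density (\<nu> s) (\<lambda>y. ennreal (indicator (H i) y))) {y. \<forall>n\<in>K. y n \<le> x n}"
        using H_eq[OF K, of j n x, folded Hi] HK[OF K] H by (simp add: ennreal_indicator emeasure_restricted sets\<nu>)
    qed (simp_all add: sets\<nu>)
  qed
  then have "emeasure (\<nu> s') (A \<inter> Pos) = emeasure (\<nu> s) (A \<inter> Pos)"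
  proof (rule emeasure_eq_of_density_eq[where N = pathspace and w = "\<lambda>i. indicator (H i)", rotated 3])
    show "A \<inter> Pos \<in> sets pathspace" using A Pos by auto
    fix y assume y: "y \<in> A \<inter> Pos"
    then obtain n where "y n \<noteq> 0" using A(2) by (metis IntD1 ext)
    with y have "y n > 0" by (auto simp: Pos_def order_less_le)
    then obtain j where "1 / real (Suc j) < y n" using nat_approx_posE by metis
    then have "y \<in> H (prod_encode (n, j))" by (simp add: H_def)
    then show "\<exists>k. 0 < (indicator (H k) y :: real)" by (intro exI[of _ "prod_encode (n, j)"]) simp
  qed (auto simp: \<nu>_def)
  moreover have "emeasure (\<nu> \<sigma>) (A \<inter> Pos) = emeasure M {x \<in> space M. g \<sigma> x \<in> A}" if \<sigma>: "\<And>n. \<sigma> n \<in> I" for \<sigma>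
  proof -
    have "AE x in M. \<forall>n. 0 \<le> f (\<sigma> n) x" using f_nonneg[OF \<sigma>] by (simp add: AE_all_countable)
    then have "AE x in M. (g \<sigma> x \<in> A \<inter> Pos) = (g \<sigma> x \<in> A)" by eventually_elim (simp add: Pos_def g_def)
    moreover note [measurable] = mg[OF \<sigma>] A(1) Pos
    have "Measurable.pred M (\<lambda>x. g \<sigma> x \<in> A \<inter> Pos)" "Measurable.pred M (\<lambda>x. g \<sigma> x \<in> A)" by measurable
    ultimately have "emeasure M {x \<in> space M. g \<sigma> x \<in> A \<inter> Pos} = emeasure M {x \<in> space M. g \<sigma> x \<in> A}"
      by (intro emeasure_Collect_eq_AE) auto
    then show ?thesis using em[OF \<sigma>, of "A \<inter> Pos"] A Pos by simp
  qed
  ultimately have "emeasure M {x \<in> space M. g s' x \<in> A} = emeasure M {x \<in> space M. g s x \<in> A}"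
    using sI by (simp add: s'_def)
  moreover have "g \<sigma> = (\<lambda>x n. f (\<sigma> n) x)" for \<sigma> by (simp add: g_def fun_eq_iff)
  ultimately show ?thesis by (simp add: s'_def)
qed

text \<open>
  The measure in question is the logarithm of a ratio of two values of distribution functions, whose
  numerator and denominator differ by at most
  \<open>P(\<bar>X (\<alpha> u) - X (\<beta> u)\<bar> > a - b)\<close>.
\<close>

lemma max_pair_tendsto:
  assumes \<alpha>: "\<And>u. u \<in> I \<Longrightarrow> \<alpha> u \<in> I" and \<beta>: "\<And>u. u \<in> I \<Longrightarrow> \<beta> u \<in> I"
    and lim: "\<And>e. e > 0 \<Longrightarrow> ((\<lambda>u. measure P {\<omega> \<in> space P. e < \<bar>X (\<alpha> u) \<omega> - X (\<beta> u) \<omega>\<bar>}) \<longlongrightarrow> 0) (at 0 within I)"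
    and ab: "0 < b" "b < a"
  shows "((\<lambda>u. measure M {w \<in> space M. a < f (\<alpha> u) w \<and> f (\<beta> u) w \<le> b}) \<longlongrightarrow> 0) (at 0 within I)"
proof -
  let ?F = "at 0 within I"
  interpret P: prob_space P using XP by (simp add: process_on_def)
  define p where "p = exp (- measure M {w \<in> space M. b < f 0 w})"
  define G where "G u = measure P {\<omega> \<in> space P. X (\<alpha> u) \<omega> \<le> a \<and> X (\<beta> u) \<omega> \<le> b}" for u
  have marg: "measure P {\<omega> \<in> space P. X t \<omega> \<le> b} = p" if t: "t \<in> I" for t
  proof -
    have "measure P {\<omega> \<in> space P. X t \<omega> \<le> b} = exp (- measure M {w \<in> space M. b < f t w})"
      using max_exponent_shift(2)[of "{()}" "\<lambda>_. t" t "\<lambda>_. b"] t ab by simp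
    also have "measure M {w \<in> space M. b < f t w} = measure M {w \<in> space M. b < f 0 w}"
      using max_exponent_shift(3)[of "{()}" "\<lambda>_. 0" t "\<lambda>_. b"] t ab I0 by simp
    finally show ?thesis by (simp add: p_def)
  qed
  have meas_eq: "measure M {w \<in> space M. a < f (\<alpha> u) w \<and> f (\<beta> u) w \<le> b} = ln p - ln (G u)" if u: "u \<in> I" for u
  proof -
    note [measurable] = f_measurable[OF \<alpha>[OF u]] f_measurable[OF \<beta>[OF u]]
    define V where "V = {w \<in> space M. a < f (\<alpha> u) w \<or> b < f (\<beta> u) w}"
    define \<tau> where "\<tau> k = (if k then \<alpha> u else \<beta> u)" for k
    define x where "x k = (if k then a else b)" for k
    have V: "V = {w \<in> space M. \<exists>k\<in>UNIV. x k < f (\<tau> k) w}" by (auto simp: V_def \<tau>_def x_def)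
    have *: "finite (UNIV :: bool set)" "range \<tau> \<subseteq> I" "\<And>k. x k > 0"
      using \<alpha>[OF u] \<beta>[OF u] ab by (auto simp: \<tau>_def x_def)
    have fin: "emeasure M V < \<infinity>" unfolding V by (rule max_exponent_shift(1)[OF * (1,2) u *(3)])
    have "{\<omega> \<in> space P. X (\<alpha> u) \<omega> \<le> a \<and> X (\<beta> u) \<omega> \<le> b} = {\<omega> \<in> space P. \<forall>k\<in>UNIV. X (\<tau> k) \<omega> \<le> x k}"
      by (auto simp: \<tau>_def x_def split: if_splits)
    then have "G u = exp (- measure M V)" unfolding G_def V using max_exponent_shift(2)[OF * (1,2) u *(3)] by simp
    moreover have "p = exp (- measure M {w \<in> space M. b < f (\<beta> u) w})"
      using max_exponent_shift(2)[of "{()}" "\<lambda>_. \<beta> u" u "\<lambda>_. b"] marg[OF \<beta>[OF u]] \<beta>[OF u] u ab by simp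
    moreover have "{w \<in> space M. a < f (\<alpha> u) w \<and> f (\<beta> u) w \<le> b} = V - {w \<in> space M. b < f (\<beta> u) w}"
      by (auto simp: V_def)
    moreover have "measure M (V - {w \<in> space M. b < f (\<beta> u) w}) = measure M V - measure M {w \<in> space M. b < f (\<beta> u) w}"
      using fin by (intro measure_Diff) (auto simp: V_def)
    ultimately show ?thesis by simp
  qed
  have diff: "\<bar>G u - p\<bar> \<le> measure P {\<omega> \<in> space P. a - b < \<bar>X (\<alpha> u) \<omega> - X (\<beta> u) \<omega>\<bar>}" if u: "u \<in> I" for u
  proof -
    note [measurable] = X_measurable[OF \<alpha>[OF u]] X_measurable[OF \<beta>[OF u]]
    have "G u \<le> p" unfolding G_def marg[OF \<beta>[OF u], symmetric]
      by (intro P.finite_measure_mono) auto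
    moreover have "p \<le> measure P ({\<omega> \<in> space P. X (\<alpha> u) \<omega> \<le> a \<and> X (\<beta> u) \<omega> \<le> b} \<union>
        {\<omega> \<in> space P. a - b < \<bar>X (\<alpha> u) \<omega> - X (\<beta> u) \<omega>\<bar>})"
      unfolding marg[OF \<beta>[OF u], symmetric] by (intro P.finite_measure_mono) auto
    moreover have "\<dots> \<le> G u + measure P {\<omega> \<in> space P. a - b < \<bar>X (\<alpha> u) \<omega> - X (\<beta> u) \<omega>\<bar>}"
      unfolding G_def by (intro measure_Un_le) auto
    ultimately show ?thesis by linarith
  qed
  have "((\<lambda>u. G u - p) \<longlongrightarrow> 0) ?F"
  proof (rule Lim_null_comparison)
    show "eventually (\<lambda>u. norm (G u - p) \<le> measure P {\<omega> \<in> space P. a - b < \<bar>X (\<alpha> u) \<omega> - X (\<beta> u) \<omega>\<bar>}) ?F"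
      using eventually_in_index by eventually_elim (use diff in simp)
    show "((\<lambda>u. measure P {\<omega> \<in> space P. a - b < \<bar>X (\<alpha> u) \<omega> - X (\<beta> u) \<omega>\<bar>}) \<longlongrightarrow> 0) ?F"
      using lim ab by simp
  qed
  then have "(G \<longlongrightarrow> p) ?F" by (simp add: LIM_zero_iff)
  then have "((\<lambda>u. ln p - ln (G u)) \<longlongrightarrow> ln p - ln p) ?F"
    by (intro tendsto_intros) (auto simp: p_def)
  then have "((\<lambda>u. ln p - ln (G u)) \<longlongrightarrow> 0) ?F" by simp
  moreover from eventually_in_index have "eventually (\<lambda>u. ln p - ln (G u) = measure M {w \<in> space M. a < f (\<alpha> u) w \<and> f (\<beta> u) w \<le> b}) ?F"
    by eventually_elim (simp add: meas_eq)
  ultimately show ?thesis by (rule Lim_transform_eventually)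
qed

text \<open>
  If \<open>f u\<close> and \<open>f 0\<close> are nonnegative, differ by more than \<open>e\<close>, and neither exceeds \<open>N h\<close>, where
  \<open>h = e / 2\<close>, then one of the finitely many strips between \<open>(j + 1) h\<close> and \<open>(j + 2) h\<close>
  lies between the two values.  Each strip contributes little for \<open>u\<close> near \<open>0\<close>, and the
  part above \<open>N h\<close> is small uniformly in \<open>u\<close>.
\<close>

lemma max_continuous_at_0:
  assumes e: "e > 0"
  shows "((\<lambda>u. measure M {w \<in> space M. e < \<bar>f u w - f 0 w\<bar>}) \<longlongrightarrow> 0) (at 0 within I)"
proof -
  let ?F = "at 0 within I"
  define h where "h = e / 2"
  have h: "h > 0" using e by (simp add: h_def)
  have sc1: "((\<lambda>u. measure P {\<omega> \<in> space P. e < \<bar>X 0 \<omega> - X u \<omega>\<bar>}) \<longlongrightarrow> 0) ?F" if "e > 0" for e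
    using stochastic_continuity_at_0[OF that] by (simp add: abs_minus_commute)
  define A where "A u j = measure M {w \<in> space M. real (j + 2) * h < f u w \<and> f 0 w \<le> real (j + 1) * h}" for u j
  define B where "B u j = measure M {w \<in> space M. real (j + 2) * h < f 0 w \<and> f u w \<le> real (j + 1) * h}" for u j
  have lev: "0 < real (j + 1) * h" "real (j + 1) * h < real (j + 2) * h" for j using h by auto
  have A: "((\<lambda>u. A u j) \<longlongrightarrow> 0) ?F" for j
    unfolding A_def by (rule max_pair_tendsto[OF _ _ stochastic_continuity_at_0 lev]) (use I0 in auto)
  have B: "((\<lambda>u. B u j) \<longlongrightarrow> 0) ?F" for j
    unfolding B_def by (rule max_pair_tendsto[OF _ _ sc1 lev]) (use I0 in auto)
  have bound: "measure M {w \<in> space M. e < \<bar>f u w - f 0 w\<bar>} \<le> (\<Sum>j<N. A u j + B u j) + 2 * measure M {w \<in> space M. real N * h < f 0 w}"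
    if u: "u \<in> I" and N: "N > 0" for u N
  proof -
    note [measurable] = f_measurable[OF u] f_measurable[OF I0]
    define SA where "SA j = {w \<in> space M. real (j + 2) * h < f u w \<and> f 0 w \<le> real (j + 1) * h}" for j
    define SB where "SB j = {w \<in> space M. real (j + 2) * h < f 0 w \<and> f u w \<le> real (j + 1) * h}" for j
    define T where "T t = {w \<in> space M. real N * h < f t w}" for t
    have Nh: "real N * h > 0" using N h by simp
    have sets[measurable]: "SA j \<in> sets M" "SB j \<in> sets M" "T u \<in> sets M" "T 0 \<in> sets M" for j
      unfolding SA_def SB_def T_def by measurable
    have finA: "emeasure M (SA j) < \<infinity>" "emeasure M (SB j) < \<infinity>" for j
    proof -
      have "emeasure M (SA j) \<le> emeasure M {w \<in> space M. real (j + 2) * h < f u w}"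
        unfolding SA_def by (intro emeasure_mono) auto
      then show "emeasure M (SA j) < \<infinity>" using f_tail[OF u, of "real (j + 2) * h"] lev[of j] by (auto intro: le_less_trans)
      have "emeasure M (SB j) \<le> emeasure M {w \<in> space M. real (j + 2) * h < f 0 w}"
        unfolding SB_def by (intro emeasure_mono) auto
      then show "emeasure M (SB j) < \<infinity>" using f_tail[OF I0, of "real (j + 2) * h"] lev[of j] by (auto intro: le_less_trans)
    qed
    have finT: "emeasure M (T u) < \<infinity>" "emeasure M (T 0) < \<infinity>" unfolding T_def using f_tail[OF u Nh] f_tail[OF I0 Nh] by auto
    define D where "D = (\<Union>j<N. SA j) \<union> (\<Union>j<N. SB j) \<union> (T u \<union> T 0)"
    have level: "\<exists>j<N. y \<le> real (j + 1) * h \<and> real (j + 2) * h < z" if "0 \<le> y" "y \<le> real N * h" "y + e < z" for y z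
    proof -
      show ?thesis
      proof (cases "y = 0")
        case True then show ?thesis using that h N by (intro exI[of _ 0]) (auto simp: h_def)
      next
        case False
        then have y: "y > 0" using that by simp
        define m where "m = nat \<lceil>y / h\<rceil>"
        have "y / h > 0" using y h by simp
        then have m: "real m \<ge> y / h" "real m < y / h + 1" "m > 0" unfolding m_def by linarith+
        have "y \<le> real m * h" using m(1) h by (simp add: field_simps)
        moreover have "real m * h < y + h" using m(2) h by (simp add: field_simps)
        moreover have "m \<le> N"
        proof -
          have "y / h \<le> real N" using that(2) h by (simp add: field_simps)
          then show ?thesis unfolding m_def by linarith
        qed
        moreover have "real (m - 1 + 1) = real m" "real (m - 1 + 2) * h = real m * h + h" using m(3) by (auto simp: algebra_simps of_nat_diff)
        ultimately show ?thesis using m(3) that(3) by (intro exI[of _ "m - 1"]) (auto simp: h_def)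
      qed
    qed
    have "AE w in M. w \<in> {w \<in> space M. e < \<bar>f u w - f 0 w\<bar>} \<longrightarrow> w \<in> D"
      using f_nonneg[OF u] f_nonneg[OF I0] AE_space
    proof eventually_elim
      case (elim w)
      show ?case
      proof
        assume w: "w \<in> {w \<in> space M. e < \<bar>f u w - f 0 w\<bar>}"
        show "w \<in> D"
        proof (cases "w \<in> T u \<or> w \<in> T 0")
          case False
          then have le: "f u w \<le> real N * h" "f 0 w \<le> real N * h" using elim by (auto simp: T_def)
          from w consider "f 0 w + e < f u w" | "f u w + e < f 0 w" by fastforce
          then show ?thesis
          proof cases
            case 1
            with level[OF elim(2) le(2)] show ?thesis using elim by (auto simp: D_def SA_def)
          next
            case 2
            with level[OF elim(1) le(1)] show ?thesis using elim by (auto simp: D_def SB_def)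
          qed
        qed (auto simp: D_def)
      qed
    qed
    then have "emeasure M {w \<in> space M. e < \<bar>f u w - f 0 w\<bar>} \<le> emeasure M D"
      by (rule emeasure_mono_AE) (simp add: D_def)
    also have "\<dots> \<le> emeasure M ((\<Union>j<N. SA j) \<union> (\<Union>j<N. SB j)) + emeasure M (T u \<union> T 0)"
      unfolding D_def by (intro emeasure_subadditive) auto
    also have "\<dots> \<le> (emeasure M (\<Union>j<N. SA j) + emeasure M (\<Union>j<N. SB j)) + (emeasure M (T u) + emeasure M (T 0))"
      by (intro add_mono emeasure_subadditive) auto
    also have "\<dots> \<le> ((\<Sum>j<N. emeasure M (SA j)) + (\<Sum>j<N. emeasure M (SB j))) + (emeasure M (T u) + emeasure M (T 0))"
      by (intro add_mono emeasure_subadditive_finite order_refl) auto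
    also have "\<dots> = ennreal (((\<Sum>j<N. A u j) + (\<Sum>j<N. B u j)) + (measure M (T u) + measure M (T 0)))"
      using finA finT unfolding A_def B_def SA_def[symmetric] SB_def[symmetric]
      by (simp add: emeasure_eq_ennreal_measure less_top sum_nonneg)
    finally have "measure M {w \<in> space M. e < \<bar>f u w - f 0 w\<bar>} \<le> ((\<Sum>j<N. A u j) + (\<Sum>j<N. B u j)) + (measure M (T u) + measure M (T 0))"
      unfolding measure_def[of M "{w \<in> space M. e < \<bar>f u w - f 0 w\<bar>}"]
      by (intro enn2real_leI) (auto simp: A_def B_def intro!: add_nonneg_nonneg sum_nonneg)
    moreover have "measure M (T u) = measure M (T 0)"
      unfolding T_def using max_exponent_shift(3)[of "{()}" "\<lambda>_. 0" u "\<lambda>_. real N * h"] u I0 Nh by simp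
    ultimately show ?thesis by (simp add: T_def sum.distrib)
  qed
  have abs_0: "measure M {w \<in> space M. real (Suc N) * h < f 0 w} \<le> measure M {w \<in> space M. real (Suc N) * h < \<bar>f 0 w\<bar>}" for N
    using f_abs_tail[OF I0, of "real (Suc N) * h"] h f_measurable[OF I0]
    by (intro measure_mono_fmeasurable) (auto simp: fmeasurable_def)
  note tail = tail_tendsto_0[OF f_measurable[OF I0] h f_abs_tail[OF I0]]
  show ?thesis
  proof (rule order_tendstoI)
    fix r :: real assume r: "0 < r"
    obtain N' where "measure M {w \<in> space M. real (Suc N') * h < \<bar>f 0 w\<bar>} < r / 4"
      using order_tendstoD(2)[OF tail, of "r / 4"] r by (auto simp: eventually_sequentially)
    then have N': "measure M {w \<in> space M. real (Suc N') * h < f 0 w} < r / 4"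
      using abs_0[of N'] by linarith
    have "((\<lambda>u. \<Sum>j<Suc N'. A u j + B u j) \<longlongrightarrow> (\<Sum>j<Suc N'. 0 + 0)) ?F"
      by (intro tendsto_sum tendsto_add A B)
    then have "eventually (\<lambda>u. (\<Sum>j<Suc N'. A u j + B u j) < r / 2) ?F"
      using r by (intro order_tendstoD(2)) auto
    then show "eventually (\<lambda>u. measure M {w \<in> space M. e < \<bar>f u w - f 0 w\<bar>} < r) ?F"
      using eventually_in_index
    proof eventually_elim
      case (elim u)
      show ?case using bound[OF elim(2), of "Suc N'"] elim(1) N' by linarith
    qed
  next
    fix r :: real assume "r < 0"
    then show "eventually (\<lambda>u. r < measure M {w \<in> space M. e < \<bar>f u w - f 0 w\<bar>}) ?F"
      by (intro always_eventually allI) (auto intro: less_le_trans)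
  qed
qed

end

section \<open>Campbell formula for Poisson sums\<close>

text \<open>
  The count takes values in the extended nonnegative reals; that it is almost surely a natural number
  follows since the Poisson weights add up to \<open>1\<close>.
\<close>

lemma poisson_count_char:
  fixes N :: "'q \<Rightarrow> ennreal"
  assumes "prob_space Q" and N[measurable]: "N \<in> borel_measurable Q" and m: "0 \<le> m"
    and law: "\<And>k. measure Q {\<omega> \<in> space Q. N \<omega> = of_nat k} = exp (- m) * m ^ k / fact k"
  shows "AE \<omega> in Q. N \<omega> \<in> range of_nat"
    and "(\<integral>\<omega>. iexp (v * enn2real (N \<omega>)) \<partial>Q) = exp (of_real m * (iexp v - 1))"
proof -
  interpret Q: prob_space Q by fact
  define A where "A k = {\<omega> \<in> space Q. N \<omega> = of_nat k}" for k :: nat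
  have A[measurable]: "A k \<in> sets Q" for k unfolding A_def by measurable
  have disj: "disjoint_family A" by (auto simp: disjoint_family_on_def A_def)
  have "(\<lambda>k. exp (- m) * (m ^ k /\<^sub>R fact k)) sums (exp (- m) * exp m)"
    by (intro sums_mult exp_converges)
  then have "(\<lambda>k. measure Q (A k)) sums 1"
    by (simp add: A_def law exp_minus scaleR_conv_of_real divide_inverse mult_ac)
  moreover have "(\<lambda>k. measure Q (A k)) sums measure Q (\<Union>k. A k)"
    using disj by (intro Q.finite_measure_UNION) auto
  ultimately have "measure Q (\<Union>k. A k) = 1" by (simp add: sums_iff)
  then have ae: "AE \<omega> in Q. \<omega> \<in> (\<Union>k. A k)" by (subst Q.AE_in_set_eq_1) auto
  then show "AE \<omega> in Q. N \<omega> \<in> range of_nat" by eventually_elim (auto simp: A_def)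
  define n where "n \<omega> = nat \<lfloor>enn2real (N \<omega>)\<rfloor>" for \<omega>
  have n[measurable]: "n \<in> Q \<rightarrow>\<^sub>M count_space UNIV" unfolding n_def by measurable
  have D: "distr Q (count_space UNIV) n = density (count_space UNIV) (\<lambda>k. ennreal (exp (- m) * m ^ k / fact k))"
  proof (rule measure_eqI_countable[where A = UNIV])
    fix k :: nat
    have "emeasure (distr Q (count_space UNIV) n) {k} = emeasure Q {\<omega> \<in> space Q. n \<omega> = k}"
      by (simp add: emeasure_distr vimage_def Int_def conj_commute)
    also have "\<dots> = emeasure Q {\<omega> \<in> space Q. N \<omega> = of_nat k}"
    proof (rule emeasure_Collect_eq_AE)
      from ae show "AE \<omega> in Q. (n \<omega> = k) = (N \<omega> = of_nat k)"
        by eventually_elim (auto simp: A_def n_def)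
    qed measurable
    also have "\<dots> = ennreal (exp (- m) * m ^ k / fact k)" by (simp add: Q.emeasure_eq_measure law)
    also have "\<dots> = emeasure (density (count_space UNIV) (\<lambda>k. ennreal (exp (- m) * m ^ k / fact k))) {k}"
      by (simp add: emeasure_density)
    finally show "emeasure (distr Q (count_space UNIV) n) {k} = emeasure (density (count_space UNIV) (\<lambda>k. ennreal (exp (- m) * m ^ k / fact k))) {k}" .
  qed auto
  have "(\<integral>\<omega>. iexp (v * enn2real (N \<omega>)) \<partial>Q) = (\<integral>\<omega>. iexp (v * real (n \<omega>)) \<partial>Q)"
  proof (rule integral_cong_AE)
    from ae show "AE \<omega> in Q. iexp (v * enn2real (N \<omega>)) = iexp (v * real (n \<omega>))"
      by eventually_elim (auto simp: A_def n_def)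
  qed measurable
  also have "\<dots> = (\<integral>k. iexp (v * real k) \<partial>distr Q (count_space UNIV) n)"
    by (subst integral_distr) auto
  also have "\<dots> = (\<integral>k. (exp (- m) * m ^ k / fact k) *\<^sub>R iexp (v * real k) \<partial>count_space UNIV)"
    unfolding D using m by (subst integral_density) auto
  also have "\<dots> = (\<Sum>k. (exp (- m) * m ^ k / fact k) *\<^sub>R iexp (v * real k))"
  proof (rule integral_count_space_nat)
    have "summable (\<lambda>k. exp (- m) * (m ^ k /\<^sub>R fact k))"
      using exp_converges[of m] by (intro summable_mult) (rule sums_summable)
    moreover have "norm ((exp (- m) * m ^ k / fact k) *\<^sub>R iexp (v * real k)) = exp (- m) * (m ^ k /\<^sub>R fact k)" for k
      unfolding norm_scaleR norm_exp_i_times using m by (simp add: divide_inverse mult_ac)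
    ultimately have "summable (\<lambda>k. norm ((exp (- m) * m ^ k / fact k) *\<^sub>R iexp (v * real k)))" by simp
    then show "integrable (count_space UNIV) (\<lambda>k. (exp (- m) * m ^ k / fact k) *\<^sub>R iexp (v * real k))"
      by (simp add: integrable_count_space_nat_iff)
  qed
  also have "(\<lambda>k. (exp (- m) * m ^ k / fact k) *\<^sub>R iexp (v * real k)) =
     (\<lambda>k. complex_of_real (exp (- m)) * ((of_real m * iexp v) ^ k /\<^sub>R fact k))"
    by (simp add: fun_eq_iff scaleR_conv_of_real power_mult_distrib exp_of_nat_mult[symmetric] field_simps)
  also have "(\<Sum>k. complex_of_real (exp (- m)) * ((of_real m * iexp v) ^ k /\<^sub>R fact k)) =
      complex_of_real (exp (- m)) * exp (of_real m * iexp v)"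
    by (intro sums_unique[symmetric] sums_mult exp_converges)
  also have "\<dots> = exp (of_real m * (iexp v - 1))"
    by (simp add: exp_of_real[symmetric] exp_add[symmetric] algebra_simps)
  finally show "(\<integral>\<omega>. iexp (v * enn2real (N \<omega>)) \<partial>Q) = exp (of_real m * (iexp v - 1))" .
qed

lemma poisson_count_finite:
  assumes pp: "poisson_point_process Q M U J" and B: "B \<in> sets M" "emeasure M B < \<infinity>"
  shows "AE \<omega> in Q. finite {i \<in> J \<omega>. U i \<omega> \<in> B} \<and> enn2real (point_count U J B \<omega>) = real (card {i \<in> J \<omega>. U i \<omega> \<in> B})"
proof -
  have "AE \<omega> in Q. point_count U J B \<omega> \<in> range of_nat"
    using pp B by (intro poisson_count_char(1)[where m = "measure M B"]) (auto simp: poisson_point_process_def)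
  then show ?thesis
  proof eventually_elim
    case (elim \<omega>)
    then have "finite {i \<in> J \<omega>. U i \<omega> \<in> B}"
      unfolding point_count_def by (cases "finite {i \<in> J \<omega>. U i \<omega> \<in> B}") (auto simp: emeasure_count_space)
    then show ?case by (simp add: point_count_def emeasure_count_space)
  qed
qed

text \<open>
  The sum equals the linear combination of the independent Poisson counts of the level sets of
  \<open>g\<close>, with the values of \<open>g\<close> as coefficients.  Only the counts of a point process are
  random variables, and the linear combination of counts is the measurable version \<open>Y\<close> of the sum.
\<close>

lemma campbell_simple:
  fixes g :: "'w \<Rightarrow> real"
  assumes pp: "poisson_point_process Q M U J" and g: "simple_function M g"
    and fin: "emeasure M {x \<in> space M. g x \<noteq> 0} < \<infinity>"
  shows "\<exists>Y\<in>borel_measurable Q. (AE \<omega> in Q. Y \<omega> = (\<Sum>i\<in>{i \<in> J \<omega>. g (U i \<omega>) \<noteq> 0}. g (U i \<omega>))) \<and>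
    (\<integral>\<omega>. iexp (Y \<omega>) \<partial>Q) = exp (\<integral>x. iexp (g x) - 1 \<partial>M)"
proof -
  interpret Q: prob_space Q using pp by (simp add: poisson_point_process_def)
  have U: "U i \<omega> \<in> space M" if "\<omega> \<in> space Q" "i \<in> J \<omega>" for i \<omega>
    using pp that by (auto simp: poisson_point_process_def)
  have gm[measurable]: "g \<in> borel_measurable M" using g by (rule borel_measurable_simple_function)
  define V where "V = g ` space M - {0}"
  have V: "finite V" using g by (auto simp: V_def simple_function_def)
  define E where "E v = {x \<in> space M. g x = v}" for v
  have E[measurable]: "E v \<in> sets M" for v unfolding E_def by measurable
  have Efin: "emeasure M (E v) < \<infinity>" if "v \<noteq> 0" for v
  proof -
    have "emeasure M (E v) \<le> emeasure M {x \<in> space M. g x \<noteq> 0}"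
      using that unfolding E_def by (intro emeasure_mono) auto
    then show ?thesis using fin by (rule le_less_trans)
  qed
  define N where "N v = point_count U J (E v)" for v
  have N[measurable]: "N v \<in> borel_measurable Q" for v
    using pp E by (simp add: poisson_point_process_def N_def)
  define Y where "Y \<omega> = (\<Sum>v\<in>V. v * enn2real (N v \<omega>))" for \<omega>
  have Y: "Y \<in> borel_measurable Q" unfolding Y_def by measurable
  have "AE \<omega> in Q. \<forall>v\<in>V. finite {i \<in> J \<omega>. U i \<omega> \<in> E v} \<and> enn2real (N v \<omega>) = real (card {i \<in> J \<omega>. U i \<omega> \<in> E v})"
    unfolding N_def using V Efin by (intro AE_finite_allI poisson_count_finite[OF pp]) (auto simp: V_def)
  then have "AE \<omega> in Q. Y \<omega> = (\<Sum>i\<in>{i \<in> J \<omega>. g (U i \<omega>) \<noteq> 0}. g (U i \<omega>))"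
    using AE_space
  proof eventually_elim
    case (elim \<omega>)
    have UN: "{i \<in> J \<omega>. g (U i \<omega>) \<noteq> 0} = (\<Union>v\<in>V. {i \<in> J \<omega>. U i \<omega> \<in> E v})"
      using U[OF elim(2)] by (auto simp: V_def E_def)
    have "(\<Sum>i\<in>{i \<in> J \<omega>. g (U i \<omega>) \<noteq> 0}. g (U i \<omega>)) = (\<Sum>v\<in>V. \<Sum>i\<in>{i \<in> J \<omega>. U i \<omega> \<in> E v}. g (U i \<omega>))"
      unfolding UN using V elim(1) by (intro sum.UNION_disjoint) (auto simp: E_def)
    also have "\<dots> = (\<Sum>v\<in>V. \<Sum>i\<in>{i \<in> J \<omega>. U i \<omega> \<in> E v}. v)"
      by (intro sum.cong refl) (auto simp: E_def)
    also have "\<dots> = Y \<omega>" unfolding Y_def using elim(1) by (simp add: mult.commute)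
    finally show ?case ..
  qed
  moreover have "(\<integral>\<omega>. iexp (Y \<omega>) \<partial>Q) = exp (\<integral>x. iexp (g x) - 1 \<partial>M)"
  proof -
    obtain e where e: "bij_betw e {..<card V} V" using ex_bij_betw_nat_finite[OF V] by (auto simp: atLeast0LessThan)
    define B where "B n = (if n < card V then E (e n) else {})" for n
    have "disjoint_family B" unfolding disjoint_family_on_def
    proof safe
      fix n m x assume "n \<noteq> m" "x \<in> B n" "x \<in> B m"
      then show "x \<in> {}" using e by (auto simp: B_def E_def bij_betw_def inj_on_def split: if_splits)
    qed
    moreover have "range B \<subseteq> sets M" by (auto simp: B_def)
    moreover have "\<forall>B :: nat \<Rightarrow> 'w set. range B \<subseteq> sets M \<and> disjoint_family B \<longrightarrow>
        Q.indep_vars (\<lambda>_. borel) (\<lambda>n. point_count U J (B n)) UNIV"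
      using pp unfolding poisson_point_process_def by (elim conjE)
    ultimately have "Q.indep_vars (\<lambda>_. borel) (\<lambda>n. point_count U J (B n)) UNIV" by blast
    then have "Q.indep_vars (\<lambda>_. borel) (\<lambda>n. point_count U J (B n)) {..<card V}"
      by (rule Q.indep_vars_subset) auto
    then have ind: "Q.indep_vars (\<lambda>_. borel) (\<lambda>n \<omega>. iexp (e n * enn2real (point_count U J (B n) \<omega>))) {..<card V}"
      by (rule Q.indep_vars_compose2) measurable
    have "(\<integral>\<omega>. iexp (Y \<omega>) \<partial>Q) = (\<integral>\<omega>. (\<Prod>n<card V. iexp (e n * enn2real (point_count U J (B n) \<omega>))) \<partial>Q)"
    proof (rule Bochner_Integration.integral_cong[OF refl])
      fix \<omega>
      have "Y \<omega> = (\<Sum>n<card V. e n * enn2real (N (e n) \<omega>))"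
        unfolding Y_def by (rule sum.reindex_bij_betw[OF e, symmetric])
      also have "\<dots> = (\<Sum>n<card V. e n * enn2real (point_count U J (B n) \<omega>))"
        by (intro sum.cong refl) (simp add: N_def B_def)
      finally show "iexp (Y \<omega>) = (\<Prod>n<card V. iexp (e n * enn2real (point_count U J (B n) \<omega>)))"
        by (simp add: exp_sum sum_distrib_left)
    qed
    also have "\<dots> = (\<Prod>n<card V. \<integral>\<omega>. iexp (e n * enn2real (point_count U J (B n) \<omega>)) \<partial>Q)"
    proof (rule Q.indep_vars_lebesgue_integral[OF _ ind])
      fix n assume n: "n \<in> {..<card V}"
      have "(\<lambda>\<omega>. point_count U J (B n) \<omega>) \<in> borel_measurable Q"
        using N[of "e n"] n by (simp add: N_def B_def)
      then show "integrable Q (\<lambda>\<omega>. iexp (e n * enn2real (point_count U J (B n) \<omega>)))"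
        by (intro Q.integrable_const_bound[of _ 1]) auto
    qed simp
    also have "\<dots> = (\<Prod>n<card V. exp (of_real (measure M (E (e n))) * (iexp (e n) - 1)))"
    proof (rule prod.cong[OF refl])
      fix n assume n: "n \<in> {..<card V}"
      have "e n \<noteq> 0" using e n by (auto simp: bij_betw_def V_def)
      then show "(\<integral>\<omega>. iexp (e n * enn2real (point_count U J (B n) \<omega>)) \<partial>Q) = exp (of_real (measure M (E (e n))) * (iexp (e n) - 1))"
        using n pp Efin[of "e n"] Q.prob_space_axioms N[of "e n"]
        by (intro poisson_count_char(2)) (auto simp: B_def N_def poisson_point_process_def)
    qed
    also have "\<dots> = exp (\<Sum>n<card V. of_real (measure M (E (e n))) * (iexp (e n) - 1))"
      by (simp add: exp_sum)
    also have "(\<Sum>n<card V. of_real (measure M (E (e n))) * (iexp (e n) - 1)) = (\<Sum>v\<in>V. of_real (measure M (E v)) * (iexp v - 1))"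
      by (rule sum.reindex_bij_betw[OF e])
    also have "\<dots> = (\<integral>x. (\<Sum>v\<in>V. indicator (E v) x *\<^sub>R (iexp v - 1)) \<partial>M)"
    proof -
      have i: "integrable M (\<lambda>x. indicator (E v) x *\<^sub>R (iexp v - 1))" if "v \<in> V" for v
        using Efin[of v] that by (intro integrable_scaleR_left integrable_real_indicator) (auto simp: V_def)
      show ?thesis
        by (subst Bochner_Integration.integral_sum[OF i])
           (auto intro!: sum.cong simp: scaleR_conv_of_real)
    qed
    also have "\<dots> = (\<integral>x. iexp (g x) - 1 \<partial>M)"
    proof (rule Bochner_Integration.integral_cong[OF refl])
      fix x assume x: "x \<in> space M"
      have "(\<Sum>v\<in>V. indicator (E v) x *\<^sub>R (iexp v - 1)) = (\<Sum>v\<in>V. if v = g x then iexp (g x) - 1 else 0)"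
        using x by (intro sum.cong refl) (auto simp: E_def indicator_def)
      also have "\<dots> = iexp (g x) - 1" using V x by (auto simp: V_def)
      finally show "(\<Sum>v\<in>V. indicator (E v) x *\<^sub>R (iexp v - 1)) = iexp (g x) - 1" .
    qed
    finally show ?thesis .
  qed
  ultimately show ?thesis using Y by blast
qed

text \<open>
  Approximation by simple functions that vanish where \<open>g\<close> does: only the finitely many points with
  \<open>g \<noteq> 0\<close> contribute, so the sums converge, and the exponents are dominated by an indicator of
  finite measure.
\<close>

lemma campbell:
  fixes g :: "'w \<Rightarrow> real"
  assumes pp: "poisson_point_process Q M U J" and g[measurable]: "g \<in> borel_measurable M"
    and fin: "emeasure M {x \<in> space M. g x \<noteq> 0} < \<infinity>"
  shows "\<exists>Y\<in>borel_measurable Q. (AE \<omega> in Q. Y \<omega> = (\<Sum>i\<in>{i \<in> J \<omega>. g (U i \<omega>) \<noteq> 0}. g (U i \<omega>))) \<and>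
    (\<integral>\<omega>. iexp (Y \<omega>) \<partial>Q) = exp (\<integral>x. iexp (g x) - 1 \<partial>M)"
proof -
  interpret Q: prob_space Q using pp by (simp add: poisson_point_process_def)
  have U: "U i \<omega> \<in> space M" if "\<omega> \<in> space Q" "i \<in> J \<omega>" for i \<omega>
    using pp that by (auto simp: poisson_point_process_def)
  obtain F where F: "\<And>n::nat. simple_function M (F n)" "\<And>x. x \<in> space M \<Longrightarrow> (\<lambda>n. F n x) \<longlonglongrightarrow> g x"
    "\<And>n x. x \<in> space M \<Longrightarrow> dist (F n x) 0 \<le> 2 * dist (g x) 0"
    using borel_measurable_implies_sequence_metric[OF g, of 0] by metis
  have F0: "F n x = 0" if "x \<in> space M" "g x = 0" for n x using F(3)[OF that(1), of n] that(2) by simp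
  have [measurable]: "F n \<in> borel_measurable M" for n by (rule borel_measurable_simple_function[OF F(1)])
  have finF: "emeasure M {x \<in> space M. F n x \<noteq> 0} < \<infinity>" for n
  proof -
    have "emeasure M {x \<in> space M. F n x \<noteq> 0} \<le> emeasure M {x \<in> space M. g x \<noteq> 0}"
      using F0 by (intro emeasure_mono) auto
    then show ?thesis using fin by (rule le_less_trans)
  qed
  from choice[OF allI[OF campbell_simple[OF pp F(1) finF, unfolded Bex_def]]]
  obtain Y where Y_ex: "\<forall>n. Y n \<in> borel_measurable Q \<and> (AE \<omega> in Q. Y n \<omega> = (\<Sum>i\<in>{i \<in> J \<omega>. F n (U i \<omega>) \<noteq> 0}. F n (U i \<omega>))) \<and>
    (\<integral>\<omega>. iexp (Y n \<omega>) \<partial>Q) = exp (\<integral>x. iexp (F n x) - 1 \<partial>M)" by (rule exE)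
  have Ym[measurable]: "Y n \<in> borel_measurable Q" for n using Y_ex by blast
  have YS: "AE \<omega> in Q. Y n \<omega> = (\<Sum>i\<in>{i \<in> J \<omega>. F n (U i \<omega>) \<noteq> 0}. F n (U i \<omega>))" for n using Y_ex by blast
  have Yc: "(\<integral>\<omega>. iexp (Y n \<omega>) \<partial>Q) = exp (\<integral>x. iexp (F n x) - 1 \<partial>M)" for n using Y_ex by blast
  define Z where "Z \<omega> = lim (\<lambda>n. Y n \<omega>)" for \<omega>
  have Z[measurable]: "Z \<in> borel_measurable Q" unfolding Z_def by measurable
  let ?S = "\<lambda>\<omega>. \<Sum>i\<in>{i \<in> J \<omega>. g (U i \<omega>) \<noteq> 0}. g (U i \<omega>)"
  have "AE \<omega> in Q. \<forall>n. Y n \<omega> = (\<Sum>i\<in>{i \<in> J \<omega>. F n (U i \<omega>) \<noteq> 0}. F n (U i \<omega>))"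
    using YS by (simp add: AE_all_countable)
  moreover have "AE \<omega> in Q. finite {i \<in> J \<omega>. U i \<omega> \<in> {x \<in> space M. g x \<noteq> 0}}"
    using poisson_count_finite[OF pp _ fin] by (auto elim: AE_mp)
  ultimately have lim: "AE \<omega> in Q. (\<lambda>n. Y n \<omega>) \<longlonglongrightarrow> ?S \<omega>"
    using AE_space
  proof eventually_elim
    case (elim \<omega>)
    let ?T = "{i \<in> J \<omega>. g (U i \<omega>) \<noteq> 0}"
    have T: "finite ?T" using elim(2) U[OF elim(3)] by (auto elim!: rev_finite_subset)
    have "(\<Sum>i\<in>{i \<in> J \<omega>. F n (U i \<omega>) \<noteq> 0}. F n (U i \<omega>)) = (\<Sum>i\<in>?T. F n (U i \<omega>))" for n
      using T F0[OF U[OF elim(3)]] by (intro sum.mono_neutral_left) auto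
    moreover have "(\<lambda>n. \<Sum>i\<in>?T. F n (U i \<omega>)) \<longlonglongrightarrow> ?S \<omega>"
      using F(2)[OF U[OF elim(3)]] by (intro tendsto_sum) auto
    ultimately show ?case using elim(1) by simp
  qed
  then have ZS: "AE \<omega> in Q. Z \<omega> = ?S \<omega>" by eventually_elim (simp add: Z_def limI)
  have "(\<lambda>n. \<integral>\<omega>. iexp (Y n \<omega>) \<partial>Q) \<longlonglongrightarrow> (\<integral>\<omega>. iexp (Z \<omega>) \<partial>Q)"
  proof (rule integral_dominated_convergence[where w = "\<lambda>_. 1"])
    from lim ZS show "AE \<omega> in Q. (\<lambda>n. iexp (Y n \<omega>)) \<longlonglongrightarrow> iexp (Z \<omega>)"
    proof eventually_elim
      case (elim \<omega>)
      then have "(\<lambda>n. Y n \<omega>) \<longlonglongrightarrow> Z \<omega>" by simp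
      then show ?case by (intro tendsto_intros)
    qed
  qed auto
  moreover have "(\<lambda>n. exp (\<integral>x. iexp (F n x) - 1 \<partial>M)) \<longlonglongrightarrow> exp (\<integral>x. iexp (g x) - 1 \<partial>M)"
  proof (intro tendsto_exp integral_dominated_convergence[where w = "\<lambda>x. 2 * indicator {x \<in> space M. g x \<noteq> 0} x"])
    show "integrable M (\<lambda>x. 2 * indicator {x \<in> space M. g x \<noteq> 0} x :: real)"
      using fin by (intro integrable_mult_right integrable_real_indicator) auto
    show "AE x in M. (\<lambda>n. iexp (F n x) - 1) \<longlonglongrightarrow> iexp (g x) - 1"
      using F(2) by (intro AE_I2) (auto intro!: tendsto_intros)
    show "AE x in M. norm (iexp (F n x) - 1) \<le> 2 * indicator {x \<in> space M. g x \<noteq> 0} x" for n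
    proof (rule AE_I2)
      fix x assume x: "x \<in> space M"
      have "norm (iexp (F n x) - 1) \<le> norm (iexp (F n x)) + norm (1::complex)" by (rule norm_triangle_ineq4)
      then have "norm (iexp (F n x) - 1) \<le> 2" by simp
      then show "norm (iexp (F n x) - 1) \<le> 2 * indicator {x \<in> space M. g x \<noteq> 0} x"
        using x F0[OF x] by (auto simp: indicator_def)
    qed
  qed auto
  ultimately have "(\<integral>\<omega>. iexp (Z \<omega>) \<partial>Q) = exp (\<integral>x. iexp (g x) - 1 \<partial>M)"
    unfolding Yc by (rule LIMSEQ_unique)
  then show ?thesis using Z ZS by blast
qed

section \<open>Characteristic functions of compensated Poisson sums\<close>

text \<open>
  This is the Levy-Khintchine integrand at the point \<open>y\<close> and the frequency vector \<open>z\<close>, with each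
  coordinate truncated separately.
\<close>

definition levy_integrand :: "'k set \<Rightarrow> ('k \<Rightarrow> real) \<Rightarrow> ('k \<Rightarrow> real) \<Rightarrow> complex" where
  "levy_integrand K z y = iexp (\<Sum>k\<in>K. z k * y k) - 1 - \<i> * of_real (\<Sum>k\<in>K. z k * trunc (y k))"

lemma measurable_trunc[measurable]: "trunc \<in> borel_measurable borel"
  unfolding trunc_def[abs_def] by measurable

lemma measurable_levy_integrand:
  assumes "\<And>k. k \<in> K \<Longrightarrow> h k \<in> borel_measurable M"
  shows "(\<lambda>x. levy_integrand K z (\<lambda>k. h k x)) \<in> borel_measurable M"
proof -
  have [measurable]: "(\<lambda>x. \<Sum>k\<in>K. z k * h k x) \<in> borel_measurable M"
    "(\<lambda>x. \<Sum>k\<in>K. z k * trunc (h k x)) \<in> borel_measurable M"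
    using assms by (auto intro!: borel_measurable_sum measurable_compose[OF _ measurable_trunc])
  show ?thesis unfolding levy_integrand_def by measurable
qed

text \<open>
  The second order Taylor bound is used if all coordinates are at most \<open>1\<close> in absolute value; otherwise the sum on the
  right is at least \<open>1\<close> and the trivial bound suffices.  A bound \<open>S\<close> for the
  frequencies appears instead of their sum in order to have one dominating function for a whole range
  of frequencies.
\<close>

lemma norm_levy_integrand_le:
  assumes K: "finite K" and z: "(\<Sum>k\<in>K. \<bar>z k\<bar>) \<le> S"
  shows "norm (levy_integrand K z y) \<le> (2 + S + S\<^sup>2) * (\<Sum>k\<in>K. min 1 (\<bar>y k\<bar>\<^sup>2))"
proof -
  have S: "S \<ge> 0" using z by (meson abs_ge_zero order_trans sum_nonneg)
  have z': "\<bar>\<Sum>k\<in>K. z k * b k\<bar> \<le> S * c" if "\<And>k. k \<in> K \<Longrightarrow> \<bar>b k\<bar> \<le> c" "c \<ge> 0" for b c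
  proof -
    have "\<bar>\<Sum>k\<in>K. z k * b k\<bar> \<le> (\<Sum>k\<in>K. \<bar>z k * b k\<bar>)" by (rule sum_abs)
    also have "\<dots> \<le> (\<Sum>k\<in>K. \<bar>z k\<bar> * c)"
      using that by (intro sum_mono) (simp add: abs_mult mult_left_mono)
    also have "\<dots> = (\<Sum>k\<in>K. \<bar>z k\<bar>) * c" by (simp add: sum_distrib_right)
    also have "\<dots> \<le> S * c" using z that(2) by (rule mult_right_mono)
    finally show ?thesis .
  qed
  define T where "T = (\<Sum>k\<in>K. min 1 (\<bar>y k\<bar>\<^sup>2))"
  have T: "T \<ge> 0" unfolding T_def by (intro sum_nonneg) simp
  have T_ge: "min 1 (\<bar>y k\<bar>\<^sup>2) \<le> T" if "k \<in> K" for k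
    unfolding T_def using K that by (intro member_le_sum) auto
  show ?thesis
  proof (cases "\<forall>k\<in>K. \<bar>y k\<bar> \<le> 1")
    case True
    define s where "s = (\<Sum>k\<in>K. z k * y k)"
    have "(\<Sum>k\<in>K. z k * trunc (y k)) = s" unfolding s_def using True by (intro sum.cong) (auto simp: trunc_def)
    then have "levy_integrand K z y = iexp s - (\<Sum>k \<le> (1::nat). (\<i> * s) ^ k / fact k)"
      by (simp add: levy_integrand_def s_def[symmetric])
    then have "norm (levy_integrand K z y) \<le> \<bar>s\<bar> ^ 2 / 2"
      using iexp_approx1[of s 1] by (simp add: numeral_2_eq_2)
    also have "\<dots> \<le> s\<^sup>2" by simp
    also have "\<dots> \<le> S\<^sup>2 * T"
    proof -
      have "\<bar>y k\<bar> \<le> sqrt T" if k: "k \<in> K" for k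
      proof -
        have "\<bar>y k\<bar>\<^sup>2 \<le> 1" using True k by (simp add: abs_square_le_1)
        then have "\<bar>y k\<bar>\<^sup>2 \<le> T" using T_ge[OF k] by (simp add: min_def split: if_splits)
        then show ?thesis by (rule real_le_rsqrt)
      qed
      then have "\<bar>s\<bar> \<le> S * sqrt T" unfolding s_def using T by (intro z') auto
      then have "\<bar>s\<bar>\<^sup>2 \<le> (S * sqrt T)\<^sup>2" by (intro power_mono) auto
      then show ?thesis using T by (simp add: power_mult_distrib)
    qed
    also have "\<dots> \<le> (2 + S + S\<^sup>2) * T" using S T by (intro mult_right_mono) auto
    finally show ?thesis by (simp add: T_def)
  next
    case False
    then obtain k where k: "k \<in> K" "\<bar>y k\<bar> > 1" by (auto simp: not_le)
    have "1 \<le> \<bar>y k\<bar>\<^sup>2" using k(2) by (intro one_le_power) simp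
    then have "T \<ge> 1" using T_ge[OF k(1)] by (simp only: min_absorb1)
    have tr: "\<bar>trunc u\<bar> \<le> 1" for u by (auto simp: trunc_def sgn_if)
    have "norm (levy_integrand K z y) \<le> norm (iexp (\<Sum>k\<in>K. z k * y k) - 1) + norm (\<i> * complex_of_real (\<Sum>k\<in>K. z k * trunc (y k)))"
      unfolding levy_integrand_def by (rule norm_triangle_ineq4)
    also have "\<dots> \<le> (norm (iexp (\<Sum>k\<in>K. z k * y k)) + norm (1::complex)) + norm (\<i> * complex_of_real (\<Sum>k\<in>K. z k * trunc (y k)))"
      by (intro add_right_mono norm_triangle_ineq4)
    also have "\<dots> = 2 + \<bar>\<Sum>k\<in>K. z k * trunc (y k)\<bar>" unfolding norm_exp_i_times norm_mult norm_of_real by simp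
    also have "\<dots> \<le> 2 + S * 1" using tr by (intro add_left_mono z') auto
    also have "\<dots> \<le> (2 + S + S\<^sup>2) * 1" by simp
    also have "\<dots> \<le> (2 + S + S\<^sup>2) * T" using \<open>T \<ge> 1\<close> S by (intro mult_left_mono) auto
    finally show ?thesis by (simp add: T_def)
  qed
qed

lemma L_sum_tail:
  assumes f: "f \<in> L_sum M" and a: "a > 0"
  shows "emeasure M {x \<in> space M. a < \<bar>f x\<bar>} < \<infinity>"
proof -
  have [measurable]: "f \<in> borel_measurable M" using f by (simp add: L_sum_def)
  define b where "b = min 1 (a\<^sup>2)"
  have b: "b > 0" using a by (simp add: b_def)
  have "emeasure M {x \<in> space M. a < \<bar>f x\<bar>} = (\<integral>\<^sup>+x. indicator {x \<in> space M. a < \<bar>f x\<bar>} x \<partial>M)" by simp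
  also have "\<dots> \<le> (\<integral>\<^sup>+x. ennreal (1 / b) * ennreal (min 1 (\<bar>f x\<bar>\<^sup>2)) \<partial>M)"
  proof (rule nn_integral_mono)
    fix x
    show "indicator {x \<in> space M. a < \<bar>f x\<bar>} x \<le> ennreal (1 / b) * ennreal (min 1 (\<bar>f x\<bar>\<^sup>2))"
    proof (cases "a < \<bar>f x\<bar>")
      case True
      then have "a\<^sup>2 \<le> \<bar>f x\<bar>\<^sup>2" using a by (intro power_mono) auto
      then have "b \<le> min 1 (\<bar>f x\<bar>\<^sup>2)" by (auto simp: b_def)
      then have "1 \<le> (1 / b) * min 1 (\<bar>f x\<bar>\<^sup>2)" using b by (simp add: field_simps)
      then have "1 \<le> ennreal ((1 / b) * min 1 (\<bar>f x\<bar>\<^sup>2))" by (simp only: ennreal_ge_1)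
      also have "\<dots> = ennreal (1 / b) * ennreal (min 1 (\<bar>f x\<bar>\<^sup>2))" using b by (intro ennreal_mult) auto
      finally show ?thesis by (auto simp: indicator_def)
    qed (auto simp: indicator_def)
  qed
  also have "\<dots> = ennreal (1 / b) * (\<integral>\<^sup>+x. ennreal (min 1 (\<bar>f x\<bar>\<^sup>2)) \<partial>M)"
    by (intro nn_integral_cmult) measurable
  also have "\<dots> < \<infinity>" using f by (auto simp: L_sum_def ennreal_mult_less_top)
  finally show ?thesis .
qed

lemma integrable_L_sum:
  assumes "f \<in> L_sum M"
  shows "integrable M (\<lambda>x. min 1 (\<bar>f x\<bar>\<^sup>2))"
  using assms unfolding L_sum_def by (intro integrableI_nonneg) auto

lemma integrable_levy_integrand:
  assumes "finite K" "\<And>k. k \<in> K \<Longrightarrow> h k \<in> L_sum M"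
  shows "integrable M (\<lambda>x. levy_integrand K z (\<lambda>k. h k x))"
proof (rule Bochner_Integration.integrable_bound)
  define S where "S = (\<Sum>k\<in>K. \<bar>z k\<bar>)"
  have S: "S \<ge> 0" unfolding S_def by (rule sum_nonneg) simp
  show "integrable M (\<lambda>x. (2 + S + S\<^sup>2) * (\<Sum>k\<in>K. min 1 (\<bar>h k x\<bar>\<^sup>2)))"
    using assms by (intro integrable_mult_right Bochner_Integration.integrable_sum integrable_L_sum)
  show "AE x in M. norm (levy_integrand K z (\<lambda>k. h k x)) \<le> norm ((2 + S + S\<^sup>2) * (\<Sum>k\<in>K. min 1 (\<bar>h k x\<bar>\<^sup>2)))"
    unfolding real_norm_def
    by (intro AE_I2 order_trans[OF _ abs_ge_self] norm_levy_integrand_le[OF assms(1)]) (simp add: S_def)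
  show "(\<lambda>x. levy_integrand K z (\<lambda>k. h k x)) \<in> borel_measurable M"
    using assms by (intro measurable_levy_integrand) (auto simp: L_sum_def)
qed

text \<open>
  For each truncation level the Campbell formula applies to \<open>\<Sum>k. z k * h k\<close> with each \<open>h k\<close>
  cut off near \<open>0\<close>, and the compensators turn its exponent into the integral of the
  \<open>levy_integrand\<close> of the cut off functions.  Both sides pass to the limit by dominated convergence.
\<close>

lemma sum_integral_char:
  fixes h :: "'k \<Rightarrow> 'w \<Rightarrow> real"
  assumes pp: "poisson_point_process Q M U J" and K: "finite K"
    and h: "\<And>k. k \<in> K \<Longrightarrow> h k \<in> L_sum M" and Z: "\<And>k. k \<in> K \<Longrightarrow> is_sum_integral Q M U J (h k) (Z k)"
  shows "(\<integral>\<omega>. iexp (\<Sum>k\<in>K. z k * Z k \<omega>) \<partial>Q) = exp (\<integral>x. levy_integrand K z (\<lambda>k. h k x) \<partial>M)"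
proof -
  interpret Q: prob_space Q using pp by (simp add: poisson_point_process_def)
  have U: "U i \<omega> \<in> space M" if "\<omega> \<in> space Q" "i \<in> J \<omega>" for i \<omega>
    using pp that by (auto simp: poisson_point_process_def)
  have hm: "h k \<in> borel_measurable M" if "k \<in> K" for k using h[OF that] by (simp add: L_sum_def)
  have Zm: "Z k \<in> borel_measurable Q" if "k \<in> K" for k using Z[OF that] by (simp add: is_sum_integral_def)
  have ZKm[measurable]: "(\<lambda>\<omega>. \<Sum>k\<in>K. z k * Z k \<omega>) \<in> borel_measurable Q"
    using Zm by (intro borel_measurable_sum borel_measurable_times borel_measurable_const)
  define \<epsilon> where "\<epsilon> n = 1 / real (Suc n)" for n
  have \<epsilon>: "\<epsilon> n > 0" for n by (simp add: \<epsilon>_def)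
  have \<epsilon>0: "\<epsilon> \<longlonglongrightarrow> 0" unfolding \<epsilon>_def using LIMSEQ_inverse_real_of_nat by (simp add: inverse_eq_divide)
  have \<epsilon>F: "filterlim \<epsilon> (at_right 0) sequentially"
    unfolding filterlim_at using \<epsilon> \<epsilon>0 by (auto simp: less_imp_neq[symmetric])
  define h' where "h' n k x = (if \<epsilon> n < \<bar>h k x\<bar> then h k x else 0)" for n k x
  have h'm[measurable]: "h' n k \<in> borel_measurable M" if "k \<in> K" for n k
    unfolding h'_def using hm[OF that] by measurable
  have h'_le: "\<bar>h' n k x\<bar> \<le> \<bar>h k x\<bar>" for n k x by (simp add: h'_def)
  have h'L: "h' n k \<in> L_sum M" if k: "k \<in> K" for n k
  proof -
    have "(\<integral>\<^sup>+x. ennreal (min 1 (\<bar>h' n k x\<bar>\<^sup>2)) \<partial>M) \<le> (\<integral>\<^sup>+x. ennreal (min 1 (\<bar>h k x\<bar>\<^sup>2)) \<partial>M)"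
      using h'_le by (intro nn_integral_mono ennreal_leI min.mono order_refl power_mono) auto
    then show ?thesis using h[OF k] h'm[OF k] by (auto simp: L_sum_def intro: le_less_trans)
  qed
  define g where "g n x = (\<Sum>k\<in>K. z k * h' n k x)" for n x
  have gm[measurable]: "g n \<in> borel_measurable M" for n
    unfolding g_def using h'm by (intro borel_measurable_sum borel_measurable_times borel_measurable_const)
  define B where "B n = {x \<in> space M. \<exists>k\<in>K. \<epsilon> n < \<bar>h k x\<bar>}" for n
  have B_UN: "B n = (\<Union>k\<in>K. {x \<in> space M. \<epsilon> n < \<bar>h k x\<bar>})" for n by (auto simp: B_def)
  have hk_sets: "{x \<in> space M. \<epsilon> n < \<bar>h k x\<bar>} \<in> sets M" if "k \<in> K" for n k using hm[OF that] by measurable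
  have Bm[measurable]: "B n \<in> sets M" for n unfolding B_UN using K hk_sets by auto
  have Bfin: "emeasure M (B n) < \<infinity>" for n
  proof -
    have "emeasure M (B n) \<le> (\<Sum>k\<in>K. emeasure M {x \<in> space M. \<epsilon> n < \<bar>h k x\<bar>})"
      unfolding B_UN using K hk_sets by (intro emeasure_subadditive_finite) auto
    also have "\<dots> < \<infinity>" using K L_sum_tail[OF h \<epsilon>] by (auto simp: less_top[symmetric] less_imp_neq)
    finally show ?thesis .
  qed
  have g0: "g n x = 0" if "x \<in> space M" "x \<notin> B n" for n x
    using that unfolding g_def by (intro sum.neutral) (auto simp: B_def h'_def)
  have gfin: "emeasure M {x \<in> space M. g n x \<noteq> 0} < \<infinity>" for n
  proof -
    have "emeasure M {x \<in> space M. g n x \<noteq> 0} \<le> emeasure M (B n)"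
      using g0 by (intro emeasure_mono) auto
    then show ?thesis using Bfin by (rule le_less_trans)
  qed
  from choice[OF allI[OF campbell[OF pp gm gfin, unfolded Bex_def]]]
  obtain Y where Y_ex: "\<forall>n. Y n \<in> borel_measurable Q \<and> (AE \<omega> in Q. Y n \<omega> = (\<Sum>i\<in>{i \<in> J \<omega>. g n (U i \<omega>) \<noteq> 0}. g n (U i \<omega>))) \<and>
    (\<integral>\<omega>. iexp (Y n \<omega>) \<partial>Q) = exp (\<integral>x. iexp (g n x) - 1 \<partial>M)" by (rule exE)
  have Ym[measurable]: "Y n \<in> borel_measurable Q" for n using Y_ex by blast
  have YS: "AE \<omega> in Q. Y n \<omega> = (\<Sum>i\<in>{i \<in> J \<omega>. g n (U i \<omega>) \<noteq> 0}. g n (U i \<omega>))" for n using Y_ex by blast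
  have Yc: "(\<integral>\<omega>. iexp (Y n \<omega>) \<partial>Q) = exp (\<integral>x. iexp (g n x) - 1 \<partial>M)" for n using Y_ex by blast
  define c where "c n k = (LINT x:{x \<in> space M. \<epsilon> n < \<bar>h k x\<bar>}|M. trunc (h k x))" for n k
  have c_eq: "c n k = (\<integral>x. trunc (h' n k x) \<partial>M)" for n k
    unfolding c_def set_lebesgue_integral_def
    by (intro Bochner_Integration.integral_cong) (auto simp: h'_def indicator_def trunc_def)
  have c_int: "integrable M (\<lambda>x. trunc (h' n k x))" if k: "k \<in> K" for n k
  proof (rule Bochner_Integration.integrable_bound)
    show "integrable M (indicator (B n) :: _ \<Rightarrow> real)" using Bfin by (intro integrable_real_indicator) auto
    show "(\<lambda>x. trunc (h' n k x)) \<in> borel_measurable M" using h'm[OF k] by measurable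
    show "AE x in M. norm (trunc (h' n k x)) \<le> norm (indicator (B n) x :: real)"
    proof (rule AE_I2)
      fix x assume x: "x \<in> space M"
      have tr: "\<bar>trunc u\<bar> \<le> 1" for u by (auto simp: trunc_def sgn_if)
      show "norm (trunc (h' n k x)) \<le> norm (indicator (B n) x :: real)"
      proof (cases "x \<in> B n")
        case False
        then have "h' n k x = 0" using k x by (auto simp: B_def h'_def)
        then show ?thesis by (simp add: trunc_def)
      qed (use tr in simp)
    qed
  qed
  define W where "W n \<omega> = Y n \<omega> - (\<Sum>k\<in>K. z k * c n k)" for n \<omega>
  have Wm[measurable]: "W n \<in> borel_measurable Q" for n unfolding W_def by measurable
  have "AE \<omega> in Q. \<forall>n. Y n \<omega> = (\<Sum>i\<in>{i \<in> J \<omega>. g n (U i \<omega>) \<noteq> 0}. g n (U i \<omega>))"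
    using YS by (simp add: AE_all_countable)
  moreover have "AE \<omega> in Q. \<forall>n. finite {i \<in> J \<omega>. U i \<omega> \<in> B n}"
    unfolding AE_all_countable
  proof
    fix n
    from poisson_count_finite[OF pp Bm[of n] Bfin[of n]] show "AE \<omega> in Q. finite {i \<in> J \<omega>. U i \<omega> \<in> B n}"
      by eventually_elim simp
  qed
  moreover have "AE \<omega> in Q. \<forall>k\<in>K. ((\<lambda>\<epsilon>. (\<Sum>i\<in>{i \<in> J \<omega>. \<bar>h k (U i \<omega>)\<bar> > \<epsilon>}. h k (U i \<omega>))
              - (LINT x:{x \<in> space M. \<bar>h k x\<bar> > \<epsilon>}|M. trunc (h k x))) \<longlongrightarrow> Z k \<omega>) (at_right 0)"
    using Z K by (intro AE_finite_allI) (auto simp: is_sum_integral_def)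
  ultimately have lim: "AE \<omega> in Q. (\<lambda>n. W n \<omega>) \<longlonglongrightarrow> (\<Sum>k\<in>K. z k * Z k \<omega>)"
    using AE_space
  proof eventually_elim
    case (elim \<omega>)
    have W_eq: "W n \<omega> = (\<Sum>k\<in>K. z k * ((\<Sum>i\<in>{i \<in> J \<omega>. \<bar>h k (U i \<omega>)\<bar> > \<epsilon> n}. h k (U i \<omega>)) - c n k))" for n
    proof -
      let ?T = "{i \<in> J \<omega>. U i \<omega> \<in> B n}"
      have T: "finite ?T" using elim by blast
      have "Y n \<omega> = (\<Sum>i\<in>{i \<in> J \<omega>. g n (U i \<omega>) \<noteq> 0}. g n (U i \<omega>))" using elim by blast
      also have "\<dots> = (\<Sum>i\<in>?T. g n (U i \<omega>))"
        using T g0 U[OF elim(4)] by (intro sum.mono_neutral_left) auto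
      also have "\<dots> = (\<Sum>k\<in>K. \<Sum>i\<in>?T. z k * h' n k (U i \<omega>))" unfolding g_def by (rule sum.swap)
      also have "\<dots> = (\<Sum>k\<in>K. z k * (\<Sum>i\<in>{i \<in> J \<omega>. \<bar>h k (U i \<omega>)\<bar> > \<epsilon> n}. h k (U i \<omega>)))"
      proof (rule sum.cong[OF refl])
        fix k assume k: "k \<in> K"
        have "(\<Sum>i\<in>?T. h' n k (U i \<omega>)) = (\<Sum>i\<in>{i \<in> J \<omega>. \<bar>h k (U i \<omega>)\<bar> > \<epsilon> n}. h k (U i \<omega>))"
          using T k U[OF elim(4)] by (intro sum.mono_neutral_cong_right) (auto simp: h'_def B_def)
        then show "(\<Sum>i\<in>?T. z k * h' n k (U i \<omega>)) = z k * (\<Sum>i\<in>{i \<in> J \<omega>. \<bar>h k (U i \<omega>)\<bar> > \<epsilon> n}. h k (U i \<omega>))"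
          by (simp add: sum_distrib_left[symmetric])
      qed
      finally show ?thesis by (simp add: W_def sum_subtractf right_diff_distrib)
    qed
    show ?case unfolding W_eq c_def
    proof (intro tendsto_sum tendsto_mult tendsto_const)
      fix k assume "k \<in> K"
      from filterlim_compose[OF elim(3)[rule_format, OF this] \<epsilon>F]
      show "(\<lambda>n. (\<Sum>i\<in>{i \<in> J \<omega>. \<bar>h k (U i \<omega>)\<bar> > \<epsilon> n}. h k (U i \<omega>))
          - (LINT x:{x \<in> space M. \<epsilon> n < \<bar>h k x\<bar>}|M. trunc (h k x))) \<longlonglongrightarrow> Z k \<omega>" .
    qed
  qed
  have lim_W: "(\<lambda>n. \<integral>\<omega>. iexp (W n \<omega>) \<partial>Q) \<longlonglongrightarrow> (\<integral>\<omega>. iexp (\<Sum>k\<in>K. z k * Z k \<omega>) \<partial>Q)"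
  proof (rule integral_dominated_convergence[where w = "\<lambda>_. 1"])
    from lim show "AE \<omega> in Q. (\<lambda>n. iexp (W n \<omega>)) \<longlonglongrightarrow> iexp (\<Sum>k\<in>K. z k * Z k \<omega>)"
    proof eventually_elim
      case (elim \<omega>)
      from tendsto_exp[OF tendsto_mult[OF tendsto_const tendsto_of_real[OF elim]]] show ?case .
    qed
    show "AE \<omega> in Q. norm (iexp (W n \<omega>)) \<le> 1" for n unfolding norm_exp_i_times by simp
    show "(\<lambda>\<omega>. iexp (\<Sum>k\<in>K. z k * Z k \<omega>)) \<in> borel_measurable Q" by measurable
    show "(\<lambda>\<omega>. iexp (W n \<omega>)) \<in> borel_measurable Q" for n by measurable
  qed simp
  have char_W: "(\<integral>\<omega>. iexp (W n \<omega>) \<partial>Q) = exp (\<integral>x. levy_integrand K z (\<lambda>k. h' n k x) \<partial>M)" for n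
  proof -
    have "(\<integral>\<omega>. iexp (W n \<omega>) \<partial>Q) = (\<integral>\<omega>. iexp (Y n \<omega>) * iexp (- (\<Sum>k\<in>K. z k * c n k)) \<partial>Q)"
      unfolding W_def by (intro Bochner_Integration.integral_cong refl) (simp only: exp_add[symmetric] of_real_add[symmetric] distrib_left[symmetric] diff_conv_add_uminus)
    also have "\<dots> = exp (\<integral>x. iexp (g n x) - 1 \<partial>M) * iexp (- (\<Sum>k\<in>K. z k * c n k))"
      by (simp only: integral_mult_left_zero Yc)
    also have "\<dots> = exp ((\<integral>x. iexp (g n x) - 1 \<partial>M) - \<i> * of_real (\<Sum>k\<in>K. z k * c n k))"
      by (simp add: exp_add[symmetric])
    also have "of_real (\<Sum>k\<in>K. z k * c n k) = (\<integral>x. complex_of_real (\<Sum>k\<in>K. z k * trunc (h' n k x)) \<partial>M)"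
      unfolding integral_complex_of_real c_eq using c_int
      by (subst Bochner_Integration.integral_sum) auto
    also have "(\<integral>x. iexp (g n x) - 1 \<partial>M) - \<i> * (\<integral>x. complex_of_real (\<Sum>k\<in>K. z k * trunc (h' n k x)) \<partial>M) =
       (\<integral>x. (iexp (g n x) - 1) - \<i> * complex_of_real (\<Sum>k\<in>K. z k * trunc (h' n k x)) \<partial>M)"
    proof -
      have i1: "integrable M (\<lambda>x. \<i> * complex_of_real (\<Sum>k\<in>K. z k * trunc (h' n k x)))"
        using c_int by (intro integrable_mult_right integrable_of_real Bochner_Integration.integrable_sum) auto
      have "integrable M (\<lambda>x. levy_integrand K z (\<lambda>k. h' n k x) + \<i> * complex_of_real (\<Sum>k\<in>K. z k * trunc (h' n k x)))"
        by (intro Bochner_Integration.integrable_add i1 integrable_levy_integrand[OF K h'L])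
      then have "integrable M (\<lambda>x. iexp (g n x) - 1)"
        by (simp add: levy_integrand_def g_def)
      from Bochner_Integration.integral_diff[OF this i1] show ?thesis by simp
    qed
    finally show ?thesis by (simp add: levy_integrand_def g_def)
  qed
  have lim_exp: "(\<lambda>n. exp (\<integral>x. levy_integrand K z (\<lambda>k. h' n k x) \<partial>M)) \<longlonglongrightarrow> exp (\<integral>x. levy_integrand K z (\<lambda>k. h k x) \<partial>M)"
  proof (intro tendsto_exp)
    define S where "S = (\<Sum>k\<in>K. \<bar>z k\<bar>)"
    have S: "S \<ge> 0" unfolding S_def by (rule sum_nonneg) simp
    show "(\<lambda>n. \<integral>x. levy_integrand K z (\<lambda>k. h' n k x) \<partial>M) \<longlonglongrightarrow> (\<integral>x. levy_integrand K z (\<lambda>k. h k x) \<partial>M)"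
    proof (rule integral_dominated_convergence[where w = "\<lambda>x. (2 + S + S\<^sup>2) * (\<Sum>k\<in>K. min 1 (\<bar>h k x\<bar>\<^sup>2))"])
      show "integrable M (\<lambda>x. (2 + S + S\<^sup>2) * (\<Sum>k\<in>K. min 1 (\<bar>h k x\<bar>\<^sup>2)))"
        using h by (intro integrable_mult_right Bochner_Integration.integrable_sum integrable_L_sum)
      show "AE x in M. norm (levy_integrand K z (\<lambda>k. h' n k x)) \<le> (2 + S + S\<^sup>2) * (\<Sum>k\<in>K. min 1 (\<bar>h k x\<bar>\<^sup>2))" for n
      proof (rule AE_I2)
        fix x
        have "norm (levy_integrand K z (\<lambda>k. h' n k x)) \<le> (2 + S + S\<^sup>2) * (\<Sum>k\<in>K. min 1 (\<bar>h' n k x\<bar>\<^sup>2))"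
          by (rule norm_levy_integrand_le[OF K]) (simp add: S_def)
        also have "\<dots> \<le> (2 + S + S\<^sup>2) * (\<Sum>k\<in>K. min 1 (\<bar>h k x\<bar>\<^sup>2))"
          using h'_le S by (intro mult_left_mono sum_mono min.mono order_refl power_mono) auto
        finally show "norm (levy_integrand K z (\<lambda>k. h' n k x)) \<le> (2 + S + S\<^sup>2) * (\<Sum>k\<in>K. min 1 (\<bar>h k x\<bar>\<^sup>2))" .
      qed
      show "AE x in M. (\<lambda>n. levy_integrand K z (\<lambda>k. h' n k x)) \<longlonglongrightarrow> levy_integrand K z (\<lambda>k. h k x)"
      proof (rule AE_I2)
        fix x
        have "eventually (\<lambda>n. \<forall>k\<in>K. h' n k x = h k x) sequentially"
        proof (rule eventually_ball_finite[OF K], rule ballI)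
          fix k
          show "eventually (\<lambda>n. h' n k x = h k x) sequentially"
          proof (cases "h k x = 0")
            case False
            then have "eventually (\<lambda>n. \<epsilon> n < \<bar>h k x\<bar>) sequentially"
              using order_tendstoD(2)[OF \<epsilon>0] by simp
            then show ?thesis by eventually_elim (simp add: h'_def)
          qed (simp add: h'_def)
        qed
        then have "eventually (\<lambda>n. levy_integrand K z (\<lambda>k. h' n k x) = levy_integrand K z (\<lambda>k. h k x)) sequentially"
          by eventually_elim (simp add: levy_integrand_def)
        then show "(\<lambda>n. levy_integrand K z (\<lambda>k. h' n k x)) \<longlonglongrightarrow> levy_integrand K z (\<lambda>k. h k x)"
          by (rule tendsto_eventually)
      qed
      show "(\<lambda>x. levy_integrand K z (\<lambda>k. h k x)) \<in> borel_measurable M" using hm by (rule measurable_levy_integrand)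
      show "(\<lambda>x. levy_integrand K z (\<lambda>k. h' n k x)) \<in> borel_measurable M" for n using h'm by (rule measurable_levy_integrand)
    qed
  qed
  from lim_W[unfolded char_W] lim_exp show ?thesis by (rule LIMSEQ_unique)
qed

text \<open>
  The values of \<open>H\<close> are integer multiples of \<open>2 pi i\<close>, and a continuous function on an interval
  with values in a discrete set is constant.
\<close>

lemma logarithm_unique_on_ray:
  fixes H :: "real \<Rightarrow> complex"
  assumes cont: "continuous_on {0..1} H" and one: "\<And>r. r \<in> {0..1} \<Longrightarrow> exp (H r) = 1" and H0: "H 0 = 0"
  shows "H 1 = 0"
proof -
  have "H constant_on {0..1}"
  proof (rule continuous_discrete_range_constant[OF _ cont])
    fix r :: real assume r: "r \<in> {0..1}"
    show "\<exists>e>0. \<forall>y. y \<in> {0..1} \<and> H y \<noteq> H r \<longrightarrow> e \<le> norm (H y - H r)"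
    proof (intro exI[of _ 1] conjI allI impI)
      fix y assume y: "y \<in> {0..1} \<and> H y \<noteq> H r"
      have "exp (H y - H r) = 1" using one[of y] one[of r] y r by (simp add: exp_diff)
      then obtain n :: int where n: "Re (H y - H r) = 0" "Im (H y - H r) = of_int (2 * n) * pi"
        by (auto simp: exp_eq_1)
      have "n \<noteq> 0"
      proof
        assume "n = 0"
        then have "H y - H r = 0" using n by (intro complex_eqI) auto
        with y show False by simp
      qed
      then have "1 \<le> \<bar>real_of_int n\<bar>" by linarith
      then have "1 * 1 \<le> \<bar>real_of_int (2 * n)\<bar> * pi" using pi_gt3 by (intro mult_mono) auto
      also have "\<dots> = \<bar>Im (H y - H r)\<bar>" unfolding n(2) abs_mult by simp
      also have "\<dots> \<le> norm (H y - H r)" by (rule abs_Im_le_cmod)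
      finally show "1 \<le> norm (H y - H r)" by simp
    qed simp
  qed simp
  then obtain a where a: "\<And>r. r \<in> {0..1} \<Longrightarrow> H r = a" unfolding constant_on_def by blast
  show ?thesis using a[of 0] a[of 1] H0 by simp
qed

lemma levy_exponent_continuous_on_ray:
  assumes K: "finite K" and h: "\<And>k. k \<in> K \<Longrightarrow> h k \<in> L_sum M"
  shows "continuous_on {0..1} (\<lambda>r::real. \<integral>x. levy_integrand K (\<lambda>k. r * z k) (\<lambda>k. h k x) \<partial>M)"
  unfolding continuous_on_sequentially comp_def
proof (intro allI impI ballI)
  fix \<rho> :: "nat \<Rightarrow> real" and r assume r: "r \<in> {0..1}" and \<rho>: "(\<forall>n. \<rho> n \<in> {0..1}) \<and> \<rho> \<longlonglongrightarrow> r"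
  define S where "S = (\<Sum>k\<in>K. \<bar>z k\<bar>)"
  have hm: "h k \<in> borel_measurable M" if "k \<in> K" for k using h[OF that] by (simp add: L_sum_def)
  show "(\<lambda>n. \<integral>x. levy_integrand K (\<lambda>k. \<rho> n * z k) (\<lambda>k. h k x) \<partial>M) \<longlonglongrightarrow> (\<integral>x. levy_integrand K (\<lambda>k. r * z k) (\<lambda>k. h k x) \<partial>M)"
  proof (rule integral_dominated_convergence[where w = "\<lambda>x. (2 + S + S\<^sup>2) * (\<Sum>k\<in>K. min 1 (\<bar>h k x\<bar>\<^sup>2))"])
    show "integrable M (\<lambda>x. (2 + S + S\<^sup>2) * (\<Sum>k\<in>K. min 1 (\<bar>h k x\<bar>\<^sup>2)))"
      using h by (intro integrable_mult_right Bochner_Integration.integrable_sum integrable_L_sum)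
    show "AE x in M. norm (levy_integrand K (\<lambda>k. \<rho> n * z k) (\<lambda>k. h k x)) \<le> (2 + S + S\<^sup>2) * (\<Sum>k\<in>K. min 1 (\<bar>h k x\<bar>\<^sup>2))" for n
    proof (intro AE_I2 norm_levy_integrand_le[OF K])
      show "(\<Sum>k\<in>K. \<bar>\<rho> n * z k\<bar>) \<le> S"
        unfolding S_def using \<rho> by (intro sum_mono) (auto simp: abs_mult intro!: mult_left_le_one_le)
    qed
    show "AE x in M. (\<lambda>n. levy_integrand K (\<lambda>k. \<rho> n * z k) (\<lambda>k. h k x)) \<longlonglongrightarrow> levy_integrand K (\<lambda>k. r * z k) (\<lambda>k. h k x)"
      unfolding levy_integrand_def using \<rho> by (intro AE_I2 tendsto_intros) auto
  qed (rule measurable_levy_integrand, rule hm, assumption)+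
qed

section \<open>Compensated Poisson sums under shifts\<close>

locale sum_representation = stationary_process I P X
  for I :: "'t::real_normed_vector set" and P :: "'p measure" and X +
  fixes M :: "'w measure" and f :: "'t \<Rightarrow> 'w \<Rightarrow> real" and c :: "'t \<Rightarrow> real" and Q :: "'q measure" and U J
  assumes pp: "poisson_point_process Q M U J" and rep: "sum_spectral_rep I P X M f c Q U J"
begin

lemma f_L_sum: "t \<in> I \<Longrightarrow> f t \<in> L_sum M" using rep by (simp add: sum_spectral_rep_def)

lemma f_measurable: "t \<in> I \<Longrightarrow> f t \<in> borel_measurable M" using f_L_sum by (auto simp: L_sum_def)

definition exponent :: "'k set \<Rightarrow> ('k \<Rightarrow> real) \<Rightarrow> ('k \<Rightarrow> 't) \<Rightarrow> complex" where
  "exponent K z \<tau> = (\<integral>x. levy_integrand K z (\<lambda>k. f (\<tau> k) x) \<partial>M) + \<i> * of_real (\<Sum>k\<in>K. z k * c (\<tau> k))"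

lemma char_eq_exp_exponent:
  assumes K: "finite K" "\<tau> ` K \<subseteq> I"
  shows "(\<integral>\<omega>. iexp (\<Sum>k\<in>K. z k * X (\<tau> k) \<omega>) \<partial>P) = exp (exponent K z \<tau>)"
proof -
  obtain Z where Z: "\<forall>t\<in>I. is_sum_integral Q M U J (f t) (Z t)" and fdd: "fdd_eq I P X Q (\<lambda>t \<omega>. Z t \<omega> + c t)"
    using rep unfolding sum_spectral_rep_def by blast
  have Zm: "Z t \<in> borel_measurable Q" if "t \<in> I" for t using Z that by (simp add: is_sum_integral_def)
  have \<tau>: "\<tau> k \<in> I" if "k \<in> K" for k using K that by auto
  have "(\<integral>\<omega>. iexp (\<Sum>k\<in>K. z k * X (\<tau> k) \<omega>) \<partial>P) = (\<integral>\<omega>. iexp (\<Sum>k\<in>K. z k * (Z (\<tau> k) \<omega> + c (\<tau> k))) \<partial>Q)"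
    using X_measurable Zm by (intro fdd_eq_integral[OF fdd K]) auto
  also have "\<dots> = (\<integral>\<omega>. iexp (\<Sum>k\<in>K. z k * Z (\<tau> k) \<omega>) * iexp (\<Sum>k\<in>K. z k * c (\<tau> k)) \<partial>Q)"
  proof (rule Bochner_Integration.integral_cong[OF refl])
    fix \<omega>
    have "(\<Sum>k\<in>K. z k * (Z (\<tau> k) \<omega> + c (\<tau> k))) = (\<Sum>k\<in>K. z k * Z (\<tau> k) \<omega>) + (\<Sum>k\<in>K. z k * c (\<tau> k))"
      by (simp add: distrib_left sum.distrib)
    then show "iexp (\<Sum>k\<in>K. z k * (Z (\<tau> k) \<omega> + c (\<tau> k))) = iexp (\<Sum>k\<in>K. z k * Z (\<tau> k) \<omega>) * iexp (\<Sum>k\<in>K. z k * c (\<tau> k))"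
      by (simp only: of_real_add distrib_left exp_add)
  qed
  also have "\<dots> = (\<integral>\<omega>. iexp (\<Sum>k\<in>K. z k * Z (\<tau> k) \<omega>) \<partial>Q) * iexp (\<Sum>k\<in>K. z k * c (\<tau> k))"
    by (rule integral_mult_left_zero)
  also have "(\<integral>\<omega>. iexp (\<Sum>k\<in>K. z k * Z (\<tau> k) \<omega>) \<partial>Q) = exp (\<integral>x. levy_integrand K z (\<lambda>k. f (\<tau> k) x) \<partial>M)"
    using Z \<tau> f_L_sum by (intro sum_integral_char[OF pp K(1)]) auto
  finally show ?thesis by (simp only: exponent_def exp_add)
qed

text \<open>
  Stationarity gives equality of the exponentials.  The exponents themselves agree because they are
  continuous along the ray from frequency \<open>0\<close> to \<open>z\<close> and agree at \<open>0\<close>.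
\<close>

lemma exponent_shift:
  assumes K: "finite K" "\<tau> ` K \<subseteq> I" and u: "u \<in> I"
  shows "exponent K z (\<lambda>k. \<tau> k + u) = exponent K z \<tau>"
proof -
  have \<tau>u: "(\<lambda>k. \<tau> k + u) ` K \<subseteq> I" using K u I_add by auto
  define H where "H r = exponent K (\<lambda>k. r * z k) (\<lambda>k. \<tau> k + u) - exponent K (\<lambda>k. r * z k) \<tau>" for r :: real
  have cont: "continuous_on {0..1} (\<lambda>r. exponent K (\<lambda>k. r * z k) \<sigma>)" if "\<sigma> ` K \<subseteq> I" for \<sigma>
  proof -
    have "continuous_on {0..1} (\<lambda>r. \<integral>x. levy_integrand K (\<lambda>k. r * z k) (\<lambda>k. f (\<sigma> k) x) \<partial>M)"
      using that f_L_sum by (intro levy_exponent_continuous_on_ray[OF K(1)]) auto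
    then show ?thesis unfolding exponent_def by (intro continuous_intros)
  qed
  have "H 1 = 0"
  proof (rule logarithm_unique_on_ray)
    show "continuous_on {0..1} H" unfolding H_def by (intro continuous_intros cont K \<tau>u)
    show "H 0 = 0" by (simp add: H_def exponent_def levy_integrand_def)
    fix r
    have "fdd_eq I P X P (\<lambda>t. X (t + u))" using st u by (simp add: stationary_def)
    from fdd_eq_integral[OF this K X_measurable, of "\<lambda>k. r * z k"]
    have "(\<integral>\<omega>. iexp (\<Sum>k\<in>K. r * z k * X (\<tau> k) \<omega>) \<partial>P) = (\<integral>\<omega>. iexp (\<Sum>k\<in>K. r * z k * X (\<tau> k + u) \<omega>) \<partial>P)"
      using I_add u X_measurable by auto
    then show "exp (H r) = 1"
      unfolding H_def char_eq_exp_exponent[OF K] char_eq_exp_exponent[OF K(1) \<tau>u] by (simp add: exp_diff)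
  qed
  then show ?thesis by (simp add: H_def)
qed

lemma integrable_one_minus_cos:
  assumes g: "g \<in> L_sum M" and a: "\<bar>a\<bar> \<le> 1"
  shows "integrable M (\<lambda>x. 1 - cos (a * g x))"
proof (rule Bochner_Integration.integrable_bound)
  have [measurable]: "g \<in> borel_measurable M" using g by (simp add: L_sum_def)
  show "integrable M (\<lambda>x. 2 * min 1 (\<bar>g x\<bar>\<^sup>2))" using g by (intro integrable_mult_right integrable_L_sum)
  show "(\<lambda>x. 1 - cos (a * g x)) \<in> borel_measurable M" by measurable
  show "AE x in M. norm (1 - cos (a * g x)) \<le> norm (2 * min 1 (\<bar>g x\<bar>\<^sup>2))"
  proof (rule AE_I2)
    fix x
    define y where "y = a * g x"
    have "1 - cos y = 2 * (sin (y / 2))\<^sup>2" using cos_double_sin[of "y / 2"] by simp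
    also have "\<bar>sin (y / 2)\<bar> \<le> \<bar>g x\<bar>"
    proof -
      have "\<bar>sin (y / 2)\<bar> \<le> \<bar>y / 2\<bar>" by (rule abs_sin_x_le_abs_x)
      also have "\<dots> \<le> \<bar>y\<bar>" by simp
      also have "\<dots> \<le> \<bar>g x\<bar>" unfolding y_def abs_mult using a by (intro mult_left_le_one_le) auto
      finally show ?thesis .
    qed
    then have "(sin (y / 2))\<^sup>2 \<le> \<bar>g x\<bar>\<^sup>2" by (simp add: abs_le_square_iff[symmetric])
    moreover have "(sin (y / 2))\<^sup>2 \<le> 1" by (simp add: abs_square_le_1)
    ultimately have "1 - cos y \<le> 2 * min 1 (\<bar>g x\<bar>\<^sup>2)"
      using \<open>1 - cos y = 2 * (sin (y / 2))\<^sup>2\<close> by simp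
    then show "norm (1 - cos (a * g x)) \<le> norm (2 * min 1 (\<bar>g x\<bar>\<^sup>2))"
      unfolding y_def using cos_le_one[of "a * g x"] by simp
  qed
qed

text \<open>
  Terms that are linear in the frequency, namely the compensators and the shift \<open>c\<close>, cancel in a second
  difference.  What is left is the Fourier transform of the law of the family \<open>f\<close>, weighted by
  \<open>2 (1 - cos (a * f (\<tau> n)))\<close>, a finite measure.
\<close>

lemma second_difference:
  fixes z :: "'k \<Rightarrow> real"
  assumes K: "finite K" "n \<in> K" "\<tau> ` K \<subseteq> I"
  shows "2 * exponent K z \<tau> - exponent K (\<lambda>k. z k + (if k = n then a else 0)) \<tau> - exponent K (\<lambda>k. z k - (if k = n then a else 0)) \<tau>
    = (\<integral>x. 2 * (of_real (1 - cos (a * f (\<tau> n) x)) * iexp (\<Sum>k\<in>K. z k * f (\<tau> k) x)) \<partial>M)"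
proof -
  have h: "f (\<tau> k) \<in> L_sum M" if "k \<in> K" for k using K that f_L_sum by auto
  note int = integrable_levy_integrand[OF K(1), of "\<lambda>k. f (\<tau> k)", OF h]
  define zp where "zp k = z k + (if k = n then a else 0)" for k
  define zm where "zm k = z k - (if k = n then a else 0)" for k
  have sp: "(\<Sum>k\<in>K. zp k * b k) = (\<Sum>k\<in>K. z k * b k) + a * b n" for b :: "'k \<Rightarrow> real"
    using K by (simp add: zp_def distrib_right sum.distrib if_distrib[of "\<lambda>x. x * _"] sum.delta cong: if_cong)
  have sm: "(\<Sum>k\<in>K. zm k * b k) = (\<Sum>k\<in>K. z k * b k) - a * b n" for b :: "'k \<Rightarrow> real"
    using K by (simp add: zm_def left_diff_distrib sum_subtractf if_distrib[of "\<lambda>x. x * _"] sum.delta cong: if_cong)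
  have "2 * exponent K z \<tau> - exponent K zp \<tau> - exponent K zm \<tau> =
    2 * (\<integral>x. levy_integrand K z (\<lambda>k. f (\<tau> k) x) \<partial>M) - (\<integral>x. levy_integrand K zp (\<lambda>k. f (\<tau> k) x) \<partial>M)
      - (\<integral>x. levy_integrand K zm (\<lambda>k. f (\<tau> k) x) \<partial>M)"
    by (simp add: exponent_def sp sm algebra_simps)
  also have "\<dots> = (\<integral>x. 2 * levy_integrand K z (\<lambda>k. f (\<tau> k) x) - levy_integrand K zp (\<lambda>k. f (\<tau> k) x) - levy_integrand K zm (\<lambda>k. f (\<tau> k) x) \<partial>M)"
    using int by simp
  also have "\<dots> = (\<integral>x. 2 * (of_real (1 - cos (a * f (\<tau> n) x)) * iexp (\<Sum>k\<in>K. z k * f (\<tau> k) x)) \<partial>M)"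
  proof (rule Bochner_Integration.integral_cong[OF refl])
    fix x
    define l where "l = (\<Sum>k\<in>K. z k * f (\<tau> k) x)"
    define v where "v = a * f (\<tau> n) x"
    have c: "complex_of_real (cos v) = (iexp v + iexp (- v)) / 2"
      by (simp add: cos_of_real[symmetric] cos_exp_eq)
    have "\<i> * complex_of_real (l + v) = \<i> * of_real l + \<i> * of_real v"
      "\<i> * complex_of_real (l - v) = \<i> * of_real l + \<i> * of_real (- v)"
      by (simp_all add: algebra_simps)
    then have e: "iexp (l + v) = iexp l * iexp v" "iexp (l - v) = iexp l * iexp (- v)"
      by (simp_all only: exp_add)
    have "2 * levy_integrand K z (\<lambda>k. f (\<tau> k) x) - levy_integrand K zp (\<lambda>k. f (\<tau> k) x) - levy_integrand K zm (\<lambda>k. f (\<tau> k) x)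
      = 2 * iexp l - iexp (l + v) - iexp (l - v)"
      unfolding levy_integrand_def sp sm l_def[symmetric] v_def[symmetric] by (simp add: algebra_simps)
    also have "\<dots> = 2 * (of_real (1 - cos v) * iexp l)"
      unfolding e unfolding of_real_diff of_real_1 c by (simp add: field_simps)
    finally show "2 * levy_integrand K z (\<lambda>k. f (\<tau> k) x) - levy_integrand K zp (\<lambda>k. f (\<tau> k) x) - levy_integrand K zm (\<lambda>k. f (\<tau> k) x)
      = 2 * (of_real (1 - cos (a * f (\<tau> n) x)) * iexp (\<Sum>k\<in>K. z k * f (\<tau> k) x))"
      by (simp only: l_def v_def)
  qed
  finally show ?thesis unfolding zp_def zm_def .
qed

lemma weighted_char_shift:
  fixes z :: "'k \<Rightarrow> real"
  assumes K: "finite K" "n \<in> K" "\<tau> ` K \<subseteq> I" and u: "u \<in> I"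
  shows "(\<integral>x. of_real (1 - cos (a * f (\<tau> n + u) x)) * iexp (\<Sum>k\<in>K. z k * f (\<tau> k + u) x) \<partial>M)
    = (\<integral>x. of_real (1 - cos (a * f (\<tau> n) x)) * iexp (\<Sum>k\<in>K. z k * f (\<tau> k) x) \<partial>M)"
proof -
  have \<tau>u: "(\<lambda>k. \<tau> k + u) ` K \<subseteq> I" using K u I_add by auto
  have "(\<integral>x. 2 * (of_real (1 - cos (a * f (\<tau> n + u) x)) * iexp (\<Sum>k\<in>K. z k * f (\<tau> k + u) x)) \<partial>M)
    = (\<integral>x. 2 * (of_real (1 - cos (a * f (\<tau> n) x)) * iexp (\<Sum>k\<in>K. z k * f (\<tau> k) x)) \<partial>M)"
    unfolding second_difference[OF K, symmetric] second_difference[OF K(1,2) \<tau>u, symmetric]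
    by (simp only: exponent_shift[OF K(1,3) u])
  then show ?thesis by (simp only: integral_mult_right_zero) simp
qed

text \<open>
  For each weight \<open>1 - cos (y n / (j + 1))\<close> the weighted laws are finite measures with equal Fourier
  transforms.  At a sequence with \<open>y n \<noteq> 0\<close> the weight is positive as soon as
  \<open>\<bar>y n\<bar> < j\<close>.
\<close>

lemma sum_shift_invariant:
  assumes s: "range s \<subseteq> I" and u: "u \<in> I" and A: "A \<in> sets pathspace" "(\<lambda>_. 0) \<notin> A"
  shows "emeasure M {x \<in> space M. (\<lambda>n. f (s n + u) x) \<in> A} = emeasure M {x \<in> space M. (\<lambda>n. f (s n) x) \<in> A}"
proof -
  have sI: "s n \<in> I" "s n + u \<in> I" for n using s u I_add by auto
  define g where "g \<sigma> x n = f (\<sigma> n) x" for \<sigma> :: "nat \<Rightarrow> 't" and x n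
  define \<nu> where "\<nu> \<sigma> = distr M pathspace (g \<sigma>)" for \<sigma>
  have mg: "g \<sigma> \<in> M \<rightarrow>\<^sub>M pathspace" if "\<And>n. \<sigma> n \<in> I" for \<sigma>
    unfolding g_def using f_measurable that by (intro measurable_PiM_single') auto
  define w where "w i y = (case prod_decode i of (n, j) \<Rightarrow> 1 - cos ((1 / real (Suc j)) * y n))" for i and y :: "nat \<Rightarrow> real"
  have w[measurable]: "w i \<in> borel_measurable pathspace" for i
    unfolding w_def by (cases "prod_decode i") simp
  have w_nn: "w i y \<ge> 0" for i y by (auto simp: w_def split: prod.split)
  define s' where "s' n = s n + u" for n
  have dens: "density (\<nu> s') (\<lambda>y. ennreal (w i y)) = density (\<nu> s) (\<lambda>y. ennreal (w i y))" for i
  proof -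
    obtain n j where i: "prod_decode i = (n, j)" by force
    define a where "a = 1 / real (Suc j)"
    have a: "\<bar>a\<bar> \<le> 1" by (simp add: a_def)
    have wi: "w i y = 1 - cos (a * y n)" for y by (simp add: w_def i a_def)
    have fin: "finite_measure (density (\<nu> \<sigma>) (\<lambda>y. ennreal (w i y)))" if \<sigma>: "\<And>n. \<sigma> n \<in> I" for \<sigma>
    proof (rule finite_measureI)
      note [measurable] = mg[OF \<sigma>]
      have "emeasure (density (\<nu> \<sigma>) (\<lambda>y. ennreal (w i y))) UNIV = (\<integral>\<^sup>+y. ennreal (w i y) \<partial>\<nu> \<sigma>)"
        using sets.top[of "\<nu> \<sigma>"] by (subst emeasure_density) (auto simp: \<nu>_def space_PiM)
      also have "\<dots> = (\<integral>\<^sup>+x. ennreal (1 - cos (a * f (\<sigma> n) x)) \<partial>M)"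
        unfolding \<nu>_def by (subst nn_integral_distr) (auto simp: wi g_def)
      also have "\<dots> = ennreal (\<integral>x. 1 - cos (a * f (\<sigma> n) x) \<partial>M)"
        by (intro nn_integral_eq_integral integrable_one_minus_cos[OF f_L_sum[OF \<sigma>] a]) auto
      finally show "emeasure (density (\<nu> \<sigma>) (\<lambda>y. ennreal (w i y))) (space (density (\<nu> \<sigma>) (\<lambda>y. ennreal (w i y)))) \<noteq> \<infinity>"
        by (simp add: \<nu>_def space_PiM)
    qed
    show ?thesis
    proof (rule finite_pathspace_measure_char_unique)
      fix K :: "nat set" and z :: "nat \<Rightarrow> real" assume K: "finite K"
      define z0 where "z0 k = (if k \<in> K then z k else 0)" for k
      have z0: "(\<Sum>k\<in>insert n K. z0 k * y k) = (\<Sum>k\<in>K. z k * y k)" for y :: "nat \<Rightarrow> real"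
        using K by (intro sum.mono_neutral_cong_right) (auto simp: z0_def)
      have ch: "(\<integral>y. iexp (\<Sum>k\<in>K. z k * y k) \<partial>density (\<nu> \<sigma>) (\<lambda>y. ennreal (w i y))) =
         (\<integral>x. of_real (1 - cos (a * f (\<sigma> n) x)) * iexp (\<Sum>k\<in>insert n K. z0 k * f (\<sigma> k) x) \<partial>M)" if \<sigma>: "\<And>n. \<sigma> n \<in> I" for \<sigma>
      proof -
        note [measurable] = mg[OF \<sigma>]
        have m[measurable]: "(\<lambda>y. iexp (\<Sum>k\<in>K. z k * y k)) \<in> borel_measurable pathspace" by measurable
        have "(\<integral>y. iexp (\<Sum>k\<in>K. z k * y k) \<partial>density (\<nu> \<sigma>) (\<lambda>y. ennreal (w i y))) = (\<integral>y. w i y *\<^sub>R iexp (\<Sum>k\<in>K. z k * y k) \<partial>\<nu> \<sigma>)"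
          using w_nn m w[of i] by (subst integral_density) (auto simp: \<nu>_def)
        also have "\<dots> = (\<integral>x. w i (g \<sigma> x) *\<^sub>R iexp (\<Sum>k\<in>K. z k * g \<sigma> x k) \<partial>M)"
          unfolding \<nu>_def by (subst integral_distr) measurable
        finally show ?thesis unfolding z0 by (simp add: wi g_def scaleR_conv_of_real)
      qed
      have "s ` insert n K \<subseteq> I" using sI by auto
      from weighted_char_shift[OF _ insertI1 this u, of a z0] K
      show "(\<integral>y. iexp (\<Sum>k\<in>K. z k * y k) \<partial>density (\<nu> s') (\<lambda>y. ennreal (w i y))) =
        (\<integral>y. iexp (\<Sum>k\<in>K. z k * y k) \<partial>density (\<nu> s) (\<lambda>y. ennreal (w i y)))"
        using ch[of s'] ch[of s] sI by (simp add: s'_def)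
    qed (use fin[of s'] fin[of s] sI in \<open>auto simp: \<nu>_def s'_def\<close>)
  qed
  have "emeasure (\<nu> s') A = emeasure (\<nu> s) A"
  proof (rule emeasure_eq_of_density_eq[where N = pathspace and w = w])
    show "density (\<nu> s') (\<lambda>y. ennreal (w k y)) = density (\<nu> s) (\<lambda>y. ennreal (w k y))" for k by (rule dens)
    fix y assume y: "y \<in> A"
    then obtain n where n: "y n \<noteq> 0" using A(2) by (metis ext)
    obtain j where j: "\<bar>y n\<bar> < real j" using reals_Archimedean2 by blast
    define v where "v = (1 / real (Suc j)) * y n"
    have v: "0 < \<bar>v\<bar>" "\<bar>v\<bar> \<le> 1" using n j by (auto simp: v_def abs_mult)
    have "cos \<bar>v\<bar> < cos 0" using v pi_gt3 by (intro cos_monotone_0_pi) auto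
    moreover have "w (prod_encode (n, j)) y = 1 - cos v" by (simp add: w_def v_def)
    ultimately have "w (prod_encode (n, j)) y > 0" by simp
    then show "\<exists>k. 0 < w k y" ..
  qed (use A in \<open>auto simp: \<nu>_def\<close>)
  moreover have "emeasure (\<nu> \<sigma>) A = emeasure M {x \<in> space M. g \<sigma> x \<in> A}" if \<sigma>: "\<And>n. \<sigma> n \<in> I" for \<sigma>
    unfolding \<nu>_def using mg[OF \<sigma>] A(1) by (simp add: emeasure_distr vimage_def Int_def conj_commute)
  ultimately have "emeasure M {x \<in> space M. g s' x \<in> A} = emeasure M {x \<in> space M. g s x \<in> A}"
    using sI by (simp add: s'_def)
  moreover have "g \<sigma> = (\<lambda>x n. f (\<sigma> n) x)" for \<sigma> by (simp add: g_def fun_eq_iff)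
  ultimately show ?thesis by (simp add: s'_def)
qed

text \<open>
  The modulus of a characteristic function involves only the real part of the exponent, so
  compensators and shifts drop out.
\<close>

lemma increment_levy:
  assumes u: "u \<in> I"
  shows "integrable M (\<lambda>x. 1 - cos (a * (f u x - f 0 x)))"
    and "norm (\<integral>\<omega>. iexp (a * (X u \<omega> - X 0 \<omega>)) \<partial>P) = exp (- (\<integral>x. 1 - cos (a * (f u x - f 0 x)) \<partial>M))"
proof -
  define \<tau> where "\<tau> k = (if k then u else 0)" for k
  define z where "z k = (if k then a else - a)" for k
  have \<tau>: "finite (UNIV :: bool set)" "range \<tau> \<subseteq> I" using u I0 by (auto simp: \<tau>_def)
  have h: "f (\<tau> k) \<in> L_sum M" for k using \<tau>(2) f_L_sum by auto
  have sumX: "(\<Sum>k\<in>UNIV. z k * X (\<tau> k) \<omega>) = a * (X u \<omega> - X 0 \<omega>)" for \<omega>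
    by (simp add: UNIV_bool z_def \<tau>_def algebra_simps)
  have sumf: "(\<Sum>k\<in>UNIV. z k * f (\<tau> k) x) = a * (f u x - f 0 x)" for x
    by (simp add: UNIV_bool z_def \<tau>_def algebra_simps)
  have int: "integrable M (\<lambda>x. levy_integrand UNIV z (\<lambda>k. f (\<tau> k) x))"
    by (intro integrable_levy_integrand \<tau> h)
  have Re_eq: "Re (levy_integrand UNIV z (\<lambda>k. f (\<tau> k) x)) = - (1 - cos (a * (f u x - f 0 x)))" for x
    unfolding levy_integrand_def sumf by (simp add: Re_exp)
  have "integrable M (\<lambda>x. - (1 - cos (a * (f u x - f 0 x))))" using integrable_Re[OF int] unfolding Re_eq .
  from Bochner_Integration.integrable_minus[OF this]
  show "integrable M (\<lambda>x. 1 - cos (a * (f u x - f 0 x)))" unfolding minus_minus .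
  have "(\<integral>\<omega>. iexp (a * (X u \<omega> - X 0 \<omega>)) \<partial>P) = exp (exponent UNIV z \<tau>)"
    using char_eq_exp_exponent[OF \<tau>, of z] unfolding sumX .
  then have "norm (\<integral>\<omega>. iexp (a * (X u \<omega> - X 0 \<omega>)) \<partial>P) = exp (Re (exponent UNIV z \<tau>))" by simp
  also have "Re (exponent UNIV z \<tau>) = (\<integral>x. Re (levy_integrand UNIV z (\<lambda>k. f (\<tau> k) x)) \<partial>M)"
    unfolding exponent_def using integral_Re[OF int] by simp
  also have "\<dots> = - (\<integral>x. 1 - cos (a * (f u x - f 0 x)) \<partial>M)" unfolding Re_eq by (rule Bochner_Integration.integral_minus)
  finally show "norm (\<integral>\<omega>. iexp (a * (X u \<omega> - X 0 \<omega>)) \<partial>P) = exp (- (\<integral>x. 1 - cos (a * (f u x - f 0 x)) \<partial>M))" .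
qed

lemma increment_tendsto:
  "((\<lambda>u. \<integral>x. 1 - cos (a * (f u x - f 0 x)) \<partial>M) \<longlongrightarrow> 0) (at 0 within I)"
proof -
  let ?F = "at 0 within I"
  interpret P: prob_space P using XP by (simp add: process_on_def)
  define \<phi> where "\<phi> u = (\<integral>\<omega>. iexp (a * (X u \<omega> - X 0 \<omega>)) \<partial>P)" for u
  have bound: "norm (\<phi> u - 1) \<le> \<bar>a\<bar> * \<delta> + 2 * measure P {\<omega> \<in> space P. \<delta> < \<bar>X u \<omega> - X 0 \<omega>\<bar>}"
    if u: "u \<in> I" and \<delta>: "\<delta> > 0" for u \<delta>
  proof -
    note [measurable] = X_measurable[OF u] X_measurable[OF I0]
    have m[measurable]: "(\<lambda>\<omega>. iexp (a * (X u \<omega> - X 0 \<omega>))) \<in> borel_measurable P" by measurable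
    have i: "integrable P (\<lambda>\<omega>. iexp (a * (X u \<omega> - X 0 \<omega>)))"
      by (rule P.integrable_const_bound[of _ 1]) (auto simp only: norm_exp_i_times m order_refl eventually_True)
    let ?A = "{\<omega> \<in> space P. \<delta> < \<bar>X u \<omega> - X 0 \<omega>\<bar>}"
    have "\<phi> u - 1 = (\<integral>\<omega>. iexp (a * (X u \<omega> - X 0 \<omega>)) - 1 \<partial>P)"
      unfolding \<phi>_def using i by (subst Bochner_Integration.integral_diff) (auto simp: P.prob_space)
    also have "norm \<dots> \<le> (\<integral>\<omega>. norm (iexp (a * (X u \<omega> - X 0 \<omega>)) - 1) \<partial>P)" by (rule integral_norm_bound)
    also have "\<dots> \<le> (\<integral>\<omega>. \<bar>a\<bar> * \<delta> + 2 * indicator ?A \<omega> \<partial>P)"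
    proof (rule integral_mono)
      show "integrable P (\<lambda>\<omega>. norm (iexp (a * (X u \<omega> - X 0 \<omega>)) - 1))"
        by (intro integrable_norm Bochner_Integration.integrable_diff i P.integrable_const)
      show "integrable P (\<lambda>\<omega>. \<bar>a\<bar> * \<delta> + 2 * indicator ?A \<omega>)"
        by (intro Bochner_Integration.integrable_add P.integrable_const integrable_mult_right integrable_real_indicator)
           (auto simp: P.emeasure_eq_measure)
      fix \<omega> assume \<omega>: "\<omega> \<in> space P"
      define y where "y = a * (X u \<omega> - X 0 \<omega>)"
      have n2: "norm (iexp y - 1) \<le> 2"
        using norm_triangle_ineq4[of "iexp y" 1] unfolding norm_exp_i_times by simp
      have "norm (iexp y - 1) \<le> \<bar>y\<bar>" using iexp_approx1[of y 0] by simp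
      then have n1: "norm (iexp y - 1) \<le> \<bar>a\<bar> * \<bar>X u \<omega> - X 0 \<omega>\<bar>" by (simp add: y_def abs_mult)
      show "norm (iexp (a * (X u \<omega> - X 0 \<omega>)) - 1) \<le> \<bar>a\<bar> * \<delta> + 2 * indicator ?A \<omega>"
        unfolding y_def[symmetric]
      proof (cases "\<omega> \<in> ?A")
        case True
        have "0 \<le> \<bar>a\<bar> * \<delta>" using \<delta> by simp
        with n2 show "norm (iexp y - 1) \<le> \<bar>a\<bar> * \<delta> + 2 * indicator ?A \<omega>"
          unfolding indicator_simps(1)[OF True] by linarith
      next
        case False
        then have "\<bar>X u \<omega> - X 0 \<omega>\<bar> \<le> \<delta>" using \<omega> by simp
        then have "\<bar>a\<bar> * \<bar>X u \<omega> - X 0 \<omega>\<bar> \<le> \<bar>a\<bar> * \<delta>" by (rule mult_left_mono) simp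
        with n1 show "norm (iexp y - 1) \<le> \<bar>a\<bar> * \<delta> + 2 * indicator ?A \<omega>"
          unfolding indicator_simps(2)[OF False] by linarith
      qed
    qed
    also have "\<dots> = \<bar>a\<bar> * \<delta> + 2 * measure P ?A"
      by (subst Bochner_Integration.integral_add) (auto simp: P.prob_space P.emeasure_eq_measure)
    finally show ?thesis .
  qed
  have "(\<phi> \<longlongrightarrow> 1) ?F"
  proof (rule tendstoI)
    fix r :: real assume r: "r > 0"
    \<comment> \<open>The summand \<open>1\<close> covers the case \<open>a = 0\<close>.\<close>
    define \<delta> where "\<delta> = r / (2 * (\<bar>a\<bar> + 1))"
    have \<delta>: "\<delta> > 0" using r by (simp add: \<delta>_def)
    have "\<bar>a\<bar> * \<delta> \<le> (\<bar>a\<bar> + 1) * \<delta>" using \<delta> by (intro mult_right_mono) auto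
    also have "\<dots> = r / 2" by (simp add: \<delta>_def field_simps)
    finally have a\<delta>: "\<bar>a\<bar> * \<delta> \<le> r / 2" .
    have "eventually (\<lambda>u. measure P {\<omega> \<in> space P. \<delta> < \<bar>X u \<omega> - X 0 \<omega>\<bar>} < r / 4) ?F"
      using r by (intro order_tendstoD(2)[OF stochastic_continuity_at_0[OF \<delta>]]) auto
    then show "eventually (\<lambda>u. dist (\<phi> u) 1 < r) ?F"
      using eventually_in_index
    proof eventually_elim
      case (elim u)
      show ?case using bound[OF elim(2) \<delta>] elim(1) a\<delta> unfolding dist_norm by linarith
    qed
  qed
  then have "((\<lambda>u. - ln (norm (\<phi> u))) \<longlongrightarrow> - ln (norm (1::complex))) ?F"
    by (intro tendsto_intros) auto
  then have "((\<lambda>u. - ln (norm (\<phi> u))) \<longlongrightarrow> 0) ?F" by simp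
  moreover from eventually_in_index have "eventually (\<lambda>u. - ln (norm (\<phi> u)) = (\<integral>x. 1 - cos (a * (f u x - f 0 x)) \<partial>M)) ?F"
    by eventually_elim (simp only: \<phi>_def increment_levy(2) ln_exp minus_minus)
  ultimately show ?thesis by (rule Lim_transform_eventually)
qed

text \<open>
  The integral of \<open>1 - cos ((f u - f 0) / L)\<close> controls the part of \<open>{\<bar>f u - f 0\<bar> > e}\<close> where the
  difference is at most \<open>L\<close>, because the cosine decreases on \<open>[0, 1]\<close>.  The remaining part lies
  in the tails of \<open>f u\<close> and \<open>f 0\<close>, which have the same measure by shift invariance.
\<close>

lemma sum_continuous_at_0:
  assumes e: "e > 0"
  shows "((\<lambda>u. measure M {x \<in> space M. e < \<bar>f u x - f 0 x\<bar>}) \<longlongrightarrow> 0) (at 0 within I)"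
proof (rule order_tendstoI)
  let ?F = "at 0 within I"
  fix r :: real assume r: "0 < r"
  note m0[measurable] = f_measurable[OF I0]
  have "(\<lambda>N. measure M {x \<in> space M. real (Suc N) * e < \<bar>f 0 x\<bar>}) \<longlonglongrightarrow> 0"
    by (rule tail_tendsto_0[OF m0 e L_sum_tail[OF f_L_sum[OF I0]]])
  then have "eventually (\<lambda>N. measure M {x \<in> space M. real (Suc N) * e < \<bar>f 0 x\<bar>} < r / 4) sequentially"
    using r by (intro order_tendstoD(2)) auto
  then obtain N where N: "measure M {x \<in> space M. real (Suc N) * e < \<bar>f 0 x\<bar>} < r / 4"
    by (auto simp: eventually_sequentially)
  define h where "h = real (Suc N) * e"
  define L where "L = 2 * h"
  have h: "h > 0" "e \<le> h" using e by (auto simp: h_def)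
  then have L: "L > 0" "e < L" by (auto simp: L_def)
  have "e / L \<le> 1" using L by simp
  then have "e / L \<le> pi" using pi_gt3 by linarith
  then have "cos (e / L) < cos 0" using e L by (intro cos_monotone_0_pi) auto
  then have d: "1 - cos (e / L) > 0" by simp
  have "eventually (\<lambda>u. (\<integral>x. 1 - cos ((1 / L) * (f u x - f 0 x)) \<partial>M) < r / 2 * (1 - cos (e / L))) ?F"
    using r d by (intro order_tendstoD(2)[OF increment_tendsto]) auto
  then show "eventually (\<lambda>u. measure M {x \<in> space M. e < \<bar>f u x - f 0 x\<bar>} < r) ?F"
    using eventually_in_index
  proof eventually_elim
    case (elim u)
    have u: "u \<in> I" by fact
    note mu[measurable] = f_measurable[OF u]
    let ?S = "{x \<in> space M. e < \<bar>f u x - f 0 x\<bar> \<and> \<bar>f u x - f 0 x\<bar> \<le> L}"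
    have finS: "emeasure M ?S < \<infinity>"
    proof -
      have "emeasure M ?S \<le> emeasure M {x \<in> space M. e < \<bar>f u x - f 0 x\<bar>}" by (intro emeasure_mono) auto
      also have "\<dots> < \<infinity>"
        by (intro difference_tail_finite L_sum_tail f_L_sum mu m0 u I0) (use e in simp_all)
      finally show ?thesis .
    qed
    have "(1 - cos (e / L)) * measure M ?S = (\<integral>x. (1 - cos (e / L)) * indicator ?S x \<partial>M)" by simp
    also have "\<dots> \<le> (\<integral>x. 1 - cos ((1 / L) * (f u x - f 0 x)) \<partial>M)"
    proof (rule integral_mono)
      show "integrable M (\<lambda>x. (1 - cos (e / L)) * indicator ?S x)"
        using finS by (intro integrable_mult_right integrable_real_indicator) auto
      show "integrable M (\<lambda>x. 1 - cos ((1 / L) * (f u x - f 0 x)))" by (rule increment_levy(1)[OF u])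
      fix x assume "x \<in> space M"
      show "(1 - cos (e / L)) * indicator ?S x \<le> 1 - cos ((1 / L) * (f u x - f 0 x))"
      proof (cases "x \<in> ?S")
        case True
        define y where "y = \<bar>f u x - f 0 x\<bar> / L"
        have "e / L \<le> y" "y \<le> 1" using True L by (auto simp: y_def divide_right_mono)
        then have "cos y \<le> cos (e / L)" using e L pi_gt3 by (intro cos_monotone_0_pi_le) auto
        moreover have "cos y = cos ((1 / L) * (f u x - f 0 x))"
        proof -
          have "y = \<bar>(1 / L) * (f u x - f 0 x)\<bar>" using L by (simp add: y_def abs_mult)
          then show ?thesis by (simp only: cos_abs_real)
        qed
        ultimately show ?thesis using True by simp
      qed simp
    qed
    also have "\<dots> < r / 2 * (1 - cos (e / L))" by fact
    finally have S: "measure M ?S < r / 2" using d by (simp add: mult.commute)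
    have tail_u: "measure M {x \<in> space M. h < \<bar>f u x\<bar>} = measure M {x \<in> space M. h < \<bar>f 0 x\<bar>}"
    proof -
      have A: "{y. h < \<bar>y 0\<bar>} \<in> sets pathspace"
        by (intro pathspace_Collect) measurable
      have "emeasure M {x \<in> space M. h < \<bar>f u x\<bar>} = emeasure M {x \<in> space M. h < \<bar>f 0 x\<bar>}"
        using sum_shift_invariant[of "\<lambda>_. 0" u, OF _ u A] I0 h by auto
      then show ?thesis by (simp add: measure_def)
    qed
    let ?T = "{x \<in> space M. h < \<bar>f u x\<bar>} \<union> {x \<in> space M. h < \<bar>f 0 x\<bar>}"
    have finT: "emeasure M {x \<in> space M. h < \<bar>f t x\<bar>} \<noteq> \<infinity>" if "t \<in> I" for t
      using L_sum_tail[OF f_L_sum[OF that] h(1)] by simp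
    have finST: "emeasure M (?S \<union> ?T) \<noteq> \<infinity>"
    proof -
      have "emeasure M (?S \<union> ?T) \<le> emeasure M ?S + emeasure M ?T" by (intro emeasure_subadditive) auto
      also have "\<dots> \<le> emeasure M ?S + (emeasure M {x \<in> space M. h < \<bar>f u x\<bar>} + emeasure M {x \<in> space M. h < \<bar>f 0 x\<bar>})"
        by (intro add_left_mono emeasure_subadditive) auto
      also have "\<dots> < \<infinity>" using finS finT[OF u] finT[OF I0] by (simp add: less_top)
      finally show ?thesis by simp
    qed
    have "measure M {x \<in> space M. e < \<bar>f u x - f 0 x\<bar>} \<le> measure M (?S \<union> ?T)"
      using finST by (intro measure_mono_fmeasurable) (auto simp: L_def fmeasurable_def less_top)
    also have "\<dots> \<le> measure M ?S + measure M ?T" by (intro measure_Un_le) auto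
    also have "\<dots> \<le> measure M ?S + (measure M {x \<in> space M. h < \<bar>f u x\<bar>} + measure M {x \<in> space M. h < \<bar>f 0 x\<bar>})"
      by (intro add_left_mono measure_Un_le) auto
    finally show ?case using S N tail_u unfolding h_def by linarith
  qed
next
  fix r :: real assume "r < 0"
  then show "eventually (\<lambda>u. r < measure M {x \<in> space M. e < \<bar>f u x - f 0 x\<bar>}) (at 0 within I)"
    by (intro always_eventually allI) (auto intro: less_le_trans)
qed

end

section \<open>The flow of a stationary process\<close>

theorem theorem3p1:
  fixes I :: "(real ^ 'd::finite) set"
    and P :: "'p measure" and X :: "real ^ 'd \<Rightarrow> 'p \<Rightarrow> real"
    and M :: "'w measure" and f :: "real ^ 'd \<Rightarrow> 'w \<Rightarrow> real" and c :: "real ^ 'd \<Rightarrow> real"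
    and Q :: "'q measure" and U :: "nat \<Rightarrow> 'q \<Rightarrow> 'w" and J :: "'q \<Rightarrow> nat set"
  assumes "I = UNIV \<or> I = integer_lattice"
    and "process_on I P X"
    and "stationary I P X"
    and "stochastically_continuous I P X"
    and "sigma_finite_borel M"
    and "poisson_point_process Q M U J"
    and "minimal_rep I M f"
  shows "(max_id I P X \<and> (\<forall>t\<in>I. essinf P (X t) = 0) \<and> max_spectral_rep I P X M f Q U J \<longrightarrow>
            (\<exists>T. measure_preserving_flow I M T \<and> measurable_flow I M T \<and>
                 (\<forall>t\<in>I. AE x in M. f t x = f 0 (T t x)))) \<and>
         (sum_id I P X \<and> without_gaussian_component I P X \<and>
          sum_spectral_rep I P X M f c Q U J \<longrightarrow>
            (\<exists>T. measure_preserving_flow I M T \<and> measurable_flow I M T \<and>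
                 (\<forall>t\<in>I. AE x in M. f t x = f 0 (T t x))) \<and>
            (\<exists>k. \<forall>t\<in>I. c t = k))"
proof (intro conjI[of "_ \<longrightarrow> _"] impI; elim conjE)
  have I_add: "\<forall>t\<in>I. \<forall>u\<in>I. t + u \<in> I" and I0: "0 \<in> I"
    using assms(1) by (auto simp: integer_lattice_def)
  {
    assume rep: "max_spectral_rep I P X M f Q U J"
    interpret max_representation I P X M f Q U J
      by unfold_locales (use assms I_add I0 rep in auto)
    interpret shift_invariant_family I M f
    proof
      fix s :: "nat \<Rightarrow> real ^ 'd" and u A
      assume "range s \<subseteq> I" "u \<in> I" "A \<in> sets pathspace" "(\<lambda>_. 0) \<notin> A"
      then show "emeasure M {x \<in> space M. (\<lambda>n. f (s n + u) x) \<in> A} = emeasure M {x \<in> space M. (\<lambda>n. f (s n) x) \<in> A}"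
        by (rule max_shift_invariant)
    next
      fix e r :: real assume "e > 0" "r > 0"
      then show "\<exists>\<delta>>0. \<forall>u\<in>I. norm u < \<delta> \<longrightarrow> emeasure M {x \<in> space M. e < \<bar>f u x - f 0 x\<bar>} \<le> ennreal r"
        using max_continuous_at_0 f_measurable f_abs_tail
        by (intro continuity_modulus[OF _ I0]) auto
    qed (use assms f_measurable in auto)
    show "\<exists>T. measure_preserving_flow I M T \<and> measurable_flow I M T \<and> (\<forall>t\<in>I. AE x in M. f t x = f 0 (T t x))"
      using ex_flow by blast
  next
    assume rep: "sum_spectral_rep I P X M f c Q U J"
    interpret sum_representation I P X M f c Q U J
      by unfold_locales (use assms I_add I0 rep in auto)
    interpret shift_invariant_family I M f
    proof
      fix s :: "nat \<Rightarrow> real ^ 'd" and u A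
      assume "range s \<subseteq> I" "u \<in> I" "A \<in> sets pathspace" "(\<lambda>_. 0) \<notin> A"
      then show "emeasure M {x \<in> space M. (\<lambda>n. f (s n + u) x) \<in> A} = emeasure M {x \<in> space M. (\<lambda>n. f (s n) x) \<in> A}"
        by (rule sum_shift_invariant)
    next
      fix e r :: real assume "e > 0" "r > 0"
      then show "\<exists>\<delta>>0. \<forall>u\<in>I. norm u < \<delta> \<longrightarrow> emeasure M {x \<in> space M. e < \<bar>f u x - f 0 x\<bar>} \<le> ennreal r"
        using sum_continuous_at_0 f_measurable L_sum_tail[OF f_L_sum]
        by (intro continuity_modulus[OF _ I0]) auto
    qed (use assms f_measurable in auto)
    obtain T where T: "measure_preserving_flow I M T" "measurable_flow I M T"
      "\<forall>t\<in>I. T t \<in> M \<rightarrow>\<^sub>M M \<and> distr M M (T t) = M" "\<forall>t\<in>I. AE x in M. f t x = f 0 (T t x)"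
      using ex_flow by blast
    \<comment> \<open>Exponents of the single variables \<open>X t\<close> and \<open>X 0\<close> at frequency \<open>1\<close> are compared.\<close>
    have "c t = c 0" if t: "t \<in> I" for t
    proof -
      define g where "g y = levy_integrand {()} (\<lambda>_. 1) (\<lambda>_. y)" for y
      have g[measurable]: "g \<in> borel_measurable borel"
        using measurable_levy_integrand[of "{()}" "\<lambda>_ y. y" borel "\<lambda>_. 1"] unfolding g_def by auto
      note [measurable] = f_measurable[OF t] f_measurable[OF I0]
      have Tt[measurable]: "T t \<in> M \<rightarrow>\<^sub>M M" and dT: "distr M M (T t) = M" using T(3) t by auto
      have m: "(\<lambda>x. g (f 0 x)) \<in> borel_measurable M" by measurable
      have "(\<integral>x. g (f t x) \<partial>M) = (\<integral>x. g (f 0 (T t x)) \<partial>M)"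
      proof (rule integral_cong_AE)
        show "AE x in M. g (f t x) = g (f 0 (T t x))" using T(4) t by (auto elim!: eventually_mono)
      qed measurable
      also have "\<dots> = (\<integral>x. g (f 0 x) \<partial>distr M M (T t))" by (rule integral_distr[OF Tt m, symmetric])
      finally have "(\<integral>x. g (f t x) \<partial>M) = (\<integral>x. g (f 0 x) \<partial>M)" by (simp only: dT)
      moreover have "exponent {()} (\<lambda>_. 1) (\<lambda>k. 0 + t) = exponent {()} (\<lambda>_. 1) (\<lambda>_. 0)"
        using I0 t by (intro exponent_shift) auto
      ultimately show ?thesis unfolding exponent_def g_def by simp
    qed
    then show "(\<exists>T. measure_preserving_flow I M T \<and> measurable_flow I M T \<and> (\<forall>t\<in>I. AE x in M. f t x = f 0 (T t x))) \<and>
            (\<exists>k. \<forall>t\<in>I. c t = k)"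
      using T by blast
  }
qed

end
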